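(* For each $N$, let $\boldsymbol{x}^{[N]}_t$, $t\in[0,T]$, solve (in the mild sense) the graphon stochastic differential equation $$d\boldsymbol{x}^{[N]}_t=\mathbb{A}^{[N]}\boldsymbol{x}^{[N]}_t\,dt+d\boldsymbol{w}^{[N]}_t,\qquad \boldsymbol{x}^{[N]}_0\in L_2[0,1],$$ where $\mathbf{Q}^{[N]}$ is the covariance operator of $\boldsymbol{w}^{[N]}$, and let $\Phi^{[N]}(t,s)$ be the solution operator of the $N$-th state system. Assume that for each triple $\epsilon_0,\epsilon_1,\epsilon_2>0$ there exists $N_0$ such that for all $N>M>N_0$ (and all $0\le s\le t\le T$) $$\|\boldsymbol{x}^{[N]}_0-\boldsymbol{x}^{[M]}_0\|_2^2<\epsilon_0,\qquad \|\Phi^{[N]}(t,s)-\Phi^{[M]}(t,s)\|_{\mathrm{op}}^2<\epsilon_1,\qquad \mathbb{E}\big[\|\boldsymbol{w}^{[N]}_t-\boldsymbol{w}^{[M]}_t\|_2^2\big]<\epsilon_2,$$ and that there exist $\alpha,C<\infty$ such that, for all $N$, $$\sum_{k=1}^N\sum_{r=1}^N|c^N_{k,r}|^2\le C,\qquad \int_0^t\|\Phi^{[N]}(t,s)\|_{\mathrm{op}}^2\,ds\le\alpha\quad\text{for } t\in[0,T].$$ Then for each $\epsilon>0$ there exists $N_0'$ such that for all $N,M>N_0'$ (and $t\in[0,T]$) $$\mathbb{E}\big[\|\boldsymbol{x}^{[N]}_t-\boldsymbol{x}^{[M]}_t\|_2\big]<\epsilon.$$ Hence there exists an $L_2[0,1]$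 limit process $\boldsymbol{x}^\infty_t$ satisfying $\mathbb{E}[\|\boldsymbol{x}^{[N]}_t-\boldsymbol{x}^\infty_t\|_2]\to0$ as $N\to\infty$, and $\boldsymbol{x}^\infty_t$ is the unique mild solution of the limit system $$d\boldsymbol{x}_t=\mathbb{A}\boldsymbol{x}_t\,dt+d\boldsymbol{w}_t,\qquad \boldsymbol{x}_0\in L_2[0,1].$$
   Context: $\|\cdot\|_2$ is the norm of $L_2[0,1]$ and $\|\cdot\|_{\mathrm{op}}$ the operator norm on $L_2[0,1]$. Partition: $P_1=[0,\tfrac1N]$, $P_i=(\tfrac{i-1}{N},\tfrac{i}{N}]$ for $2\le i\le N$, and $\mathbb{S}^N_k(\alpha)=\mathbf{1}_{P_k}(\alpha)$. $\mathbb{A}^{[N]}=\boldsymbol{A}^{[N]}+a_N\mathbb{I}$ is a bounded operator on $L_2[0,1]$ (possibly depending on time), where $\boldsymbol{A}^{[N]}$ is the integral operator with step-function kernel $\boldsymbol{A}^{[N]}(\alpha,\beta)=\sum_{i,j=1}^N A^N_{ij}\mathbf{1}_{P_i}(\alpha)\mathbf{1}_{P_j}(\beta)$ associated with a symmetric $N\times N$ matrix $A^N$, $a_N\in\mathbb{R}$, and $\mathbb{I}$ is the identity. Noise: $\{W_r\}_{r\ge1}$ is a sequence of independent standard Brownian motions (the same for all $N$), $c^N_{k,r}$ are real coefficients, and $\boldsymbol{w}^{[N]}_t(\alpha)=\sum_{k=1}^N\mathbb{S}^N_k(\alpha)\sum_{r=1}^\infty c^N_{k,r}W_r(t)$. This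 is a Q-noise, i.e. a Gaussian $L_2[0,1]$-valued process with Wiener increments in time and $\mathbb{E}[\boldsymbol{w}^{[N]}_t(\alpha)\boldsymbol{w}^{[N]}_s(\beta)]=\min(t,s)\,\mathbf{Q}^{[N]}(\alpha,\beta)$, with $\mathbf{Q}^{[N]}(\alpha,\beta)=\sum_{i,j=1}^N Q^N_{ij}\mathbf{1}_{P_i}(\alpha)\mathbf{1}_{P_j}(\beta)$ for a covariance matrix $Q^N$. $\Phi^{[N]}(t,s)$ denotes the operator such that $\boldsymbol{y}_t=\Phi^{[N]}(t,s)\boldsymbol{y}_s$ for solutions of $\dot{\boldsymbol{y}}_t=\mathbb{A}^{[N]}\boldsymbol{y}_t$ (so $\Phi^{[N]}(t,s)=e^{\mathbb{A}^{[N]}(t-s)}$ when $\mathbb{A}^{[N]}$ is constant in time). The mild solution of $d\boldsymbol{x}_t=\mathbb{A}\boldsymbol{x}_t\,dt+d\boldsymbol{w}_t$ with solution operator $\Phi$ is $\boldsymbol{x}_t=\Phi(t,0)\boldsymbol{x}_0+\int_0^t\Phi(t,s)\,d\boldsymbol{w}_s$. In the limit system, $\boldsymbol{x}_0$ is the $L_2[0,1]$ limit of $\boldsymbol{x}^{[N]}_0$, $\boldsymbol{w}_t$ is the mean-square $L_2[0,1]$ limit of $\boldsymbol{w}^{[N]}_t$, and $\mathbb{A}$ is the bounded limit operator, whose solution operator $\Phi(t,s)$ is the operator-norm limit of $\Phi^{[N]}(t,s)$. *)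

theory Defs
  imports "HOL-Probability.Probability"
begin

section \<open>The Hilbert space $L_2[0,1]$\<close>

abbreviation unit_interval :: "real measure" where
  "unit_interval \<equiv> restrict_space lborel {0..1}"

definition square_integrable :: "(real \<Rightarrow> real) \<Rightarrow> bool" where
  "square_integrable f \<longleftrightarrow>
     f \<in> borel_measurable unit_interval \<and> integrable unit_interval (\<lambda>x. (f x)\<^sup>2)"

definition L2_rel :: "(real \<Rightarrow> real) \<Rightarrow> (real \<Rightarrow> real) \<Rightarrow> bool" where
  "L2_rel f g \<longleftrightarrow>
     square_integrable f \<and> square_integrable g \<and> (AE x in unit_interval. f x = g x)"

lemma finite_measure_unit_interval: "finite_measure unit_interval"
  by (intro finite_measure_restrict_space finite_measureI)
     (auto simp: emeasure_restrict_space space_restrict_space intro!: finite_measureI)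

lemma square_integrable_mult:
  assumes "square_integrable f" "square_integrable g"
  shows "integrable unit_interval (\<lambda>x. f x * g x)"
proof (rule Bochner_Integration.integrable_bound)
  show "integrable unit_interval (\<lambda>x. (f x)\<^sup>2 + (g x)\<^sup>2)"
    using assms by (auto simp: square_integrable_def)
  show "(\<lambda>x. f x * g x) \<in> borel_measurable unit_interval"
    using assms by (auto simp: square_integrable_def)
  have "\<bar>a * b\<bar> \<le> a\<^sup>2 + b\<^sup>2" for a b :: real
  proof -
    have "2 * (\<bar>a\<bar> * \<bar>b\<bar>) \<le> a\<^sup>2 + b\<^sup>2"
      using sum_squares_bound[of "\<bar>a\<bar>" "\<bar>b\<bar>"] by simp
    then show ?thesis
      using zero_le_power2[of a] zero_le_power2[of b] by (simp only: abs_mult)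
  qed
  then show "AE x in unit_interval. norm (f x * g x) \<le> norm ((f x)\<^sup>2 + (g x)\<^sup>2)"
    by simp
qed

lemma square_integrable_zero: "square_integrable (\<lambda>x. 0)"
  by (simp add: square_integrable_def)

lemma square_integrable_add:
  assumes "square_integrable f" "square_integrable g"
  shows "square_integrable (\<lambda>x. f x + g x)"
  using assms square_integrable_mult[OF assms]
  by (auto simp: square_integrable_def power2_sum mult.assoc)

lemma square_integrable_scale:
  assumes "square_integrable f"
  shows "square_integrable (\<lambda>x. r * f x)"
  using assms by (auto simp: square_integrable_def power_mult_distrib)

quotient_type L2 = "real \<Rightarrow> real" / partial: L2_rel
proof (rule part_equivpI)
  show "\<exists>x. L2_rel x x"
    by (rule exI[of _ "\<lambda>x. 0"]) (simp add: L2_rel_def square_integrable_zero)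
  show "symp L2_rel"
    by (rule sympI) (auto simp: L2_rel_def elim: eventually_mono)
  show "transp L2_rel"
    by (rule transpI) (auto simp: L2_rel_def elim: AE_mp)
qed

instantiation L2 :: real_inner
begin

lift_definition zero_L2 :: L2 is "\<lambda>x. 0"
  by (simp add: L2_rel_def square_integrable_zero)

lift_definition plus_L2 :: "L2 \<Rightarrow> L2 \<Rightarrow> L2" is "\<lambda>f g x. f x + g x"
  by (auto simp: L2_rel_def square_integrable_add)

lift_definition uminus_L2 :: "L2 \<Rightarrow> L2" is "\<lambda>f x. - f x"
  by (auto simp: L2_rel_def dest: square_integrable_scale[of _ "-1"])

lift_definition scaleR_L2 :: "real \<Rightarrow> L2 \<Rightarrow> L2" is "\<lambda>r f x. r * f x"
  by (auto simp: L2_rel_def square_integrable_scale)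

lift_definition inner_L2 :: "L2 \<Rightarrow> L2 \<Rightarrow> real" is "\<lambda>f g. LINT x|unit_interval. f x * g x"
  unfolding L2_rel_def
  by (rule integral_cong_AE)
     (auto simp: square_integrable_def elim: AE_mp)

definition minus_L2 :: "L2 \<Rightarrow> L2 \<Rightarrow> L2" where "minus_L2 f g = f + (- g)"

definition norm_L2 :: "L2 \<Rightarrow> real" where "norm_L2 f = sqrt (inner f f)"

definition sgn_L2 :: "L2 \<Rightarrow> L2" where "sgn_L2 f = inverse (norm f) *\<^sub>R f"

definition dist_L2 :: "L2 \<Rightarrow> L2 \<Rightarrow> real" where "dist_L2 f g = norm (f - g)"

definition uniformity_L2 :: "(L2 \<times> L2) filter" where
  "uniformity_L2 = (INF e\<in>{0<..}. principal {(x, y). dist x y < e})"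

definition open_L2 :: "L2 set \<Rightarrow> bool" where
  "open_L2 U \<longleftrightarrow> (\<forall>x\<in>U. eventually (\<lambda>(x', y). x' = x \<longrightarrow> y \<in> U) uniformity)"

instance
proof
  fix f g h :: L2 and r s :: real
  show "f + g + h = f + (g + h)"
    by transfer (auto simp: L2_rel_def square_integrable_add add.assoc)
  show "f + g = g + f"
    by transfer (auto simp: L2_rel_def square_integrable_add add.commute)
  show "0 + f = f"
    by transfer (auto simp: L2_rel_def)
  show "- f + f = 0"
    by transfer (auto simp: L2_rel_def square_integrable_zero)
  show "f - g = f + - g"
    by (simp add: minus_L2_def)
  show "r *\<^sub>R (f + g) = r *\<^sub>R f + r *\<^sub>R g"
    by transfer (auto simp: L2_rel_def square_integrable_add square_integrable_scale algebra_simps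
        intro!: square_integrable_scale square_integrable_add)
  show "(r + s) *\<^sub>R f = r *\<^sub>R f + s *\<^sub>R f"
    by transfer (auto simp: L2_rel_def distrib_right
        intro!: square_integrable_scale square_integrable_add)
  show "r *\<^sub>R s *\<^sub>R f = (r * s) *\<^sub>R f"
    by transfer (auto simp: L2_rel_def mult.assoc intro!: square_integrable_scale
        dest: square_integrable_scale[of _ "r * s"])
  show "1 *\<^sub>R f = f"
    by transfer (auto simp: L2_rel_def)
  show "sgn f = inverse (norm f) *\<^sub>R f"
    by (simp add: sgn_L2_def)
  show "dist f g = norm (f - g)"
    by (simp add: dist_L2_def)
  show "uniformity = (INF e\<in>{0<..}. principal {(x, y :: L2). dist x y < e})"
    by (simp add: uniformity_L2_def)
  show "open U \<longleftrightarrow> (\<forall>x\<in>U. eventually (\<lambda>(x', y). x' = x \<longrightarrow> y \<in> U) uniformity)"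
    for U :: "L2 set"
    by (simp add: open_L2_def)
  show "inner f g = inner g f"
    by transfer (simp add: mult.commute)
  show "inner (f + g) h = inner f h + inner g h"
    by transfer (simp add: L2_rel_def distrib_right square_integrable_mult)
  show "inner (r *\<^sub>R f) g = r * inner f g"
    by transfer (simp add: mult.assoc)
  show "0 \<le> inner f f"
    by transfer simp
  show "inner f f = 0 \<longleftrightarrow> f = 0"
  proof transfer
    fix f assume "L2_rel f f"
    then have f: "square_integrable f" by (simp add: L2_rel_def)
    have "(LINT x|unit_interval. f x * f x) = 0 \<longleftrightarrow> (AE x in unit_interval. f x * f x = 0)"
      by (rule integral_nonneg_eq_0_iff_AE) (use square_integrable_mult[OF f f] in auto)
    then show "(LINT x|unit_interval. f x * f x) = 0 \<longleftrightarrow> L2_rel f (\<lambda>x. 0)"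
      using f by (simp add: L2_rel_def square_integrable_zero)
  qed
  show "norm f = sqrt (inner f f)"
    by (simp add: norm_L2_def)
qed

end

section \<open>Step-function graphon operators\<close>

definition cell :: "nat \<Rightarrow> nat \<Rightarrow> real set" where
  "cell N i = (if i = 1 then {0..1 / real N} else {(real i - 1) / real N<..real i / real N})"

definition cell_fun :: "nat \<Rightarrow> nat \<Rightarrow> L2" where
  "cell_fun N k = abs_L2 (indicator (cell N k))"

definition step_kernel :: "nat \<Rightarrow> (nat \<Rightarrow> nat \<Rightarrow> real) \<Rightarrow> real \<Rightarrow> real \<Rightarrow> real" where
  "step_kernel N A \<alpha> \<beta> =
     (\<Sum>i=1..N. \<Sum>j=1..N. A i j * indicator (cell N i) \<alpha> * indicator (cell N j) \<beta>)"

definition integral_operator :: "(real \<Rightarrow> real \<Rightarrow> real) \<Rightarrow> L2 \<Rightarrow>\<^sub>L L2" where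
  "integral_operator K =
     Blinfun (\<lambda>f. abs_L2 (\<lambda>\<alpha>. LINT \<beta>|unit_interval. K \<alpha> \<beta> * rep_L2 f \<beta>))"

text \<open>For step kernels the map under \<open>Blinfun\<close> really is bounded linear, so
  \<^const>\<open>integral_operator\<close> is not a default value.\<close>

lemma cell_sets: "cell N i \<in> sets borel"
  by (simp add: cell_def)

lemma square_integrable_indicator:
  assumes "S \<in> sets borel"
  shows "square_integrable (indicator S)"
proof -
  interpret finite_measure unit_interval by (rule finite_measure_unit_interval)
  have *: "indicator S \<in> borel_measurable unit_interval"
    using assms by (intro measurable_restrict_space1) auto
  have "integrable unit_interval (\<lambda>x. (indicator S x :: real)\<^sup>2)"
    by (rule integrable_const_bound[where B = 1])
       (use * in \<open>auto intro!: borel_measurable_power simp: abs_square_le_1 indicator_le_1\<close>)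
  with * show ?thesis by (simp add: square_integrable_def)
qed

lemma square_integrable_sum:
  assumes "\<And>i. i \<in> I \<Longrightarrow> square_integrable (f i)"
  shows "square_integrable (\<lambda>x. \<Sum>i\<in>I. f i x)"
  using assms
  by (induction I rule: infinite_finite_induct)
     (auto simp: square_integrable_zero square_integrable_add)

lemma L2_rel_refl: "square_integrable f \<Longrightarrow> L2_rel f f"
  by (simp add: L2_rel_def)

lemma square_integrable_rep: "square_integrable (rep_L2 f)"
  using Quotient3_rep_reflp[OF Quotient3_L2, of f] by (simp add: L2_rel_def)

lemma abs_L2_sum:
  assumes "\<And>i. i \<in> I \<Longrightarrow> square_integrable (f i)"
  shows "abs_L2 (\<lambda>x. \<Sum>i\<in>I. r i * f i x) = (\<Sum>i\<in>I. r i *\<^sub>R abs_L2 (f i))"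
  using assms
proof (induction I rule: infinite_finite_induct)
  case (insert i I)
  then have 1: "square_integrable (\<lambda>x. \<Sum>i\<in>I. r i * f i x)"
    by (intro square_integrable_sum square_integrable_scale) auto
  have 2: "square_integrable (f i)" using insert by auto
  show ?case
    using insert 1 2
    by (simp add: plus_L2.abs_eq[symmetric] scaleR_L2.abs_eq[symmetric] L2_rel_refl
        square_integrable_scale flip: plus_L2.abs_eq scaleR_L2.abs_eq)
qed (simp_all add: zero_L2_def)

lemma integral_operator_step_kernel:
  "integral_operator (step_kernel N A) f =
     (\<Sum>i=1..N. (\<Sum>j=1..N. A i j * inner (cell_fun N j) f) *\<^sub>R cell_fun N i)"
proof -
  have *: "inner (cell_fun N j) f = (LINT \<beta>|unit_interval. indicator (cell N j) \<beta> * rep_L2 f \<beta>)"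
    for j f
  proof -
    have "inner (cell_fun N j) (abs_L2 (rep_L2 f)) =
        (LINT \<beta>|unit_interval. indicator (cell N j) \<beta> * rep_L2 f \<beta>)"
      unfolding cell_fun_def
      by (rule inner_L2.abs_eq)
         (auto intro!: L2_rel_refl square_integrable_indicator square_integrable_rep cell_sets)
    then show ?thesis by (simp add: Quotient3_abs_rep[OF Quotient3_L2])
  qed
  have **: "(LINT \<beta>|unit_interval. step_kernel N A \<alpha> \<beta> * rep_L2 f \<beta>) =
      (\<Sum>i=1..N. (\<Sum>j=1..N. A i j * inner (cell_fun N j) f) * indicator (cell N i) \<alpha>)" for \<alpha> f
  proof -
    have int: "integrable unit_interval (\<lambda>\<beta>. indicator (cell N j) \<beta> * rep_L2 f \<beta>)" for j
      by (intro square_integrable_mult square_integrable_indicator cell_sets square_integrable_rep)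
    have "(LINT \<beta>|unit_interval. step_kernel N A \<alpha> \<beta> * rep_L2 f \<beta>) =
        (LINT \<beta>|unit_interval. (\<Sum>i=1..N. \<Sum>j=1..N. (A i j * indicator (cell N i) \<alpha>) *
           (indicator (cell N j) \<beta> * rep_L2 f \<beta>)))"
      by (simp add: step_kernel_def sum_distrib_right mult.assoc)
    also have "\<dots> = (\<Sum>i=1..N. \<Sum>j=1..N. (A i j * indicator (cell N i) \<alpha>) *
           inner (cell_fun N j) f)"
      using int by (simp add: Bochner_Integration.integral_sum *)
    finally show ?thesis by (simp add: sum_distrib_right sum_distrib_left mult_ac)
  qed
  have "abs_L2 (\<lambda>\<alpha>. LINT \<beta>|unit_interval. step_kernel N A \<alpha> \<beta> * rep_L2 f \<beta>) =
      (\<Sum>i=1..N. (\<Sum>j=1..N. A i j * inner (cell_fun N j) f) *\<^sub>R cell_fun N i)" for f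
    unfolding ** cell_fun_def
    by (rule abs_L2_sum) (intro square_integrable_indicator cell_sets)
  moreover have "bounded_linear
      (\<lambda>f. \<Sum>i=1..N. (\<Sum>j=1..N. A i j * inner (cell_fun N j) f) *\<^sub>R cell_fun N i)"
    by (intro bounded_linear_sum bounded_linear_scaleR_const bounded_linear_const_mult
        bounded_linear_inner_right)
  ultimately show ?thesis
    by (simp add: integral_operator_def bounded_linear_Blinfun_apply)
qed

definition graphon_operator :: "nat \<Rightarrow> (nat \<Rightarrow> nat \<Rightarrow> real) \<Rightarrow> real \<Rightarrow> L2 \<Rightarrow>\<^sub>L L2" where
  "graphon_operator N A a = integral_operator (step_kernel N A) + a *\<^sub>R id_blinfun"

section \<open>Solution operators\<close>

text \<open>Solutions of $\dot y_t = A_t y_t$ on $[s,T]$ are read in integrated form, so that \<open>A\<close> may be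
  discontinuous in time; a function differentiable everywhere with this derivative is a solution,
  since the integral is the Henstock--Kurzweil one.\<close>

definition linear_ode_solution ::
  "(real \<Rightarrow> L2 \<Rightarrow>\<^sub>L L2) \<Rightarrow> real \<Rightarrow> real \<Rightarrow> (real \<Rightarrow> L2) \<Rightarrow> bool" where
  "linear_ode_solution A s T y \<longleftrightarrow>
     (\<forall>t\<in>{s..T}. ((\<lambda>r. A r (y r)) has_integral (y t - y s)) {s..t})"

definition solution_operator ::
  "real \<Rightarrow> (real \<Rightarrow> L2 \<Rightarrow>\<^sub>L L2) \<Rightarrow> (real \<Rightarrow> real \<Rightarrow> L2 \<Rightarrow>\<^sub>L L2) \<Rightarrow> bool" where
  "solution_operator T A \<Phi> \<longleftrightarrow>
     (\<forall>s\<in>{0..T}.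
        (\<forall>v. \<exists>y. y s = v \<and> linear_ode_solution A s T y) \<and>
        (\<forall>y. linear_ode_solution A s T y \<longrightarrow> (\<forall>t\<in>{s..T}. y t = \<Phi> t s (y s))))"

section \<open>Noise and mild solutions\<close>

text \<open>The expectation of a nonnegative random variable, with value in $[0,\infty]$ (the Bochner
  integral would assign $0$ to a non-integrable one).\<close>

definition E_nonneg :: "'a measure \<Rightarrow> ('a \<Rightarrow> real) \<Rightarrow> ennreal" where
  "E_nonneg P X = (\<integral>\<^sup>+ \<omega>. ennreal (X \<omega>) \<partial>P)"

definition mean_square_limit ::
  "'a measure \<Rightarrow> (nat \<Rightarrow> 'a \<Rightarrow> L2) \<Rightarrow> ('a \<Rightarrow> L2) \<Rightarrow> bool" where
  "mean_square_limit P X Y \<longleftrightarrow>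
     Y \<in> borel_measurable P \<and> (\<lambda>n. E_nonneg P (\<lambda>\<omega>. (norm (X n \<omega> - Y \<omega>))\<^sup>2)) \<longlonglongrightarrow> 0"

definition brownian_motion :: "'a measure \<Rightarrow> (real \<Rightarrow> 'a \<Rightarrow> real) \<Rightarrow> bool" where
  "brownian_motion P W \<longleftrightarrow>
     (\<forall>t\<ge>0. W t \<in> borel_measurable P) \<and>
     (AE \<omega> in P. W 0 \<omega> = 0) \<and>
     (\<forall>s t. 0 \<le> s \<and> s < t \<longrightarrow>
        distributed P lborel (\<lambda>\<omega>. W t \<omega> - W s \<omega>) (normal_density 0 (sqrt (t - s)))) \<and>
     (\<forall>n \<tau>. 0 \<le> \<tau> 0 \<and> (\<forall>i<n. \<tau> i \<le> \<tau> (Suc i)) \<longrightarrow>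
        prob_space.indep_vars P (\<lambda>_. borel) (\<lambda>i \<omega>. W (\<tau> (Suc i)) \<omega> - W (\<tau> i) \<omega>) {..<n}) \<and>
     (AE \<omega> in P. continuous_on {0..} (\<lambda>t. W t \<omega>))"

text \<open>Processes are independent if they are independent as random elements of the path space
  $\mathbb{R}^{[0,\infty)}$.\<close>

definition independent_brownian_motions ::
  "'a measure \<Rightarrow> (nat \<Rightarrow> real \<Rightarrow> 'a \<Rightarrow> real) \<Rightarrow> nat set \<Rightarrow> bool" where
  "independent_brownian_motions P W R \<longleftrightarrow>
     (\<forall>r\<in>R. brownian_motion P (W r)) \<and>
     prob_space.indep_vars P (\<lambda>_. Pi\<^sub>M {0..} (\<lambda>_. borel)) (\<lambda>r \<omega>. \<lambda>t\<in>{0..}. W r t \<omega>) R"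

text \<open>$w_t = \sum_{k=1}^N \mathbf{1}_{P_k} \sum_{r=1}^\infty c_{k,r} W_r(t)$, the series
  converging in mean square.\<close>

definition step_noise ::
  "'a measure \<Rightarrow> nat \<Rightarrow> (nat \<Rightarrow> nat \<Rightarrow> real) \<Rightarrow> (nat \<Rightarrow> real \<Rightarrow> 'a \<Rightarrow> real) \<Rightarrow>
   (real \<Rightarrow> 'a \<Rightarrow> L2) \<Rightarrow> bool" where
  "step_noise P N c W w \<longleftrightarrow>
     (\<forall>t\<ge>0. mean_square_limit P
        (\<lambda>n \<omega>. \<Sum>k=1..N. (\<Sum>r=1..n. c k r * W r t \<omega>) *\<^sub>R cell_fun N k) (w t))"

definition noise_covariance_operator ::
  "'a measure \<Rightarrow> (real \<Rightarrow> 'a \<Rightarrow> L2) \<Rightarrow> (L2 \<Rightarrow>\<^sub>L L2) \<Rightarrow> bool" where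
  "noise_covariance_operator P w Q \<longleftrightarrow>
     (\<forall>t\<ge>0. \<forall>s\<ge>0. \<forall>f g.
        prob_space.expectation P (\<lambda>\<omega>. inner (w t \<omega>) f * inner (w s \<omega>) g) =
          min t s * inner f (Q g))"

text \<open>The integral of a deterministic operator-valued function against the noise is the mean-square
  limit of the elementary integrals $\sum_i B_i (w_{\tau_{i+1}} - w_{\tau_i})$ of step functions
  converging to the integrand in $L_2([0,t])$ with respect to the operator norm. For a noise
  with trace-class covariance $Q$, an elementary integral has second moment at most
  $\mathrm{tr}(Q) \int_0^t \|B_s\|^2\,ds$, so the limit does not depend (up to null sets) on the
  approximating sequence.\<close>

definition step_integrand ::
  "nat \<Rightarrow> (nat \<Rightarrow> real) \<Rightarrow> (nat \<Rightarrow> L2 \<Rightarrow>\<^sub>L L2) \<Rightarrow> real \<Rightarrow> L2 \<Rightarrow>\<^sub>L L2" where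
  "step_integrand n \<tau> B s = (\<Sum>i<n. indicator {\<tau> i<..\<tau> (Suc i)} s *\<^sub>R B i)"

definition step_stochastic_integral ::
  "nat \<Rightarrow> (nat \<Rightarrow> real) \<Rightarrow> (nat \<Rightarrow> L2 \<Rightarrow>\<^sub>L L2) \<Rightarrow> (real \<Rightarrow> 'a \<Rightarrow> L2) \<Rightarrow> 'a \<Rightarrow> L2" where
  "step_stochastic_integral n \<tau> B w \<omega> = (\<Sum>i<n. B i (w (\<tau> (Suc i)) \<omega> - w (\<tau> i) \<omega>))"

definition has_stochastic_integral ::
  "'a measure \<Rightarrow> (real \<Rightarrow> 'a \<Rightarrow> L2) \<Rightarrow> real \<Rightarrow> (real \<Rightarrow> L2 \<Rightarrow>\<^sub>L L2) \<Rightarrow> ('a \<Rightarrow> L2) \<Rightarrow> bool" where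
  "has_stochastic_integral P w t F J \<longleftrightarrow>
     (\<exists>(n :: nat \<Rightarrow> nat) \<tau> B.
        (\<forall>m. \<tau> m 0 = 0 \<and> \<tau> m (n m) = t \<and> (\<forall>i<n m. \<tau> m i \<le> \<tau> m (Suc i))) \<and>
        (\<forall>m. set_integrable lborel {0..t}
           (\<lambda>s. (norm (step_integrand (n m) (\<tau> m) (B m) s - F s))\<^sup>2)) \<and>
        (\<lambda>m. LBINT s:{0..t}. (norm (step_integrand (n m) (\<tau> m) (B m) s - F s))\<^sup>2) \<longlonglongrightarrow> 0 \<and>
        mean_square_limit P (\<lambda>m. step_stochastic_integral (n m) (\<tau> m) (B m) w) J)"

definition mild_solution ::
  "'a measure \<Rightarrow> real \<Rightarrow> (real \<Rightarrow> L2 \<Rightarrow>\<^sub>L L2) \<Rightarrow> (real \<Rightarrow> real \<Rightarrow> L2 \<Rightarrow>\<^sub>L L2) \<Rightarrow>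
   (real \<Rightarrow> 'a \<Rightarrow> L2) \<Rightarrow> L2 \<Rightarrow> (real \<Rightarrow> 'a \<Rightarrow> L2) \<Rightarrow> bool" where
  "mild_solution P T A \<Phi> w x0 x \<longleftrightarrow>
     solution_operator T A \<Phi> \<and>
     (\<forall>t\<in>{0..T}. x t \<in> borel_measurable P \<and>
        (\<exists>J. has_stochastic_integral P w t (\<lambda>s. \<Phi> t s) J \<and>
             (AE \<omega> in P. x t \<omega> = \<Phi> t 0 x0 + J \<omega>)))"

end

theory Submission
  imports Defs
begin

text \<open>
  Subtracting the mild formulas of systems \<open>N\<close> and \<open>M\<close> writes \<open>x\<^sup>N\<^sub>t - x\<^sup>M\<^sub>t\<close> as the sum of
  \<open>\<Phi>\<^sup>N(t,0) x\<^sup>N\<^sub>0 - \<Phi>\<^sup>M(t,0) x\<^sup>M\<^sub>0\<close>, of the integral of \<open>\<Phi>\<^sup>N(t,\<cdot>)\<close> against \<open>w\<^sup>N - w\<^sup>M\<close>, and of the integral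
  of \<open>\<Phi>\<^sup>N(t,\<cdot>) - \<Phi>\<^sup>M(t,\<cdot>)\<close> against \<open>w\<^sup>M\<close>. The first term is small because initial states and solution
  operators converge. For the other two the tool is the Ito inequality
  \<open>E \<parallel>\<integral>\<^sub>0\<^sup>t F dv\<parallel>\<^sup>2 \<le> \<kappa> \<integral>\<^sub>0\<^sup>t \<parallel>F\<^sub>s\<parallel>\<^sup>2 ds\<close>, in which \<open>\<kappa>\<close> bounds the trace of the covariance of \<open>v\<close>.
  All noises are mean-square limits of series \<open>\<Sum>\<^sub>r W\<^sub>r(t) g\<^sub>r\<close> over the same Brownian motions, so
  \<open>w\<^sup>N - w\<^sup>M\<close> is such a series too; its trace is \<open>\<Sum>\<^sub>r \<parallel>g\<^sub>r\<parallel>\<^sup>2 = E \<parallel>w\<^sup>N\<^sub>T - w\<^sup>M\<^sub>T\<parallel>\<^sup>2 / T\<close>, which is small by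
  hypothesis. Together these give the Cauchy property in mean square, uniformly in \<open>t\<close>
  (\<open>states_cauchy\<close>), and with it the one in mean.

  The Ito inequality is encoded as a predicate \<open>ito_bounded\<close> on processes, stated for elementary
  integrals only. It holds for finite sums of Brownian motions by orthogonality
  (\<open>ito_isometry\<close>), and it passes to mean-square limits at the price of a factor 2
  (\<open>ito_bounded_limit\<close>); hence the limit noise, which is given as such a limit, satisfies it as well.

  The limit state exists since mean-square Cauchy sequences converge (\<open>mean_square_complete\<close>); this
  needs \<open>L2\<close> to be complete and separable, the latter also because sums of Borel functions into a
  space without a countable base need not be Borel. The completeness theorem is used twice: for
  real functions on the unit interval it yields the completeness of \<open>L2\<close> itself, for
  \<open>L2\<close>-valued functions on the probability space it yields the limit process. That
  the limit process is a mild solution is a diagonal argument (\<open>stochastic_integral_limit\<close>): choose, for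
  each \<open>N\<close>, a step function so close to \<open>\<Phi>\<^sup>N(t,\<cdot>)\<close> that its elementary integral against \<open>w\<^sup>N\<close> is
  close to the stochastic integral; the same step functions approximate the limit solution
  operator, and replacing \<open>w\<^sup>N\<close> by the limit noise costs little. Uniqueness is the
  difference bound applied to two solutions with equal data.

  The space of operators on \<open>L2\<close> is not separable, so measurability of operator-valued functions
  is avoided: only norms of differences are integrated, and these are measurable since
  \<open>s \<mapsto> \<Phi>(t,s)\<close> is norm-continuous when the generator is bounded
  (\<open>solution_operator_continuous\<close>).
\<close>

section \<open>Mean squares\<close>

lemma ennreal_tendsto_0I:
  fixes f :: "nat \<Rightarrow> ennreal"
  assumes "\<And>e::real. e > 0 \<Longrightarrow> \<forall>\<^sub>F n in sequentially. f n \<le> ennreal e"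
  shows "f \<longlonglongrightarrow> 0"
proof (rule order_tendstoI)
  fix a :: ennreal assume "0 < a"
  then obtain e :: real where e: "e > 0" "ennreal e < a"
    by (metis dense ennreal_cases ennreal_less_zero_iff not_less_iff_gr_or_eq order_less_trans top.not_eq_extremum)
  then show "\<forall>\<^sub>F n in sequentially. f n < a"
    using assms[of e] by (auto elim!: eventually_mono)
qed simp

lemma ennreal_tendsto_0D:
  fixes f :: "nat \<Rightarrow> ennreal"
  assumes "f \<longlonglongrightarrow> 0" "e > (0::real)"
  shows "\<forall>\<^sub>F n in sequentially. f n \<le> ennreal e"
  using order_tendstoD(2)[OF assms(1), of "ennreal e"] assms(2)
  by (auto elim!: eventually_mono)

lemma ennreal_tendsto_0_squeeze:
  fixes f g :: "nat \<Rightarrow> ennreal"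
  assumes "\<And>n. f n \<le> g n" "g \<longlonglongrightarrow> 0"
  shows "f \<longlonglongrightarrow> 0"
  by (rule tendsto_sandwich[OF _ _ tendsto_const assms(2)]) (auto simp: assms(1))

lemma ennreal_tendsto_0_combine:
  fixes f g :: "nat \<Rightarrow> ennreal"
  assumes "f \<longlonglongrightarrow> 0" "g \<longlonglongrightarrow> 0" "c < top" "d < top"
  shows "(\<lambda>n. c * f n + d * g n) \<longlonglongrightarrow> 0"
  using tendsto_add[OF ennreal_tendsto_cmult[OF assms(3,1)] ennreal_tendsto_cmult[OF assms(4,2)]] by simp

lemma ennreal_le_limI:
  fixes f :: "nat \<Rightarrow> ennreal"
  assumes "f \<longlonglongrightarrow> 0" "\<forall>\<^sub>F n in sequentially. x \<le> y + f n"
  shows "x \<le> y"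
proof (rule tendsto_lowerbound[OF _ assms(2)])
  show "(\<lambda>n. y + f n) \<longlonglongrightarrow> y" using tendsto_add[OF tendsto_const[of y] assms(1)] by simp
qed simp

text \<open>Used for processes on the probability space, for functions on the unit interval and for
  integrands on a time interval alike.\<close>
abbreviation (input) mean_square :: "'a measure \<Rightarrow> ('a \<Rightarrow> 'b::real_normed_vector) \<Rightarrow> ennreal" where
  "mean_square M X \<equiv> E_nonneg M (\<lambda>\<omega>. (norm (X \<omega>))\<^sup>2)"

lemma mean_square_mono:
  assumes "AE \<omega> in M. norm (X \<omega>) \<le> norm (Y \<omega>)"
  shows "mean_square M X \<le> mean_square M Y"
  unfolding E_nonneg_def
  using assms by (intro nn_integral_mono_AE) (auto elim!: eventually_mono simp: power_mono ennreal_leI)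

text \<open>From \<open>(a + b)\<^sup>2 \<le> 2 a\<^sup>2 + 2 b\<^sup>2\<close>. Only the norms of the two summands have to be
  measurable; this is what makes the lemma applicable to functions with values in a
  non-separable space of operators.\<close>
lemma mean_square_triangle:
  fixes X :: "'a \<Rightarrow> 'b::real_normed_vector" and Y :: "'a \<Rightarrow> 'c::real_normed_vector"
    and Z :: "'a \<Rightarrow> 'd::real_normed_vector"
  assumes [measurable]: "(\<lambda>\<omega>. norm (X \<omega>)) \<in> borel_measurable M" "(\<lambda>\<omega>. norm (Y \<omega>)) \<in> borel_measurable M"
    and le: "AE \<omega> in M. norm (Z \<omega>) \<le> norm (X \<omega>) + norm (Y \<omega>)"
  shows "mean_square M Z \<le> 2 * mean_square M X + 2 * mean_square M Y"
proof -
  have *: "ennreal ((norm (Z \<omega>))\<^sup>2) \<le> 2 * ennreal ((norm (X \<omega>))\<^sup>2) + 2 * ennreal ((norm (Y \<omega>))\<^sup>2)"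
    if "norm (Z \<omega>) \<le> norm (X \<omega>) + norm (Y \<omega>)" for \<omega>
  proof -
    have "(norm (Z \<omega>))\<^sup>2 \<le> (norm (X \<omega>) + norm (Y \<omega>))\<^sup>2"
      using that by (intro power_mono) auto
    also have "\<dots> \<le> 2 * (norm (X \<omega>))\<^sup>2 + 2 * (norm (Y \<omega>))\<^sup>2"
      using sum_squares_bound[of "norm (X \<omega>)" "norm (Y \<omega>)"] by (simp add: power2_sum)
    finally have "ennreal ((norm (Z \<omega>))\<^sup>2) \<le> ennreal (2 * (norm (X \<omega>))\<^sup>2 + 2 * (norm (Y \<omega>))\<^sup>2)"
      by (rule ennreal_leI)
    then show ?thesis by (simp add: ennreal_plus ennreal_mult)
  qed
  have "mean_square M Z \<le>
      (\<integral>\<^sup>+ \<omega>. 2 * ennreal ((norm (X \<omega>))\<^sup>2) + 2 * ennreal ((norm (Y \<omega>))\<^sup>2) \<partial>M)"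
    unfolding E_nonneg_def
    by (rule nn_integral_mono_AE) (use le in \<open>auto elim!: eventually_mono intro: *\<close>)
  also have "\<dots> = 2 * mean_square M X + 2 * mean_square M Y"
    unfolding E_nonneg_def by (simp add: nn_integral_add nn_integral_cmult)
  finally show ?thesis .
qed

text \<open>Integrates \<open>y \<le> d + y\<^sup>2 / d\<close>: a substitute for the Cauchy--Schwarz inequality that is linear in the
  mean square and therefore convenient in \<open>[0, \<infinity>]\<close>.\<close>
lemma E_norm_le:
  fixes X :: "'a \<Rightarrow> 'b::real_normed_vector"
  assumes [measurable]: "(\<lambda>\<omega>. norm (X \<omega>)) \<in> borel_measurable M" and d: "d > 0"
  shows "E_nonneg M (\<lambda>\<omega>. norm (X \<omega>)) \<le> ennreal d * emeasure M (space M) + ennreal (1/d) * mean_square M X"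
proof -
  have "norm (X \<omega>) \<le> d + 1/d * (norm (X \<omega>))\<^sup>2" for \<omega>
  proof (cases "norm (X \<omega>) \<le> d")
    case False
    then have "norm (X \<omega>) * d \<le> (norm (X \<omega>))\<^sup>2" by (simp add: power2_eq_square mult_left_mono)
    then have "norm (X \<omega>) \<le> 1/d * (norm (X \<omega>))\<^sup>2" using d by (simp add: field_simps)
    then show ?thesis using d by linarith
  qed (use d in \<open>simp add: add_increasing2\<close>)
  then have "E_nonneg M (\<lambda>\<omega>. norm (X \<omega>)) \<le> (\<integral>\<^sup>+ \<omega>. ennreal d + ennreal (1/d) * ennreal ((norm (X \<omega>))\<^sup>2) \<partial>M)"
    unfolding E_nonneg_def using d
    by (intro nn_integral_mono) (simp add: ennreal_leI flip: ennreal_mult ennreal_plus del: times_divide_eq_left)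
  also have "\<dots> = ennreal d * emeasure M (space M) + ennreal (1/d) * mean_square M X"
    unfolding E_nonneg_def by (simp add: nn_integral_add nn_integral_cmult)
  finally show ?thesis .
qed

lemma mean_square_diff_triangle:
  fixes X Y Z :: "'a \<Rightarrow> 'b::real_normed_vector"
  assumes "(\<lambda>\<omega>. norm (X \<omega> - Y \<omega>)) \<in> borel_measurable M" "(\<lambda>\<omega>. norm (Y \<omega> - Z \<omega>)) \<in> borel_measurable M"
  shows "mean_square M (\<lambda>\<omega>. X \<omega> - Z \<omega>) \<le>
    2 * mean_square M (\<lambda>\<omega>. X \<omega> - Y \<omega>) + 2 * mean_square M (\<lambda>\<omega>. Y \<omega> - Z \<omega>)"
  by (rule mean_square_triangle[OF assms])
     (use norm_triangle_ineq[of "X \<omega> - Y \<omega>" "Y \<omega> - Z \<omega>" for \<omega>] in auto)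

lemma mean_square_const:
  assumes "prob_space P"
  shows "mean_square P (\<lambda>\<omega>. c) = ennreal ((norm c)\<^sup>2)"
  unfolding E_nonneg_def nn_integral_const prob_space.emeasure_space_1[OF assms] by simp

lemma mean_square_eq_0_iff:
  assumes [measurable]: "(\<lambda>\<omega>. norm (X \<omega>)) \<in> borel_measurable P"
  shows "mean_square P X = 0 \<longleftrightarrow> (AE \<omega> in P. X \<omega> = 0)"
proof -
  have "mean_square P X = 0 \<longleftrightarrow> (AE \<omega> in P. ennreal ((norm (X \<omega>))\<^sup>2) = 0)"
    unfolding E_nonneg_def by (rule nn_integral_0_iff_AE) measurable
  then show ?thesis by (simp add: ennreal_eq_0_iff)
qed

lemma E_norm_le_sqrt:
  fixes X :: "'a \<Rightarrow> 'b::{real_normed_vector,second_countable_topology}"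
  assumes P: "prob_space P" and [measurable]: "X \<in> borel_measurable P" and e: "e > 0"
    and ms: "mean_square P X \<le> ennreal (e\<^sup>2/4)"
  shows "E_nonneg P (\<lambda>\<omega>. norm (X \<omega>)) \<le> ennreal e"
proof -
  have "E_nonneg P (\<lambda>\<omega>. norm (X \<omega>)) \<le>
      ennreal (e/2) * emeasure P (space P) + ennreal (1 / (e/2)) * mean_square P X"
    using e by (intro E_norm_le) auto
  also have "\<dots> \<le> ennreal (e/2) * 1 + ennreal (1 / (e/2)) * ennreal (e\<^sup>2/4)"
    by (intro add_mono mult_left_mono ms) (auto simp: prob_space.emeasure_space_1[OF P])
  also have "\<dots> = ennreal (e/2 + 1 / (e/2) * (e\<^sup>2/4))"
    using e by (simp add: ennreal_mult[symmetric] ennreal_plus[symmetric] del: ennreal_plus)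
  also have "e/2 + 1 / (e/2) * (e\<^sup>2/4) = e" using e by (simp add: power2_eq_square)
  finally show ?thesis .
qed

lemma E_norm_tendsto_0:
  fixes X :: "nat \<Rightarrow> 'a \<Rightarrow> 'b::{real_normed_vector,second_countable_topology}"
  assumes P: "prob_space P" and X: "\<And>n. X n \<in> borel_measurable P"
    and lim: "(\<lambda>n. mean_square P (X n)) \<longlonglongrightarrow> 0"
  shows "(\<lambda>n. E_nonneg P (\<lambda>\<omega>. norm (X n \<omega>))) \<longlonglongrightarrow> 0"
proof (rule ennreal_tendsto_0I)
  fix e :: real assume e: "e > 0"
  have "\<forall>\<^sub>F n in sequentially. mean_square P (X n) \<le> ennreal (e\<^sup>2/4)"
    using e by (intro ennreal_tendsto_0D[OF lim]) simp
  then show "\<forall>\<^sub>F n in sequentially. E_nonneg P (\<lambda>\<omega>. norm (X n \<omega>)) \<le> ennreal e"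
  proof eventually_elim
    case (elim n)
    show ?case by (rule E_norm_le_sqrt[OF P X e elim])
  qed
qed

lemma mean_square_dominated:
  fixes X :: "nat \<Rightarrow> 'a \<Rightarrow> real"
  assumes [measurable]: "\<And>n. X n \<in> borel_measurable M" "h \<in> borel_measurable M"
    and bound: "\<And>n. AE \<omega> in M. \<bar>X n \<omega>\<bar> \<le> h \<omega>"
    and fin: "mean_square M h < \<infinity>"
    and lim: "AE \<omega> in M. (\<lambda>n. X n \<omega>) \<longlonglongrightarrow> 0"
  shows "(\<lambda>n. mean_square M (X n)) \<longlonglongrightarrow> 0"
proof -
  have "(\<lambda>n. \<integral>\<^sup>+ \<omega>. ennreal ((norm (X n \<omega>))\<^sup>2) \<partial>M) \<longlonglongrightarrow> (\<integral>\<^sup>+ \<omega>. 0 \<partial>M)"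
  proof (rule nn_integral_dominated_convergence[where w = "\<lambda>\<omega>. ennreal ((norm (h \<omega>))\<^sup>2)"])
    show "(\<integral>\<^sup>+ \<omega>. ennreal ((norm (h \<omega>))\<^sup>2) \<partial>M) < \<infinity>"
      using fin by (simp add: E_nonneg_def)
    show "AE \<omega> in M. ennreal ((norm (X n \<omega>))\<^sup>2) \<le> ennreal ((norm (h \<omega>))\<^sup>2)" for n
      using bound[of n] by eventually_elim (intro ennreal_leI power_mono, auto)
    show "AE \<omega> in M. (\<lambda>n. ennreal ((norm (X n \<omega>))\<^sup>2)) \<longlonglongrightarrow> 0"
      using lim
    proof eventually_elim
      case (elim \<omega>)
      then have "(\<lambda>n. ennreal ((norm (X n \<omega>))\<^sup>2)) \<longlonglongrightarrow> ennreal ((norm (0::real))\<^sup>2)"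
        by (intro tendsto_ennrealI tendsto_power tendsto_norm)
      then show ?case by simp
    qed
  qed measurable
  then show ?thesis by (simp add: E_nonneg_def)
qed

text \<open>The Riesz--Fischer theorem for functions with values in a separable Banach space. On a finite
  measure space a mean-square Cauchy sequence is Cauchy in \<open>L\<^sub>1\<close>, so a subsequence converges almost
  everywhere, and Fatou's lemma turns the Cauchy estimate into convergence to its limit.\<close>
lemma mean_square_complete:
  fixes X :: "nat \<Rightarrow> 'a \<Rightarrow> 'b::{banach,second_countable_topology}"
  assumes "finite_measure M" and X[measurable]: "\<And>n. X n \<in> borel_measurable M"
    and cauchy: "\<And>e::real. e > 0 \<Longrightarrow>
      \<exists>N. \<forall>m\<ge>N. \<forall>n\<ge>N. mean_square M (\<lambda>\<omega>. X m \<omega> - X n \<omega>) \<le> ennreal e"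
  shows "\<exists>Y. Y \<in> borel_measurable M \<and> (\<lambda>n. mean_square M (\<lambda>\<omega>. X n \<omega> - Y \<omega>)) \<longlonglongrightarrow> 0"
proof -
  interpret finite_measure M by fact
  define \<mu> where "\<mu> = measure M (space M)"
  have \<mu>: "\<mu> \<ge> 0" "emeasure M (space M) = ennreal \<mu>"
    by (auto simp: \<mu>_def emeasure_eq_measure)
  have L1: "\<exists>N. \<forall>m\<ge>N. \<forall>n\<ge>N. E_nonneg M (\<lambda>\<omega>. norm (X m \<omega> - X n \<omega>)) \<le> ennreal e"
    if e: "e > 0" for e :: real
  proof -
    define d where "d = e / (2 * (\<mu> + 1))"
    have d: "d > 0" using e \<mu> by (simp add: d_def)
    obtain N where N: "\<And>m n. m \<ge> N \<Longrightarrow> n \<ge> N \<Longrightarrow> mean_square M (\<lambda>\<omega>. X m \<omega> - X n \<omega>) \<le> ennreal (d * (e/2))"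
      using cauchy[of "d * (e/2)"] d e by auto
    have "E_nonneg M (\<lambda>\<omega>. norm (X m \<omega> - X n \<omega>)) \<le> ennreal e" if "m \<ge> N" "n \<ge> N" for m n
    proof -
      have "E_nonneg M (\<lambda>\<omega>. norm (X m \<omega> - X n \<omega>)) \<le>
          ennreal d * ennreal \<mu> + ennreal (1/d) * ennreal (d * (e/2))"
        using d by (intro order_trans[OF E_norm_le[of _ M d]] add_mono mult_left_mono N that) (auto simp: \<mu>)
      also have "\<dots> = ennreal (d * \<mu> + 1/d * (d * (e/2)))"
        using d e \<mu> by (subst ennreal_plus) (simp_all only: ennreal_mult[symmetric], auto simp flip: ennreal_mult)
      also have "d * \<mu> + 1/d * (d * (e/2)) \<le> e"
      proof -
        have "d * \<mu> \<le> d * (\<mu> + 1)" using d by simp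
        also have "\<dots> = e/2" using \<mu>(1) by (simp add: d_def field_simps add_eq_0_iff)
        finally show ?thesis using d by simp
      qed
      finally show ?thesis by (simp add: ennreal_leI)
    qed
    then show ?thesis by blast
  qed
  obtain N0 where N0: "\<And>m. m \<ge> N0 \<Longrightarrow> E_nonneg M (\<lambda>\<omega>. norm (X m \<omega> - X N0 \<omega>)) \<le> ennreal 1"
    using L1[of 1] by auto
  define s where "s i \<omega> = X (N0 + i) \<omega> - X N0 \<omega>" for i \<omega>
  have s_meas[measurable]: "s i \<in> borel_measurable M" for i
    unfolding s_def[abs_def] by measurable
  have s_int: "integrable M (s i)" for i
    unfolding integrable_iff_bounded
    using N0[of "N0 + i"] by (auto simp: E_nonneg_def s_def elim!: le_less_trans)
  have s_cauchy: "\<exists>N. \<forall>i\<ge>N. \<forall>j\<ge>N. LINT x|M. norm (s i x - s j x) < e" if "e > 0" for e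
  proof -
    obtain N where N: "\<forall>m\<ge>N. \<forall>n\<ge>N. E_nonneg M (\<lambda>\<omega>. norm (X m \<omega> - X n \<omega>)) \<le> ennreal (e/2)"
      using L1[of "e/2"] \<open>e > 0\<close> by auto
    have "LINT x|M. norm (s i x - s j x) < e" if "i \<ge> N" "j \<ge> N" for i j
    proof -
      have "ennreal (LINT x|M. norm (s i x - s j x)) = E_nonneg M (\<lambda>\<omega>. norm (X (N0+i) \<omega> - X (N0+j) \<omega>))"
        unfolding E_nonneg_def
        by (subst nn_integral_eq_integral[symmetric])
           (use Bochner_Integration.integrable_diff[OF s_int[of i] s_int[of j]] in \<open>auto simp: s_def\<close>)
      also have "\<dots> \<le> ennreal (e/2)" using N that by auto
      finally show ?thesis using \<open>e > 0\<close> by (simp add: ennreal_le_iff)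
    qed
    then show ?thesis by blast
  qed
  from cauchy_L1_AE_cauchy_subseq[OF s_int s_cauchy]
  obtain r where r: "strict_mono r" and ae: "AE x in M. Cauchy (\<lambda>i. s (r i) x)"
    by auto
  define Y where "Y x = lim (\<lambda>i. X (N0 + r i) x)" for x
  have Y_meas[measurable]: "Y \<in> borel_measurable M"
    unfolding Y_def by measurable
  have lim: "AE x in M. (\<lambda>i. X (N0 + r i) x) \<longlonglongrightarrow> Y x"
    using ae
  proof eventually_elim
    case (elim x)
    then have "convergent (\<lambda>i. s (r i) x)" by (simp add: Cauchy_convergent_iff)
    then have "convergent (\<lambda>i. s (r i) x + X N0 x)" by (intro convergent_add convergent_const)
    then show ?case by (simp add: s_def Y_def convergent_LIMSEQ_iff)
  qed
  have "(\<lambda>n. mean_square M (\<lambda>\<omega>. X n \<omega> - Y \<omega>)) \<longlonglongrightarrow> 0"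
  proof (rule ennreal_tendsto_0I)
    fix e :: real assume "e > 0"
    then obtain N where N: "\<forall>m\<ge>N. \<forall>n\<ge>N. mean_square M (\<lambda>\<omega>. X m \<omega> - X n \<omega>) \<le> ennreal e"
      using cauchy by blast
    have "mean_square M (\<lambda>\<omega>. X n \<omega> - Y \<omega>) \<le> ennreal e" if "n \<ge> N" for n
    proof -
      have "mean_square M (\<lambda>\<omega>. X n \<omega> - Y \<omega>) =
          (\<integral>\<^sup>+ \<omega>. liminf (\<lambda>i. ennreal ((norm (X n \<omega> - X (N0 + r i) \<omega>))\<^sup>2)) \<partial>M)"
        unfolding E_nonneg_def
      proof (rule nn_integral_cong_AE)
        show "AE \<omega> in M. ennreal ((norm (X n \<omega> - Y \<omega>))\<^sup>2) =
            liminf (\<lambda>i. ennreal ((norm (X n \<omega> - X (N0 + r i) \<omega>))\<^sup>2))"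
          using lim
        proof eventually_elim
          case (elim \<omega>)
          then have "(\<lambda>i. ennreal ((norm (X n \<omega> - X (N0 + r i) \<omega>))\<^sup>2)) \<longlonglongrightarrow> ennreal ((norm (X n \<omega> - Y \<omega>))\<^sup>2)"
            by (intro tendsto_ennrealI tendsto_power tendsto_norm tendsto_diff tendsto_const)
          then show ?case by (metis lim_imp_Liminf trivial_limit_sequentially)
        qed
      qed
      also have "\<dots> \<le> liminf (\<lambda>i. mean_square M (\<lambda>\<omega>. X n \<omega> - X (N0 + r i) \<omega>))"
        unfolding E_nonneg_def by (rule nn_integral_liminf) measurable
      also have "\<dots> \<le> ennreal e"
      proof (rule Liminf_le)
        have "mean_square M (\<lambda>\<omega>. X n \<omega> - X (N0 + r i) \<omega>) \<le> ennreal e" if "i \<ge> N" for i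
        proof -
          have "i \<le> r i" using r by (rule seq_suble)
          then have "N \<le> N0 + r i" using that by linarith
          then show ?thesis using N \<open>n \<ge> N\<close> by blast
        qed
        then show "\<forall>\<^sub>F i in sequentially. mean_square M (\<lambda>\<omega>. X n \<omega> - X (N0 + r i) \<omega>) \<le> ennreal e"
          unfolding eventually_sequentially by blast
      qed simp
      finally show ?thesis .
    qed
    then show "\<forall>\<^sub>F n in sequentially. mean_square M (\<lambda>\<omega>. X n \<omega> - Y \<omega>) \<le> ennreal e"
      unfolding eventually_sequentially by blast
  qed
  with Y_meas show ?thesis by blast
qed

section \<open>Completeness and separability of the space of states\<close>

lemma abs_rep_L2: "abs_L2 (rep_L2 f) = f"
  by (rule Quotient3_abs_rep[OF Quotient3_L2])

lemma diff_abs_L2: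
  assumes "square_integrable f" "square_integrable g"
  shows "abs_L2 f - abs_L2 g = abs_L2 (\<lambda>x. f x - g x)"
proof -
  have "abs_L2 f - abs_L2 g = abs_L2 (\<lambda>x. f x + - g x)"
    unfolding minus_L2_def using assms square_integrable_scale[of g "-1"]
    by (simp add: uminus_L2.abs_eq plus_L2.abs_eq L2_rel_refl)
  then show ?thesis by simp
qed

lemma norm_abs_L2:
  assumes "square_integrable f"
  shows "ennreal ((norm (abs_L2 f))\<^sup>2) = mean_square unit_interval f"
proof -
  have "(norm (abs_L2 f))\<^sup>2 = (LINT x|unit_interval. f x * f x)"
    unfolding power2_norm_eq_inner using assms by (simp add: inner_L2.abs_eq L2_rel_refl)
  also have "ennreal \<dots> = (\<integral>\<^sup>+ x. ennreal (f x * f x) \<partial>unit_interval)"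
    by (rule nn_integral_eq_integral[symmetric]) (use square_integrable_mult[OF assms assms] in auto)
  finally show ?thesis by (simp add: E_nonneg_def power2_eq_square)
qed

lemma norm_diff_L2:
  assumes "square_integrable f" "square_integrable g"
  shows "ennreal ((norm (abs_L2 f - abs_L2 g))\<^sup>2) = mean_square unit_interval (\<lambda>x. f x - g x)"
proof -
  have "square_integrable (\<lambda>x. f x - g x)"
    using square_integrable_add[OF assms(1) square_integrable_scale[OF assms(2), of "-1"]] by simp
  then show ?thesis by (simp only: diff_abs_L2[OF assms] norm_abs_L2)
qed

lemma square_integrable_iff_mean_square:
  "square_integrable f \<longleftrightarrow> f \<in> borel_measurable unit_interval \<and> mean_square unit_interval f < \<infinity>"
  unfolding square_integrable_def E_nonneg_def by (auto simp: integrable_iff_bounded)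

text \<open>Representatives of a Cauchy sequence are mean-square Cauchy on the unit interval, so this is
  the completeness theorem for real-valued functions.\<close>
instance L2 :: banach
proof
  fix F :: "nat \<Rightarrow> L2" assume "Cauchy F"
  define f where "f n = rep_L2 (F n)" for n
  have f: "square_integrable (f n)" "F n = abs_L2 (f n)" for n
    by (simp_all add: f_def square_integrable_rep abs_rep_L2)
  then have [measurable]: "f n \<in> borel_measurable unit_interval" for n
    by (simp add: square_integrable_def)
  have "\<exists>g. g \<in> borel_measurable unit_interval \<and>
      (\<lambda>n. mean_square unit_interval (\<lambda>x. f n x - g x)) \<longlonglongrightarrow> 0"
  proof (rule mean_square_complete[OF finite_measure_unit_interval])
    fix e :: real assume "e > 0"
    then obtain N where N: "\<forall>m\<ge>N. \<forall>n\<ge>N. norm (F m - F n) < sqrt e"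
      using CauchyD[OF \<open>Cauchy F\<close>, of "sqrt e"] by auto
    have "mean_square unit_interval (\<lambda>x. f m x - f n x) \<le> ennreal e" if "m \<ge> N" "n \<ge> N" for m n
    proof -
      have "(norm (F m - F n))\<^sup>2 \<le> (sqrt e)\<^sup>2"
        using N that by (intro power_mono) (auto intro: less_imp_le)
      then have "(norm (F m - F n))\<^sup>2 \<le> e" using \<open>e > 0\<close> by simp
      then show ?thesis unfolding f(2) by (subst norm_diff_L2[OF f(1) f(1), symmetric]) (rule ennreal_leI)
    qed
    then show "\<exists>N. \<forall>m\<ge>N. \<forall>n\<ge>N. mean_square unit_interval (\<lambda>x. f m x - f n x) \<le> ennreal e"
      by blast
  qed measurable
  then obtain g where [measurable]: "g \<in> borel_measurable unit_interval"
    and lim: "(\<lambda>n. mean_square unit_interval (\<lambda>x. f n x - g x)) \<longlonglongrightarrow> 0" by blast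
  obtain n where n: "mean_square unit_interval (\<lambda>x. f n x - g x) \<le> ennreal 1"
    using eventually_happens'[OF _ ennreal_tendsto_0D[OF lim, of 1]] by auto
  have "mean_square unit_interval g \<le>
      2 * mean_square unit_interval (f n) + 2 * mean_square unit_interval (\<lambda>x. f n x - g x)"
    by (rule mean_square_triangle) auto
  also have "\<dots> < \<infinity>"
    using f(1)[of n] n by (auto simp: square_integrable_iff_mean_square ennreal_mult_less_top
        intro: le_less_trans)
  finally have g: "square_integrable g" by (simp add: square_integrable_iff_mean_square)
  have "(\<lambda>n. ennreal ((norm (F n - abs_L2 g))\<^sup>2)) \<longlonglongrightarrow> ennreal 0"
    using lim unfolding f(2) by (simp add: norm_diff_L2 f(1) g)
  then have "(\<lambda>n. (norm (F n - abs_L2 g))\<^sup>2) \<longlonglongrightarrow> 0"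
    by (subst (asm) tendsto_ennreal_iff) auto
  then have "(\<lambda>n. norm (F n - abs_L2 g)) \<longlonglongrightarrow> 0"
    using tendsto_real_sqrt[of "\<lambda>n. (norm (F n - abs_L2 g))\<^sup>2" 0 sequentially] by simp
  then have "F \<longlonglongrightarrow> abs_L2 g" by (simp add: LIM_zero_iff tendsto_norm_zero_iff)
  then show "convergent F" by (auto simp: convergent_def)
qed

lemma countable_dense_imp_countable_subbasis:
  fixes D :: "'a::metric_space set"
  assumes "countable D" and dense: "\<And>x e. e > 0 \<Longrightarrow> \<exists>d\<in>D. dist x d < e"
  shows "\<exists>B :: 'a set set. countable B \<and> open = generate_topology B"
proof -
  define B where "B = (\<lambda>(d, n). ball d (1 / real (Suc n))) ` (D \<times> (UNIV :: nat set))"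
  have "topological_basis B"
  proof (rule topological_basisI)
    fix U and x :: 'a assume "open U" "x \<in> U"
    then obtain e where e: "e > 0" "ball x e \<subseteq> U" by (meson open_contains_ball)
    obtain n where n: "1 / real (Suc n) < e/2"
      using nat_approx_posE[of "e/2"] e by auto
    obtain d where d: "d \<in> D" "dist x d < 1 / real (Suc n)" using dense[of "1 / real (Suc n)" x] by auto
    have "ball d (1 / real (Suc n)) \<subseteq> ball x e"
    proof
      fix y assume "y \<in> ball d (1 / real (Suc n))"
      then show "y \<in> ball x e" using dist_triangle[of x y d] d n by (simp add: dist_commute)
    qed
    then have "x \<in> ball d (1 / real (Suc n)) \<and> ball d (1 / real (Suc n)) \<subseteq> U"
      using d e by (auto simp: dist_commute)
    then show "\<exists>B'\<in>B. x \<in> B' \<and> B' \<subseteq> U" using d by (auto simp: B_def)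
  qed (auto simp: B_def)
  moreover have "countable B" using \<open>countable D\<close> by (auto simp: B_def)
  ultimately show ?thesis using topological_basis_imp_subbasis by blast
qed

lemma square_integrable_continuous:
  assumes "continuous_on UNIV g"
  shows "square_integrable g"
proof -
  have "integrable lborel (\<lambda>x. indicator {0..1::real} x *\<^sub>R (g x)\<^sup>2)"
    by (intro borel_integrable_compact continuous_intros continuous_on_subset[OF assms]) auto
  moreover have "g \<in> borel_measurable lborel"
    using borel_measurable_continuous_onI[OF assms] by simp
  ultimately show ?thesis
    unfolding square_integrable_def
    by (auto simp: integrable_restrict_space intro: measurable_restrict_space1)
qed

lemma norm_diff_L2_le:
  assumes "square_integrable f" "square_integrable g" "e \<ge> 0"
    "mean_square unit_interval (\<lambda>x. f x - g x) \<le> ennreal (e\<^sup>2)"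
  shows "norm (abs_L2 f - abs_L2 g) \<le> e"
proof -
  have "(norm (abs_L2 f - abs_L2 g))\<^sup>2 \<le> e\<^sup>2"
    using assms(4) unfolding norm_diff_L2[OF assms(1,2), symmetric] by (simp add: ennreal_le_iff)
  then show ?thesis using assms(3) by (rule power2_le_imp_le)
qed

lemma emeasure_unit_interval: "emeasure unit_interval (space unit_interval) = 1"
  by (simp add: space_restrict_space emeasure_restrict_space)

lemma mean_square_unit_interval_const: "mean_square unit_interval (\<lambda>x. c) = ennreal ((norm c)\<^sup>2)"
  unfolding E_nonneg_def nn_integral_const emeasure_unit_interval by simp

text \<open>Truncation makes the function bounded, and a bounded measurable function is an almost everywhere
  limit of continuous functions, which may be truncated at the same level. Both approximations are
  then mean-square approximations by dominated convergence.\<close>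
lemma continuous_approx_L2:
  assumes f: "square_integrable f" and e: "e > 0"
  shows "\<exists>g. continuous_on UNIV g \<and> norm (abs_L2 f - abs_L2 g) < e"
proof -
  have [measurable]: "f \<in> borel_measurable unit_interval"
    using f by (simp add: square_integrable_def)
  define c where "c k y = max (- real k) (min (real k) y)" for k :: nat and y :: real
  have c_bound: "\<bar>c k y\<bar> \<le> real k" "\<bar>y - c k y\<bar> \<le> \<bar>y\<bar>" for k y by (auto simp: c_def)
  have c_cont: "continuous_on S h \<Longrightarrow> continuous_on S (\<lambda>x. c k (h x))" for k S and h :: "real \<Rightarrow> real"
    unfolding c_def by (intro continuous_intros)
  have c_meas[measurable]: "c k \<in> borel_measurable borel" for k
    unfolding c_def[abs_def] by measurable
  have "(\<lambda>k. mean_square unit_interval (\<lambda>x. f x - c k (f x))) \<longlonglongrightarrow> 0"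
  proof (rule mean_square_dominated[where h = "\<lambda>x. \<bar>f x\<bar>"])
    have "(\<lambda>k. y - c k y) \<longlonglongrightarrow> 0" for y
    proof (rule tendsto_eventually)
      have "y - c k y = 0" if "k \<ge> nat \<lceil>\<bar>y\<bar>\<rceil>" for k
      proof -
        have "\<bar>y\<bar> \<le> real k" using that by linarith
        then show ?thesis by (auto simp: c_def)
      qed
      then show "\<forall>\<^sub>F k in sequentially. y - c k y = 0"
        unfolding eventually_sequentially by blast
    qed
    then show "AE x in unit_interval. (\<lambda>k. f x - c k (f x)) \<longlonglongrightarrow> 0" by simp
  qed (use f c_bound in \<open>auto simp: square_integrable_iff_mean_square\<close>)
  then obtain k where k: "mean_square unit_interval (\<lambda>x. f x - c k (f x)) \<le> ennreal ((e/3)\<^sup>2)"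
    using eventually_happens'[OF _ ennreal_tendsto_0D[of _ "(e/3)\<^sup>2"]] e by force
  have ck: "square_integrable (\<lambda>x. c k (f x))"
  proof -
    have "mean_square unit_interval (\<lambda>x. c k (f x)) \<le> mean_square unit_interval (\<lambda>x. real k)"
      by (rule mean_square_mono) (use c_bound in auto)
    also have "\<dots> < \<infinity>" unfolding mean_square_unit_interval_const by simp
    finally show ?thesis by (simp add: square_integrable_iff_mean_square)
  qed
  define F where "F x = indicator {0..1} x * f x" for x
  have "F \<in> borel_measurable lborel"
    using borel_measurable_restrict_space_iff[of "{0..1}" lborel f]
    by (simp add: F_def[abs_def])
  then have "F \<in> borel_measurable lebesgue" by (simp add: measurable_completion)
  then have "F measurable_on UNIV"
    by (intro lebesgue_measurable_imp_measurable_on) auto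
  then obtain N g where N: "negligible N" and g: "\<And>n. continuous_on UNIV (g n)"
    and gF: "\<And>x. x \<notin> N \<Longrightarrow> (\<lambda>n. g n x) \<longlonglongrightarrow> F x"
    unfolding measurable_on_def by auto
  have [measurable]: "g n \<in> borel_measurable unit_interval" for n
    using square_integrable_continuous[OF g] by (simp add: square_integrable_def)
  have AE_N: "AE x in unit_interval. x \<notin> N"
  proof -
    have "N \<in> null_sets lebesgue" using N by (simp add: negligible_iff_null_sets)
    then have "AE x in lborel. x \<notin> N" using AE_completion_iff AE_not_in by blast
    then show ?thesis by (simp add: AE_restrict_space_iff) (auto elim: eventually_mono)
  qed
  have "(\<lambda>n. mean_square unit_interval (\<lambda>x. c k (f x) - c k (g n x))) \<longlonglongrightarrow> 0"
  proof (rule mean_square_dominated[where h = "\<lambda>x. 2 * real k"])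
    have "\<bar>c k y - c k z\<bar> \<le> 2 * real k" for y z using c_bound(1)[of k y] c_bound(1)[of k z] by linarith
    then show "AE x in unit_interval. \<bar>c k (f x) - c k (g n x)\<bar> \<le> 2 * real k" for n by simp
    show "AE x in unit_interval. (\<lambda>n. c k (f x) - c k (g n x)) \<longlonglongrightarrow> 0"
      using AE_N AE_space
    proof eventually_elim
      case (elim x)
      then have "(\<lambda>n. g n x) \<longlonglongrightarrow> f x" using gF[of x] by (simp add: F_def space_restrict_space)
      then have "(\<lambda>n. c k (f x) - c k (g n x)) \<longlonglongrightarrow> c k (f x) - c k (f x)"
        unfolding c_def by (intro tendsto_intros)
      then show ?case by simp
    qed
    show "mean_square unit_interval (\<lambda>x. 2 * real k) < \<infinity>"
      unfolding mean_square_unit_interval_const by simp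
  qed measurable
  then obtain n where n: "mean_square unit_interval (\<lambda>x. c k (f x) - c k (g n x)) \<le> ennreal ((e/3)\<^sup>2)"
    using eventually_happens'[OF _ ennreal_tendsto_0D[of _ "(e/3)\<^sup>2"]] e by force
  have cont: "continuous_on UNIV (\<lambda>x. c k (g n x))" by (rule c_cont[OF g])
  have "norm (abs_L2 f - abs_L2 (\<lambda>x. c k (f x))) \<le> e/3"
    by (rule norm_diff_L2_le) (use f ck k e in auto)
  moreover have "norm (abs_L2 (\<lambda>x. c k (f x)) - abs_L2 (\<lambda>x. c k (g n x))) \<le> e/3"
    by (rule norm_diff_L2_le) (use ck n e square_integrable_continuous[OF cont] in auto)
  ultimately have "norm (abs_L2 f - abs_L2 (\<lambda>x. c k (g n x))) < e"
    using norm_triangle_ineq[of "abs_L2 f - abs_L2 (\<lambda>x. c k (f x))"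
        "abs_L2 (\<lambda>x. c k (f x)) - abs_L2 (\<lambda>x. c k (g n x))"] e by simp
  with cont show ?thesis by blast
qed

text \<open>The Bernstein polynomials are nonnegative and sum to 1, so that rounding all
  coefficients by less than \<open>e/2\<close> moves the polynomial by at most \<open>e/2\<close>.\<close>
lemma rational_Bernstein_approx:
  assumes g: "continuous_on {0..1} g" and e: "e > (0::real)"
  shows "\<exists>n (q :: rat list). \<forall>x\<in>{0..1}. \<bar>g x - (\<Sum>k\<le>n. of_rat (q ! k) * Bernstein n k x)\<bar> < e"
proof -
  obtain n where n: "\<And>x. x \<in> {0..1} \<Longrightarrow> \<bar>g x - (\<Sum>k\<le>n. g (k/n) * Bernstein n k x)\<bar> < e/2"
    using Bernstein_Weierstrass[OF g, of "e/2"] e by auto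
  have "\<exists>q :: rat. \<bar>y - of_rat q\<bar> < e/2" for y :: real
  proof -
    obtain q where "y - e/2 < real_of_rat q" "real_of_rat q < y + e/2"
      using of_rat_dense[of "y - e/2" "y + e/2"] e by auto
    then show ?thesis by (intro exI[of _ q]) linarith
  qed
  then obtain r :: "real \<Rightarrow> rat" where r: "\<And>y. \<bar>y - of_rat (r y)\<bar> < e/2" by metis
  define q where "q = map (\<lambda>k. r (g (real k / real n))) [0..<Suc n]"
  have q: "q ! k = r (g (k/n))" if "k \<le> n" for k
    using that by (simp add: q_def del: upt_Suc)
  have "\<bar>g x - (\<Sum>k\<le>n. of_rat (q ! k) * Bernstein n k x)\<bar> < e" if x: "x \<in> {0..1}" for x
  proof -
    have "\<bar>(\<Sum>k\<le>n. g (k/n) * Bernstein n k x) - (\<Sum>k\<le>n. of_rat (q ! k) * Bernstein n k x)\<bar> =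
        \<bar>\<Sum>k\<le>n. (g (k/n) - of_rat (q ! k)) * Bernstein n k x\<bar>"
      by (simp add: sum_subtractf left_diff_distrib)
    also have "\<dots> \<le> (\<Sum>k\<le>n. \<bar>(g (k/n) - of_rat (q ! k)) * Bernstein n k x\<bar>)" by (rule sum_abs)
    also have "\<dots> \<le> (\<Sum>k\<le>n. e/2 * Bernstein n k x)"
    proof (rule sum_mono)
      fix k assume k: "k \<in> {..n}"
      have "0 \<le> Bernstein n k x" using x by (simp add: Bernstein_nonneg)
      then show "\<bar>(g (k/n) - of_rat (q ! k)) * Bernstein n k x\<bar> \<le> e/2 * Bernstein n k x"
        using k e r[of "g (k/n)"] unfolding abs_mult by (intro mult_mono) (auto simp: q)
    qed
    also have "\<dots> = e/2" by (simp only: sum_distrib_left[symmetric] sum_Bernstein mult_1_right)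
    finally show ?thesis using n[OF x] by linarith
  qed
  then show ?thesis by blast
qed

text \<open>Bernstein combinations with rational coefficients form a countable dense set. The
  measurability of sums and differences of \<open>L2\<close>-valued random variables rests on this instance.\<close>
instance L2 :: second_countable_topology
proof
  define p where "p n q x = (\<Sum>k\<le>n. of_rat (q ! k) * Bernstein n k x)"
    for n and q :: "rat list" and x :: real
  have p: "square_integrable (p n q)" for n q
    unfolding p_def[abs_def] Bernstein_def
    by (intro square_integrable_continuous continuous_intros)
  define D where "D = range (\<lambda>(n, q). abs_L2 (p n q))"
  show "\<exists>B :: L2 set set. countable B \<and> open = generate_topology B"
  proof (rule countable_dense_imp_countable_subbasis)
    show "countable D" unfolding D_def by (rule countable_image) simp
    fix F :: L2 and e :: real assume e: "e > 0"
    obtain g where g: "continuous_on UNIV g" "norm (abs_L2 (rep_L2 F) - abs_L2 g) < e/2"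
      using continuous_approx_L2[OF square_integrable_rep, of "e/2" F] e by auto
    obtain n q where nq: "\<forall>x\<in>{0..1}. \<bar>g x - p n q x\<bar> < e/2"
      using rational_Bernstein_approx[OF continuous_on_subset[OF g(1)], of "e/2"] e
      unfolding p_def by auto
    have "norm (abs_L2 g - abs_L2 (p n q)) \<le> e/2"
    proof (rule norm_diff_L2_le)
      have "mean_square unit_interval (\<lambda>x. g x - p n q x) \<le> mean_square unit_interval (\<lambda>x. e/2)"
        by (rule mean_square_mono) (use nq e in \<open>auto intro!: AE_I2 less_imp_le simp: space_restrict_space\<close>)
      also have "\<dots> = ennreal ((e/2)\<^sup>2)"
        by (subst mean_square_unit_interval_const) (use e in simp)
      finally show "mean_square unit_interval (\<lambda>x. g x - p n q x) \<le> ennreal ((e/2)\<^sup>2)" .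
    qed (use p e g square_integrable_continuous in auto)
    then have "dist F (abs_L2 (p n q)) < e"
      using g(2) norm_triangle_ineq[of "F - abs_L2 g" "abs_L2 g - abs_L2 (p n q)"]
      by (simp add: dist_norm abs_rep_L2)
    then show "\<exists>d\<in>D. dist F d < e" by (auto simp: D_def)
  qed
qed

section \<open>Continuity of solution operators\<close>

lemma linear_ode_solution_continuous:
  assumes y: "linear_ode_solution A s T y"
  shows "continuous_on {s..T} y"
proof (cases "s \<le> T")
  case True
  let ?f = "\<lambda>r. A r (y r)"
  have int: "(?f has_integral (y t - y s)) {s..t}" if "t \<in> {s..T}" for t
    using y that by (simp add: linear_ode_solution_def)
  have "continuous_on {s..T} (\<lambda>t. y s + integral {s..t} ?f)"
    using int[of T] True by (intro continuous_intros indefinite_integral_continuous_1) (auto simp: integrable_on_def)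
  moreover have "y t = y s + integral {s..t} ?f" if "t \<in> {s..T}" for t
    using integral_unique[OF int[OF that]] by simp
  ultimately show ?thesis by (metis (no_types, lifting) continuous_on_cong)
qed simp

text \<open>A Gronwall estimate with a constant that is not sharp. If \<open>m\<close> is the maximum of
  \<open>exp (- 2 K (r - s)) \<parallel>y r\<parallel>\<close>, then the integral equation gives \<open>m \<le> \<parallel>y s\<parallel> + m/2\<close>; the factor 2 in
  the weight is what leaves the coefficient 1/2 in front of \<open>m\<close>.\<close>
lemma linear_ode_solution_bound:
  assumes y: "linear_ode_solution A s T y" and K: "K > 0" "\<And>r. r \<in> {s..T} \<Longrightarrow> norm (A r) \<le> K"
    and t: "t \<in> {s..T}"
  shows "norm (y t) \<le> 2 * exp (2 * K * (t - s)) * norm (y s)"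
proof -
  have sT: "s \<le> T" using t by simp
  let ?g = "\<lambda>r. exp (- (2 * K * (r - s))) * norm (y r)"
  have "continuous_on {s..T} ?g"
    by (intro continuous_intros linear_ode_solution_continuous[OF y])
  then obtain r0 where r0: "r0 \<in> {s..T}" "\<And>r. r \<in> {s..T} \<Longrightarrow> ?g r \<le> ?g r0"
    using continuous_attains_sup[of "{s..T}" ?g] sT by auto
  define m where "m = ?g r0"
  have ym: "norm (y r) \<le> m * exp (2 * K * (r - s))" if "r \<in> {s..T}" for r
  proof -
    have "norm (y r) = ?g r * exp (2 * K * (r - s))" by (simp add: exp_minus)
    also have "\<dots> \<le> m * exp (2 * K * (r - s))" using r0(2)[OF that] by (simp add: m_def)
    finally show ?thesis .
  qed
  have y_le: "norm (y t) \<le> norm (y s) + (m/2 * exp (2 * K * (t - s)) - m/2)" if t: "t \<in> {s..T}" for t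
  proof -
    have int: "((\<lambda>r. A r (y r)) has_integral (y t - y s)) {s..t}"
      using y t by (simp add: linear_ode_solution_def)
    have "((\<lambda>r. K * (m * exp (2 * K * (r - s)))) has_integral
        (m/2 * exp (2 * K * (t - s)) - m/2 * exp (2 * K * (s - s)))) {s..t}"
      using t by (intro fundamental_theorem_of_calculus)
        (auto intro!: derivative_eq_intros simp flip: has_real_derivative_iff_has_vector_derivative)
    then have int': "((\<lambda>r. K * (m * exp (2 * K * (r - s)))) has_integral
        (m/2 * exp (2 * K * (t - s)) - m/2)) {s..t}" by simp
    have "norm (integral {s..t} (\<lambda>r. A r (y r))) \<le> integral {s..t} (\<lambda>r. K * (m * exp (2 * K * (r - s))))"
    proof (rule integral_norm_bound_integral)
      fix r assume r: "r \<in> {s..t}"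
      then have rT: "r \<in> {s..T}" using t by auto
      have "norm (A r (y r)) \<le> norm (A r) * norm (y r)" by (rule norm_blinfun)
      also have "\<dots> \<le> K * (m * exp (2 * K * (r - s)))"
        using K(2)[OF rT] ym[OF rT] K(1) by (intro mult_mono) auto
      finally show "norm (A r (y r)) \<le> K * (m * exp (2 * K * (r - s)))" .
    qed (use int int' in \<open>auto simp: integrable_on_def\<close>)
    then have "norm (y t - y s) \<le> m/2 * exp (2 * K * (t - s)) - m/2"
      using integral_unique[OF int] integral_unique[OF int'] by simp
    then show ?thesis using norm_triangle_ineq2[of "y t" "y s"] by linarith
  qed
  have m0: "m \<ge> 0" by (simp add: m_def)
  have r0s: "exp (- (2 * K * (r0 - s))) \<le> 1" using K(1) r0(1) by simp
  have "m \<le> exp (- (2 * K * (r0 - s))) * (norm (y s) + (m/2 * exp (2 * K * (r0 - s)) - m/2))"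
    unfolding m_def using y_le[OF r0(1)] m_def by (intro mult_left_mono) auto
  also have "\<dots> = exp (- (2 * K * (r0 - s))) * norm (y s) + m/2 - exp (- (2 * K * (r0 - s))) * (m/2)"
  proof -
    have *: "exp (- u) * (b + (m/2 * exp u - m/2)) = exp (- u) * b + m/2 - exp (- u) * (m/2)" for u b :: real
    proof -
      have "exp (- u) * (m/2 * exp u) = m/2" by (simp add: exp_minus)
      then show ?thesis by (simp add: distrib_left right_diff_distrib)
    qed
    show ?thesis by (rule *)
  qed
  also have "\<dots> \<le> norm (y s) + m/2"
  proof -
    have "exp (- (2 * K * (r0 - s))) * norm (y s) \<le> 1 * norm (y s)"
      using r0s by (intro mult_right_mono) auto
    moreover have "0 \<le> exp (- (2 * K * (r0 - s))) * (m/2)" using m0 by simp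
    ultimately show ?thesis by linarith
  qed
  finally have "m \<le> 2 * norm (y s)" by simp
  then have "m * exp (2 * K * (t - s)) \<le> 2 * norm (y s) * exp (2 * K * (t - s))"
    by (intro mult_right_mono) auto
  with ym[OF t] have "norm (y t) \<le> 2 * norm (y s) * exp (2 * K * (t - s))" by (rule order_trans)
  then show ?thesis by (simp only: mult_ac)
qed

lemma linear_ode_solution_restrict:
  assumes y: "linear_ode_solution A s T y" and "s \<le> r"
  shows "linear_ode_solution A r T y"
  unfolding linear_ode_solution_def
proof
  fix t assume t: "t \<in> {r..T}"
  let ?f = "\<lambda>u. A u (y u)"
  have 1: "(?f has_integral (y t - y s)) {s..t}" and 2: "(?f has_integral (y r - y s)) {s..r}"
    using y t \<open>s \<le> r\<close> by (auto simp: linear_ode_solution_def)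
  have "?f integrable_on {r..t}"
    by (rule integrable_on_subinterval[of _ "{s..t}"]) (use 1 t \<open>s \<le> r\<close> in \<open>auto simp: integrable_on_def\<close>)
  moreover have "integral {s..r} ?f + integral {r..t} ?f = integral {s..t} ?f"
    by (rule Henstock_Kurzweil_Integration.integral_combine)
       (use 1 t \<open>s \<le> r\<close> in \<open>auto simp: integrable_on_def\<close>)
  ultimately show "(?f has_integral (y t - y r)) {r..t}"
    using integral_unique[OF 1] integral_unique[OF 2]
    by (simp add: has_integral_integrable_integral algebra_simps)
qed

text \<open>For \<open>s \<le> r\<close> the cocycle identity \<open>\<Phi>(t,s) = \<Phi>(t,r) \<Phi>(r,s)\<close> reduces the difference
  \<open>\<Phi>(t,s) - \<Phi>(t,r)\<close> to \<open>\<Phi>(r,s) - 1\<close>, which is an integral over \<open>[s,r]\<close> of a function bounded by the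
  Gronwall estimate.\<close>
lemma solution_operator_Lipschitz:
  assumes \<Phi>: "solution_operator T A \<Phi>" and A: "bounded (A ` {0..T})"
  shows "\<exists>L\<ge>0. (\<forall>s t. 0 \<le> s \<and> s \<le> t \<and> t \<le> T \<longrightarrow> norm (\<Phi> t s) \<le> L) \<and>
    (\<forall>r s t. 0 \<le> s \<and> s \<le> r \<and> r \<le> t \<and> t \<le> T \<longrightarrow> norm (\<Phi> t s - \<Phi> t r) \<le> L * (r - s))"
proof -
  obtain K where K: "K > 0" "\<And>r. r \<in> {0..T} \<Longrightarrow> norm (A r) \<le> K"
    using A unfolding bounded_pos by auto
  define L where "L = 2 * exp (2 * K * T)"
  have L: "L \<ge> 0" by (simp add: L_def)
  have sol: "\<exists>y. y s = v \<and> linear_ode_solution A s T y" if "s \<in> {0..T}" for s v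
    using \<Phi> that by (auto simp: solution_operator_def)
  have flow: "y t = \<Phi> t s (y s)" if "linear_ode_solution A s T y" "s \<in> {0..T}" "t \<in> {s..T}" for y s t
    using \<Phi> that by (auto simp: solution_operator_def)
  have bound: "norm (y t) \<le> L * norm (y s)"
    if y: "linear_ode_solution A s T y" and st: "s \<in> {0..T}" "t \<in> {s..T}" for y s t
  proof -
    have "norm (y t) \<le> 2 * exp (2 * K * (t - s)) * norm (y s)"
      by (rule linear_ode_solution_bound[OF y K(1) _ st(2)]) (use st K(2) in auto)
    also have "\<dots> \<le> L * norm (y s)"
      unfolding L_def using st K(1) by (intro mult_right_mono) auto
    finally show ?thesis .
  qed
  have norm_le: "norm (\<Phi> t s) \<le> L" if st: "0 \<le> s" "s \<le> t" "t \<le> T" for s t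
  proof (rule norm_blinfun_bound[OF L])
    fix v obtain y where y: "y s = v" "linear_ode_solution A s T y" using sol[of s v] st by auto
    show "norm (\<Phi> t s v) \<le> L * norm v" using bound[OF y(2), of t] flow[OF y(2), of t] y(1) st by simp
  qed
  have lip: "norm (\<Phi> t s - \<Phi> t r) \<le> (L * (K * L)) * (r - s)"
    if st: "0 \<le> s" "s \<le> r" "r \<le> t" "t \<le> T" for r s t
  proof (rule norm_blinfun_bound)
    fix v obtain y where y: "y s = v" "linear_ode_solution A s T y" using sol[of s v] st by auto
    have y': "linear_ode_solution A r T y" by (rule linear_ode_solution_restrict[OF y(2) st(2)])
    have "norm (y r - y s) \<le> (K * (L * norm v)) * measure lborel (cbox s r)"
    proof (rule has_integral_bound)
      show "((\<lambda>u. A u (y u)) has_integral (y r - y s)) (cbox s r)"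
        using y(2) st by (auto simp: linear_ode_solution_def)
      fix u assume u: "u \<in> cbox s r"
      have "norm (A u (y u)) \<le> norm (A u) * norm (y u)" by (rule norm_blinfun)
      also have "\<dots> \<le> K * (L * norm v)"
        using K(2)[of u] bound[OF y(2), of u] u st y(1) K(1) by (intro mult_mono) auto
      finally show "norm (A u (y u)) \<le> K * (L * norm v)" .
    qed (use K L in auto)
    then have incr: "norm (y r - v) \<le> K * (L * norm v) * (r - s)" using y(1) st by simp
    have "\<Phi> t s v = \<Phi> t r (y r)"
      using flow[OF y(2), of t] flow[OF y', of t] y(1) st by simp
    then have "norm ((\<Phi> t s - \<Phi> t r) v) = norm (\<Phi> t r (y r - v))"
      by (simp add: blinfun.diff_left blinfun.diff_right)
    also have "\<dots> \<le> norm (\<Phi> t r) * norm (y r - v)" by (rule norm_blinfun)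
    also have "\<dots> \<le> L * (K * (L * norm v) * (r - s))"
      by (rule mult_mono[OF norm_le incr]) (use st L in auto)
    finally show "norm ((\<Phi> t s - \<Phi> t r) v) \<le> L * (K * L) * (r - s) * norm v" by (simp add: mult_ac)
  qed (use L K st in auto)
  show ?thesis
  proof (intro exI[of _ "max L (L * (K * L))"] conjI allI impI)
    fix s t assume "0 \<le> s \<and> s \<le> t \<and> t \<le> T"
    then show "norm (\<Phi> t s) \<le> max L (L * (K * L))" using norm_le[of s t] by auto
  next
    fix r s t assume st: "0 \<le> s \<and> s \<le> r \<and> r \<le> t \<and> t \<le> T"
    have "(L * (K * L)) * (r - s) \<le> max L (L * (K * L)) * (r - s)"
      using st by (intro mult_right_mono) auto
    then show "norm (\<Phi> t s - \<Phi> t r) \<le> max L (L * (K * L)) * (r - s)" using lip[of s r t] st by linarith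
  qed (use L in auto)
qed

corollary solution_operator_bounded:
  assumes "solution_operator T A \<Phi>" "bounded (A ` {0..T})"
  shows "\<exists>L. \<forall>s t. 0 \<le> s \<and> s \<le> t \<and> t \<le> T \<longrightarrow> norm (\<Phi> t s) \<le> L"
  using solution_operator_Lipschitz[OF assms] by blast

lemma solution_operator_continuous:
  assumes \<Phi>: "solution_operator T A \<Phi>" and A: "bounded (A ` {0..T})" and t: "t \<in> {0..T}"
  shows "continuous_on {0..t} (\<Phi> t)"
proof -
  obtain L where L: "L \<ge> 0" "\<And>r s. 0 \<le> s \<Longrightarrow> s \<le> r \<Longrightarrow> r \<le> t \<Longrightarrow> norm (\<Phi> t s - \<Phi> t r) \<le> L * (r - s)"
    using solution_operator_Lipschitz[OF \<Phi> A] t by auto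
  have "L-lipschitz_on {0..t} (\<Phi> t)"
  proof (rule lipschitz_onI[OF _ L(1)])
    fix r s assume "r \<in> {0..t}" "s \<in> {0..t}"
    then show "dist (\<Phi> t r) (\<Phi> t s) \<le> L * dist r s"
      using L(2)[of r s] L(2)[of s r] by (cases "r \<le> s") (auto simp: dist_norm norm_minus_commute)
  qed
  then show ?thesis by (rule lipschitz_on_continuous_on)
qed

section \<open>Covariance of Brownian motions\<close>

lemma integrable_product_of_squares:
  fixes X Y :: "'a \<Rightarrow> real"
  assumes [measurable]: "X \<in> borel_measurable M" "Y \<in> borel_measurable M"
    and "integrable M (\<lambda>\<omega>. (X \<omega>)\<^sup>2)" "integrable M (\<lambda>\<omega>. (Y \<omega>)\<^sup>2)"
  shows "integrable M (\<lambda>\<omega>. X \<omega> * Y \<omega>)"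
proof (rule Bochner_Integration.integrable_bound)
  show "integrable M (\<lambda>\<omega>. (X \<omega>)\<^sup>2 + (Y \<omega>)\<^sup>2)" using assms by simp
  have "\<bar>x * y\<bar> \<le> x\<^sup>2 + y\<^sup>2" for x y :: real
    using sum_squares_bound[of "\<bar>x\<bar>" "\<bar>y\<bar>"] zero_le_power2[of x] zero_le_power2[of y]
    unfolding abs_mult power2_abs by linarith
  then show "AE \<omega> in M. norm (X \<omega> * Y \<omega>) \<le> norm ((X \<omega>)\<^sup>2 + (Y \<omega>)\<^sup>2)" by simp
qed measurable

lemma (in prob_space) centered_normal_moments:
  assumes X: "distributed M lborel X (normal_density 0 \<sigma>)" and \<sigma>: "\<sigma> > 0"
  shows "integrable M X" "expectation X = 0"
    "integrable M (\<lambda>\<omega>. (X \<omega>)\<^sup>2)" "expectation (\<lambda>\<omega>. (X \<omega>)\<^sup>2) = \<sigma>\<^sup>2"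
proof -
  show "integrable M X"
    using distributed_integrable[OF X, of "\<lambda>x. x"] integrable_normal_moment_nz_1[OF \<sigma>, of 0] by simp
  show E: "expectation X = 0" by (rule normal_distributed_expectation[OF \<sigma> X])
  show "integrable M (\<lambda>\<omega>. (X \<omega>)\<^sup>2)"
    using distributed_integrable[OF X, of "\<lambda>x. x\<^sup>2"] integrable_normal_moment[OF \<sigma>, of 0 2] by simp
  show "expectation (\<lambda>\<omega>. (X \<omega>)\<^sup>2) = \<sigma>\<^sup>2"
    using normal_distributed_variance[OF \<sigma> X] E by simp
qed

lemma brownian_increment:
  assumes "brownian_motion P B" "0 \<le> s" "s < t"
  shows "distributed P lborel (\<lambda>\<omega>. B t \<omega> - B s \<omega>) (normal_density 0 (sqrt (t - s)))"
proof -
  have "\<forall>s t. 0 \<le> s \<and> s < t \<longrightarrow>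
      distributed P lborel (\<lambda>\<omega>. B t \<omega> - B s \<omega>) (normal_density 0 (sqrt (t - s)))"
    using assms(1) unfolding brownian_motion_def by (elim conjE)
  with assms(2,3) show ?thesis by simp
qed

lemma (in prob_space) brownian_moments:
  assumes B: "brownian_motion M B" and t: "t \<ge> 0"
  shows "B t \<in> borel_measurable M" "integrable M (B t)" "expectation (B t) = 0"
    "integrable M (\<lambda>\<omega>. (B t \<omega>)\<^sup>2)" "expectation (\<lambda>\<omega>. (B t \<omega>)\<^sup>2) = t"
proof -
  have m[measurable]: "B t \<in> borel_measurable M" "B 0 \<in> borel_measurable M"
    and B0: "AE \<omega> in M. B 0 \<omega> = 0"
    using B t by (auto simp: brownian_motion_def)
  show "B t \<in> borel_measurable M" by fact
  have "integrable M (B t) \<and> expectation (B t) = 0 \<and>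
      integrable M (\<lambda>\<omega>. (B t \<omega>)\<^sup>2) \<and> expectation (\<lambda>\<omega>. (B t \<omega>)\<^sup>2) = t"
  proof (cases "t = 0")
    case True
    have "integrable M (B 0) \<longleftrightarrow> integrable M (\<lambda>_. 0 :: real)"
      by (rule integrable_cong_AE) (use B0 in auto)
    moreover have "integrable M (\<lambda>\<omega>. (B 0 \<omega>)\<^sup>2) \<longleftrightarrow> integrable M (\<lambda>_. 0 :: real)"
      by (rule integrable_cong_AE) (use B0 in auto)
    moreover have "expectation (B 0) = expectation (\<lambda>_. 0)"
      by (rule integral_cong_AE) (use B0 in auto)
    moreover have "expectation (\<lambda>\<omega>. (B 0 \<omega>)\<^sup>2) = expectation (\<lambda>_. 0)"
      by (rule integral_cong_AE) (use B0 in auto)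
    ultimately show ?thesis using True by simp
  next
    case False
    then have "t > 0" using t by simp
    then have D: "distributed M lborel (\<lambda>\<omega>. B t \<omega> - B 0 \<omega>) (normal_density 0 (sqrt t))"
      using brownian_increment[OF B, of 0 t] by simp
    note mom = centered_normal_moments[OF D]
    have "integrable M (B t) \<longleftrightarrow> integrable M (\<lambda>\<omega>. B t \<omega> - B 0 \<omega>)"
      by (rule integrable_cong_AE) (use B0 in auto)
    moreover have "integrable M (\<lambda>\<omega>. (B t \<omega>)\<^sup>2) \<longleftrightarrow> integrable M (\<lambda>\<omega>. (B t \<omega> - B 0 \<omega>)\<^sup>2)"
      by (rule integrable_cong_AE) (use B0 in auto)
    moreover have "expectation (B t) = expectation (\<lambda>\<omega>. B t \<omega> - B 0 \<omega>)"
      by (rule integral_cong_AE) (use B0 in auto)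
    moreover have "expectation (\<lambda>\<omega>. (B t \<omega>)\<^sup>2) = expectation (\<lambda>\<omega>. (B t \<omega> - B 0 \<omega>)\<^sup>2)"
      by (rule integral_cong_AE) (use B0 in auto)
    ultimately show ?thesis using mom \<open>t > 0\<close> by simp
  qed
  then show "integrable M (B t)" "expectation (B t) = 0"
    "integrable M (\<lambda>\<omega>. (B t \<omega>)\<^sup>2)" "expectation (\<lambda>\<omega>. (B t \<omega>)\<^sup>2) = t" by auto
qed

text \<open>By polarization, since \<open>B\<^sub>s\<close>, \<open>B\<^sub>t\<close> and \<open>B\<^sub>t - B\<^sub>s\<close> have the variances \<open>s\<close>, \<open>t\<close> and \<open>t - s\<close>.\<close>
lemma (in prob_space) brownian_autocovariance:
  assumes B: "brownian_motion M B" and st: "s \<ge> 0" "t \<ge> 0"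
  shows "expectation (\<lambda>\<omega>. B s \<omega> * B t \<omega>) = min s t"
proof -
  have *: "expectation (\<lambda>\<omega>. B s \<omega> * B t \<omega>) = s" if st: "0 \<le> s" "s < t" for s t
  proof -
    note mom = brownian_moments[OF B]
    have D: "distributed M lborel (\<lambda>\<omega>. B t \<omega> - B s \<omega>) (normal_density 0 (sqrt (t - s)))"
      using brownian_increment[OF B] st by simp
    have "expectation (\<lambda>\<omega>. (B t \<omega> - B s \<omega>)\<^sup>2) = t - s"
      using centered_normal_moments(4)[OF D] st by simp
    moreover have "expectation (\<lambda>\<omega>. (B t \<omega> - B s \<omega>)\<^sup>2) =
        expectation (\<lambda>\<omega>. (B t \<omega>)\<^sup>2 + (B s \<omega>)\<^sup>2 - 2 * (B s \<omega> * B t \<omega>))"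
      by (simp add: power2_diff mult.commute mult.left_commute)
    moreover have "\<dots> = t + s - 2 * expectation (\<lambda>\<omega>. B s \<omega> * B t \<omega>)"
      using mom[of s] mom[of t] st integrable_product_of_squares[of "B s" M "B t"] by simp
    ultimately show ?thesis by simp
  qed
  show ?thesis
  proof (rule linorder_cases[of s t])
    assume "s = t"
    then show ?thesis using brownian_moments(5)[OF B st(1)] by (simp add: power2_eq_square)
  next
    assume "t < s"
    then show ?thesis using *[of t s] st by (simp add: mult.commute)
  qed (use * st in simp)
qed

lemma (in prob_space) independent_brownian_covariance:
  assumes W: "independent_brownian_motions M W R" and r: "r \<in> R" "q \<in> R" and st: "s \<ge> 0" "t \<ge> 0"
  shows "integrable M (\<lambda>\<omega>. W r s \<omega> * W q t \<omega>)"
    "expectation (\<lambda>\<omega>. W r s \<omega> * W q t \<omega>) = (if r = q then min s t else 0)"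
proof -
  have B: "brownian_motion M (W r)" "brownian_motion M (W q)"
    using W r by (auto simp: independent_brownian_motions_def)
  show "integrable M (\<lambda>\<omega>. W r s \<omega> * W q t \<omega>)"
    by (intro integrable_product_of_squares brownian_moments B st)
  show "expectation (\<lambda>\<omega>. W r s \<omega> * W q t \<omega>) = (if r = q then min s t else 0)"
  proof (cases "r = q")
    case True
    then show ?thesis using brownian_autocovariance[OF B(1) st] by simp
  next
    case False
    have I: "indep_vars (\<lambda>_. Pi\<^sub>M {0..} (\<lambda>_. borel)) (\<lambda>r \<omega>. \<lambda>t\<in>{0..}. W r t \<omega>) R"
      using W by (simp add: independent_brownian_motions_def)
    have eval: "(\<lambda>f. f i u) \<in> measurable (Pi\<^sub>M {i} (\<lambda>_. Pi\<^sub>M {0..} (\<lambda>_. borel))) borel"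
      if "u \<ge> 0" for i :: nat and u :: real
      by (rule measurable_compose[where N = "Pi\<^sub>M {0..} (\<lambda>_. borel)" and g = "\<lambda>f. f u"];
          rule measurable_component_singleton) (use that in auto)
    have "indep_var borel ((\<lambda>f. f r s) \<circ> (\<lambda>\<omega>. \<lambda>i\<in>{r}. \<lambda>t\<in>{0..}. W i t \<omega>))
        borel ((\<lambda>f. f q t) \<circ> (\<lambda>\<omega>. \<lambda>i\<in>{q}. \<lambda>t\<in>{0..}. W i t \<omega>))"
      by (rule indep_var_compose[OF indep_var_restrict[OF I] eval eval]) (use r False st in auto)
    moreover have "(\<lambda>f. f r s) \<circ> (\<lambda>\<omega>. \<lambda>i\<in>{r}. \<lambda>t\<in>{0..}. W i t \<omega>) = W r s"
      "(\<lambda>f. f q t) \<circ> (\<lambda>\<omega>. \<lambda>i\<in>{q}. \<lambda>t\<in>{0..}. W i t \<omega>) = W q t"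
      using st by (auto simp: fun_eq_iff)
    ultimately have "indep_var borel (W r s) borel (W q t)" by simp
    then have "expectation (\<lambda>\<omega>. W r s \<omega> * W q t \<omega>) = expectation (W r s) * expectation (W q t)"
      by (rule indep_var_lebesgue_integral) (intro brownian_moments B st)+
    then show ?thesis using False brownian_moments(3)[OF B(1) st(1)] by simp
  qed
qed

text \<open>Expansion of the square by bilinearity. Random increments on the probability space and
  indicators of time intervals have the same Gram matrix; comparing the two instances of this formula
  is the whole of the Ito isometry.\<close>
lemma mean_square_gram:
  fixes h :: "'i \<Rightarrow> 'b::real_inner"
  assumes int: "\<And>i j. i \<in> I \<Longrightarrow> j \<in> I \<Longrightarrow> integrable M (\<lambda>\<omega>. \<xi> i \<omega> * \<xi> j \<omega>)"
  shows "mean_square M (\<lambda>\<omega>. \<Sum>i\<in>I. \<xi> i \<omega> *\<^sub>R h i) =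
      ennreal (\<Sum>i\<in>I. \<Sum>j\<in>I. (LINT \<omega>|M. \<xi> i \<omega> * \<xi> j \<omega>) * inner (h i) (h j))" (is "_ = ennreal ?S")
    and "0 \<le> (\<Sum>i\<in>I. \<Sum>j\<in>I. (LINT \<omega>|M. \<xi> i \<omega> * \<xi> j \<omega>) * inner (h i) (h j))"
proof -
  have eq: "(norm (\<Sum>i\<in>I. \<xi> i \<omega> *\<^sub>R h i))\<^sup>2 = (\<Sum>i\<in>I. \<Sum>j\<in>I. \<xi> i \<omega> * \<xi> j \<omega> * inner (h i) (h j))" for \<omega>
    unfolding power2_norm_eq_inner inner_sum_left
    by (simp add: inner_sum_right sum_distrib_left mult_ac)
  have S: "(LINT \<omega>|M. (norm (\<Sum>i\<in>I. \<xi> i \<omega> *\<^sub>R h i))\<^sup>2) = ?S"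
    unfolding eq using int by (simp add: Bochner_Integration.integral_sum)
  have "integrable M (\<lambda>\<omega>. (norm (\<Sum>i\<in>I. \<xi> i \<omega> *\<^sub>R h i))\<^sup>2)"
    unfolding eq using int by (intro Bochner_Integration.integrable_sum integrable_mult_left) auto
  then have "mean_square M (\<lambda>\<omega>. \<Sum>i\<in>I. \<xi> i \<omega> *\<^sub>R h i) =
      ennreal (LINT \<omega>|M. (norm (\<Sum>i\<in>I. \<xi> i \<omega> *\<^sub>R h i))\<^sup>2)"
    unfolding E_nonneg_def by (rule nn_integral_eq_integral) simp
  then show "mean_square M (\<lambda>\<omega>. \<Sum>i\<in>I. \<xi> i \<omega> *\<^sub>R h i) = ennreal ?S"
    by (simp only: S)
  show "0 \<le> ?S"
    unfolding S[symmetric] by simp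
qed

section \<open>Elementary integrals and the Ito isometry\<close>

text \<open>A piece \<open>(a, b, B)\<close> stands for the integrand with value \<open>B\<close> on \<open>(a, b]\<close>. The intervals in a list of
  pieces may overlap, so the difference of two step functions is a concatenation of lists even if
  their partitions differ.\<close>
type_synonym piece = "real \<times> real \<times> (L2 \<Rightarrow>\<^sub>L L2)"

abbreviation time_interval :: "real \<Rightarrow> real measure" where
  "time_interval t \<equiv> restrict_space lborel {0..t}"

definition elementary_integrand :: "piece list \<Rightarrow> real \<Rightarrow> L2 \<Rightarrow>\<^sub>L L2" where
  "elementary_integrand ps s = (\<Sum>(a, b, B)\<leftarrow>ps. indicator {a<..b} s *\<^sub>R B)"

definition elementary_integral :: "piece list \<Rightarrow> (real \<Rightarrow> 'a \<Rightarrow> L2) \<Rightarrow> 'a \<Rightarrow> L2" where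
  "elementary_integral ps v \<omega> = (\<Sum>(a, b, B)\<leftarrow>ps. B (v b \<omega> - v a \<omega>))"

definition pieces_within :: "real \<Rightarrow> piece list \<Rightarrow> bool" where
  "pieces_within t ps \<longleftrightarrow> (\<forall>(a, b, B)\<in>set ps. 0 \<le> a \<and> a \<le> b \<and> b \<le> t)"

definition negate_pieces :: "piece list \<Rightarrow> piece list" where
  "negate_pieces = map (\<lambda>(a, b, B). (a, b, - B))"

lemma pieces_within_append: "pieces_within t (ps @ qs) \<longleftrightarrow> pieces_within t ps \<and> pieces_within t qs"
  by (simp add: pieces_within_def ball_Un)

lemma pieces_within_negate: "pieces_within t (negate_pieces ps) \<longleftrightarrow> pieces_within t ps"
  by (auto simp: pieces_within_def negate_pieces_def)

lemma elementary_integrand_simps: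
  "elementary_integrand [] s = 0"
  "elementary_integrand ((a, b, B) # ps) s = indicator {a<..b} s *\<^sub>R B + elementary_integrand ps s"
  "elementary_integrand (ps @ qs) s = elementary_integrand ps s + elementary_integrand qs s"
  by (simp_all add: elementary_integrand_def)

lemma elementary_integral_simps:
  "elementary_integral [] v \<omega> = 0"
  "elementary_integral ((a, b, B) # ps) v \<omega> = B (v b \<omega> - v a \<omega>) + elementary_integral ps v \<omega>"
  "elementary_integral (ps @ qs) v \<omega> = elementary_integral ps v \<omega> + elementary_integral qs v \<omega>"
  by (simp_all add: elementary_integral_def)

lemma elementary_integrand_negate: "elementary_integrand (negate_pieces ps) s = - elementary_integrand ps s"
  by (induction ps) (auto simp: elementary_integrand_simps negate_pieces_def)

lemma elementary_integral_negate: "elementary_integral (negate_pieces ps) v \<omega> = - elementary_integral ps v \<omega>"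
  by (induction ps) (auto simp: elementary_integral_simps negate_pieces_def blinfun.minus_left)

lemma elementary_integral_diff:
  "elementary_integral ps (\<lambda>t \<omega>. u t \<omega> - v t \<omega>) \<omega> = elementary_integral ps u \<omega> - elementary_integral ps v \<omega>"
  by (induction ps) (auto simp: elementary_integral_simps blinfun.diff_right)

lemma measurable_blinfun_apply[measurable]:
  fixes X :: "'a \<Rightarrow> L2" and B :: "L2 \<Rightarrow>\<^sub>L L2"
  assumes "X \<in> borel_measurable M"
  shows "(\<lambda>\<omega>. B (X \<omega>)) \<in> borel_measurable M"
  by (rule measurable_compose[OF assms borel_measurable_continuous_onI]) (intro continuous_intros)

lemma measurable_elementary_integral:
  assumes "pieces_within t ps" and "\<And>s. s \<in> {0..t} \<Longrightarrow> v s \<in> borel_measurable M"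
  shows "elementary_integral ps v \<in> borel_measurable M"
  using assms(1)
proof (induction ps)
  case Nil
  then show ?case by (simp add: elementary_integral_simps cong: measurable_cong)
next
  case (Cons p ps)
  obtain a b B where p: "p = (a, b, B)" by (cases p) auto
  have ab: "0 \<le> a" "a \<le> b" "b \<le> t" and ps: "pieces_within t ps"
    using Cons.prems by (auto simp: pieces_within_def p)
  have [measurable]: "v a \<in> borel_measurable M" "v b \<in> borel_measurable M"
      "elementary_integral ps v \<in> borel_measurable M"
    using assms(2)[of a] assms(2)[of b] ab Cons.IH[OF ps] by auto
  have "(\<lambda>\<omega>. B (v b \<omega> - v a \<omega>) + elementary_integral ps v \<omega>) \<in> borel_measurable M" by measurable
  then show ?case by (simp add: p elementary_integral_simps cong: measurable_cong)
qed

lemma simple_function_elementary_integrand: "simple_function lborel (elementary_integrand ps)"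
proof (induction ps)
  case Nil
  then show ?case by (simp add: elementary_integrand_simps cong: simple_function_cong)
next
  case (Cons p ps)
  obtain a b B where p: "p = (a, b, B)" by (cases p) auto
  have "simple_function lborel (\<lambda>s. indicator {a<..b} s :: real)"
    by (rule simple_function_indicator) simp
  then have "simple_function lborel (\<lambda>s. indicator {a<..b} s *\<^sub>R B + elementary_integrand ps s)"
    by (rule simple_function_compose2[OF _ Cons.IH, of _ "\<lambda>x y. x *\<^sub>R B + y"])
  then show ?case by (simp add: p elementary_integrand_simps cong: simple_function_cong)
qed

text \<open>Step functions are simple functions, and composing a simple function with any map
  preserves measurability whatever the space of values.\<close>
lemma measurable_norm_elementary_integrand:
  "(\<lambda>s. norm (elementary_integrand ps s)) \<in> borel_measurable (time_interval t)"
  by (intro measurable_restrict_space1 borel_measurable_simple_function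
      simple_function_compose1[OF simple_function_elementary_integrand])

text \<open>The right-hand side is the covariance of the increments of a Brownian motion over the two
  intervals.\<close>
lemma interval_gram:
  assumes "0 \<le> a" "a \<le> b" "b \<le> t" "0 \<le> c" "c \<le> d" "d \<le> t"
  shows "integrable (time_interval t) (\<lambda>s. indicator {a<..b} s * indicator {c<..d} s :: real)"
    "(LINT s|time_interval t. indicator {a<..b} s * indicator {c<..d} s) =
      (min b d - min b c) - (min a d - min a c)"
proof -
  have eq: "indicator {0..t} s *\<^sub>R (indicator {a<..b} s * indicator {c<..d} s) =
      (indicator {max a c<..min b d} s :: real)" for s
    using assms by (auto simp: indicator_def)
  show "integrable (time_interval t) (\<lambda>s. indicator {a<..b} s * indicator {c<..d} s :: real)"
    by (subst integrable_restrict_space)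
       (auto simp: eq simp del: real_scaleR_def intro!: integrable_real_indicator emeasure_bounded_finite)
  have "(LINT s|time_interval t. indicator {a<..b} s * indicator {c<..d} s) =
      measure lborel {max a c<..min b d}"
    by (subst integral_restrict_space) (auto simp: eq simp del: real_scaleR_def)
  also have "\<dots> = (min b d - min b c) - (min a d - min a c)"
    using assms by (auto simp: min_def max_def measure_def)
  finally show "(LINT s|time_interval t. indicator {a<..b} s * indicator {c<..d} s) =
      (min b d - min b c) - (min a d - min a c)" .
qed

text \<open>Increments of different Brownian motions are uncorrelated, and increments of the same one over
  \<open>(a, b]\<close> and \<open>(c, d]\<close> have the covariance \<open>\<integral> 1\<^bsub>(a,b]\<^esub> 1\<^bsub>(c,d]\<^esub>\<close>. So the Gram expansion over pairs
  (piece, Brownian motion) on the probability space collapses to the sum over \<open>r\<close> of the Gram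
  expansions on the time interval.\<close>
lemma ito_isometry:
  assumes "prob_space P" and W: "independent_brownian_motions P W {1..}" and ps: "pieces_within t ps"
  shows "mean_square P (elementary_integral ps (\<lambda>s \<omega>. \<Sum>r=1..n. W r s \<omega> *\<^sub>R g r)) =
    (\<Sum>r=1..n. mean_square (time_interval t) (\<lambda>s. elementary_integrand ps s (g r)))"
proof -
  interpret prob_space P by fact
  define l where "l = length ps"
  define a where "a i = fst (ps ! i)" for i
  define b where "b i = fst (snd (ps ! i))" for i
  define B where "B i = snd (snd (ps ! i))" for i
  have ps_nth: "ps ! i = (a i, b i, B i)" for i by (simp add: a_def b_def B_def)
  have ab: "0 \<le> a i" "a i \<le> b i" "b i \<le> t" "0 \<le> b i" if "i < l" for i
  proof -
    have "(a i, b i, B i) \<in> set ps" using that ps_nth[of i] nth_mem[of i ps] by (simp add: l_def)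
    then show "0 \<le> a i" "a i \<le> b i" "b i \<le> t" "0 \<le> b i" using ps by (auto simp: pieces_within_def)
  qed
  have integral_eq: "elementary_integral ps v \<omega> = (\<Sum>i<l. B i (v (b i) \<omega> - v (a i) \<omega>))" for v and \<omega> :: 'a
    by (simp add: elementary_integral_def sum_list_sum_nth l_def ps_nth atLeast0LessThan)
  have integrand_eq: "elementary_integrand ps s = (\<Sum>i<l. indicator {a i<..b i} s *\<^sub>R B i)" for s
    by (simp add: elementary_integrand_def sum_list_sum_nth l_def ps_nth atLeast0LessThan)
  define c where "c i j = (LINT s|time_interval t. indicator {a i<..b i} s * indicator {a j<..b j} s :: real)" for i j
  define \<xi> where "\<xi> = (\<lambda>(i, r) \<omega>. W r (b i) \<omega> - W r (a i) \<omega>)"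
  define h where "h = (\<lambda>(i, r). B i (g r))"
  have \<xi>_int: "integrable P (\<lambda>\<omega>. \<xi> p \<omega> * \<xi> q \<omega>)"
    and \<xi>_cov: "expectation (\<lambda>\<omega>. \<xi> p \<omega> * \<xi> q \<omega>) = (if snd p = snd q then c (fst p) (fst q) else 0)"
    if pq: "p \<in> {..<l} \<times> {1..n}" "q \<in> {..<l} \<times> {1..n}" for p q
  proof -
    obtain i r j k where p: "p = (i, r)" and q: "q = (j, k)" by (cases p, cases q) auto
    have ij: "i < l" "j < l" and rk: "r \<in> {1..}" "k \<in> {1..}" using pq by (auto simp: p q)
    note cov = independent_brownian_covariance[OF W rk]
    have eq: "\<xi> p \<omega> * \<xi> q \<omega> = (W r (b i) \<omega> * W k (b j) \<omega> - W r (b i) \<omega> * W k (a j) \<omega>) -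
        (W r (a i) \<omega> * W k (b j) \<omega> - W r (a i) \<omega> * W k (a j) \<omega>)" for \<omega>
      by (simp add: \<xi>_def p q algebra_simps)
    show "integrable P (\<lambda>\<omega>. \<xi> p \<omega> * \<xi> q \<omega>)"
      unfolding eq using ab[OF ij(1)] ab[OF ij(2)] by (intro Bochner_Integration.integrable_diff cov) auto
    show "expectation (\<lambda>\<omega>. \<xi> p \<omega> * \<xi> q \<omega>) = (if snd p = snd q then c (fst p) (fst q) else 0)"
      unfolding eq using ab[OF ij(1)] ab[OF ij(2)]
      by (simp add: cov p q c_def interval_gram)
  qed
  have sq_r: "mean_square (time_interval t) (\<lambda>s. elementary_integrand ps s (g r)) =
      ennreal (\<Sum>i<l. \<Sum>j<l. c i j * inner (h (i, r)) (h (j, r)))"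
    and pos: "0 \<le> (\<Sum>i<l. \<Sum>j<l. c i j * inner (h (i, r)) (h (j, r)))" for r
  proof -
    have int: "integrable (time_interval t) (\<lambda>s. indicator {a i<..b i} s * indicator {a j<..b j} s :: real)"
      if "i \<in> {..<l}" "j \<in> {..<l}" for i j
      using that ab[of i] ab[of j] by (intro interval_gram) auto
    have "elementary_integrand ps s (g r) = (\<Sum>i<l. indicator {a i<..b i} s *\<^sub>R h (i, r))" for s
      by (simp add: integrand_eq blinfun.sum_left blinfun.scaleR_left h_def)
    then show "mean_square (time_interval t) (\<lambda>s. elementary_integrand ps s (g r)) =
      ennreal (\<Sum>i<l. \<Sum>j<l. c i j * inner (h (i, r)) (h (j, r)))"
      using mean_square_gram(1)[where M = "time_interval t" and I = "{..<l}"
          and \<xi> = "\<lambda>i. indicator {a i<..b i}" and h = "\<lambda>i. h (i, r)", OF int] by (simp add: c_def)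
    show "0 \<le> (\<Sum>i<l. \<Sum>j<l. c i j * inner (h (i, r)) (h (j, r)))"
      using mean_square_gram(2)[where M = "time_interval t" and I = "{..<l}"
          and \<xi> = "\<lambda>i. indicator {a i<..b i}" and h = "\<lambda>i. h (i, r)", OF int] by (simp add: c_def)
  qed
  have "elementary_integral ps (\<lambda>s \<omega>. \<Sum>r=1..n. W r s \<omega> *\<^sub>R g r) \<omega> =
      (\<Sum>p\<in>{..<l}\<times>{1..n}. \<xi> p \<omega> *\<^sub>R h p)" for \<omega>
  proof -
    have "elementary_integral ps (\<lambda>s \<omega>. \<Sum>r=1..n. W r s \<omega> *\<^sub>R g r) \<omega> =
        (\<Sum>i<l. \<Sum>r=1..n. \<xi> (i, r) \<omega> *\<^sub>R h (i, r))"
      unfolding integral_eq sum_subtractf[symmetric] scaleR_left_diff_distrib[symmetric]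
      by (simp add: blinfun.sum_right blinfun.scaleR_right \<xi>_def h_def)
    then show ?thesis by (simp add: sum.cartesian_product)
  qed
  then have "mean_square P (elementary_integral ps (\<lambda>s \<omega>. \<Sum>r=1..n. W r s \<omega> *\<^sub>R g r)) =
      mean_square P (\<lambda>\<omega>. \<Sum>p\<in>{..<l}\<times>{1..n}. \<xi> p \<omega> *\<^sub>R h p)"
    by simp
  also have "\<dots> = ennreal (\<Sum>p\<in>{..<l}\<times>{1..n}. \<Sum>q\<in>{..<l}\<times>{1..n}.
      expectation (\<lambda>\<omega>. \<xi> p \<omega> * \<xi> q \<omega>) * inner (h p) (h q))"
    using \<xi>_int by (rule mean_square_gram)
  also have "(\<Sum>p\<in>{..<l}\<times>{1..n}. \<Sum>q\<in>{..<l}\<times>{1..n}.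
      expectation (\<lambda>\<omega>. \<xi> p \<omega> * \<xi> q \<omega>) * inner (h p) (h q)) =
      (\<Sum>p\<in>{..<l}\<times>{1..n}. \<Sum>q\<in>{..<l}\<times>{1..n}.
        (if snd p = snd q then c (fst p) (fst q) else 0) * inner (h p) (h q))"
    by (intro sum.cong refl) (simp only: \<xi>_cov)
  also have "\<dots> = (\<Sum>i<l. \<Sum>r=1..n. \<Sum>j<l. \<Sum>k=1..n.
      (if r = k then c i j else 0) * inner (h (i, r)) (h (j, k)))"
  proof -
    have split: "(\<Sum>p\<in>{..<l}\<times>{1..n}. f p) = (\<Sum>i<l. \<Sum>r=1..n. f (i, r))" for f :: "nat \<times> nat \<Rightarrow> real"
      by (simp add: sum.cartesian_product)
    show ?thesis by (simp only: split fst_conv snd_conv)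
  qed
  also have "\<dots> = (\<Sum>i<l. \<Sum>r=1..n. \<Sum>j<l. c i j * inner (h (i, r)) (h (j, r)))"
  proof (intro sum.cong refl)
    fix i r j assume r: "r \<in> {1..n}"
    have "(\<Sum>k=1..n. (if r = k then c i j else 0) * inner (h (i, r)) (h (j, k))) =
        (\<Sum>k=1..n. if r = k then c i j * inner (h (i, r)) (h (j, k)) else 0)"
      by (intro sum.cong) auto
    also have "\<dots> = c i j * inner (h (i, r)) (h (j, r))" using r by (simp add: sum.delta)
    finally show "(\<Sum>k=1..n. (if r = k then c i j else 0) * inner (h (i, r)) (h (j, k))) =
        c i j * inner (h (i, r)) (h (j, r))" .
  qed
  also have "\<dots> = (\<Sum>r=1..n. \<Sum>i<l. \<Sum>j<l. c i j * inner (h (i, r)) (h (j, r)))"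
    by (rule sum.swap)
  also have "ennreal \<dots> = (\<Sum>r=1..n. ennreal (\<Sum>i<l. \<Sum>j<l. c i j * inner (h (i, r)) (h (j, r))))"
    using pos by (intro sum_ennreal[symmetric]) auto
  finally show ?thesis unfolding sq_r .
qed

text \<open>The Ito inequality with constant \<open>\<kappa>\<close>. It is demanded of elementary integrals with arbitrary pieces;
  that is a property of the covariance of the process alone, so it survives passage to limits
  and does not mention the Brownian motions.\<close>
definition ito_bounded :: "'a measure \<Rightarrow> real \<Rightarrow> real \<Rightarrow> (real \<Rightarrow> 'a \<Rightarrow> L2) \<Rightarrow> bool" where
  "ito_bounded P T \<kappa> v \<longleftrightarrow> \<kappa> \<ge> 0 \<and> (\<forall>t\<in>{0..T}. v t \<in> borel_measurable P) \<and>
     (\<forall>t\<in>{0..T}. \<forall>ps. pieces_within t ps \<longrightarrow>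
        mean_square P (elementary_integral ps v) \<le>
          ennreal \<kappa> * mean_square (time_interval t) (elementary_integrand ps))"

text \<open>From the isometry and \<open>\<parallel>B g\<parallel> \<le> \<parallel>B\<parallel> \<parallel>g\<parallel>\<close>. The constant is the trace of the covariance.\<close>
lemma ito_bounded_finite_noise:
  assumes "prob_space P" and W: "independent_brownian_motions P W {1..}"
  shows "ito_bounded P T (\<Sum>r=1..n. (norm (g r))\<^sup>2) (\<lambda>s \<omega>. \<Sum>r=1..n. W r s \<omega> *\<^sub>R g r)"
  unfolding ito_bounded_def
proof (intro conjI ballI allI impI)
  have [measurable]: "W r t \<in> borel_measurable P" if "r \<in> {1..}" "t \<ge> 0" for r t
    using W that by (auto simp: independent_brownian_motions_def brownian_motion_def)
  show "(\<lambda>\<omega>. \<Sum>r=1..n. W r t \<omega> *\<^sub>R g r) \<in> borel_measurable P" if "t \<in> {0..T}" for t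
    using that by (intro borel_measurable_sum borel_measurable_scaleR) auto
next
  fix t ps assume "pieces_within t ps"
  have "mean_square (time_interval t) (\<lambda>s. elementary_integrand ps s (g r)) \<le>
      ennreal ((norm (g r))\<^sup>2) * mean_square (time_interval t) (elementary_integrand ps)" for r
  proof -
    have "mean_square (time_interval t) (\<lambda>s. elementary_integrand ps s (g r)) \<le>
        (\<integral>\<^sup>+ s. ennreal ((norm (g r))\<^sup>2) * ennreal ((norm (elementary_integrand ps s))\<^sup>2) \<partial>time_interval t)"
      unfolding E_nonneg_def
    proof (rule nn_integral_mono)
      fix s
      have "(norm (elementary_integrand ps s (g r)))\<^sup>2 \<le> (norm (elementary_integrand ps s) * norm (g r))\<^sup>2"
        by (intro power_mono norm_blinfun) simp
      then show "ennreal ((norm (elementary_integrand ps s (g r)))\<^sup>2) \<le>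
          ennreal ((norm (g r))\<^sup>2) * ennreal ((norm (elementary_integrand ps s))\<^sup>2)"
        by (simp add: power_mult_distrib mult.commute ennreal_leI flip: ennreal_mult)
    qed
    also have "\<dots> = ennreal ((norm (g r))\<^sup>2) * mean_square (time_interval t) (elementary_integrand ps)"
      unfolding E_nonneg_def
      by (intro nn_integral_cmult measurable_compose[OF measurable_norm_elementary_integrand,
            where g = "\<lambda>x. ennreal (x\<^sup>2)"]) measurable
    finally show ?thesis .
  qed
  then have "mean_square P (elementary_integral ps (\<lambda>s \<omega>. \<Sum>r=1..n. W r s \<omega> *\<^sub>R g r)) \<le>
      (\<Sum>r=1..n. ennreal ((norm (g r))\<^sup>2) * mean_square (time_interval t) (elementary_integrand ps))"
    unfolding ito_isometry[OF assms \<open>pieces_within t ps\<close>] by (intro sum_mono)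
  also have "\<dots> = ennreal (\<Sum>r=1..n. (norm (g r))\<^sup>2) * mean_square (time_interval t) (elementary_integrand ps)"
    by (simp add: sum_distrib_right[symmetric] sum_ennreal)
  finally show "mean_square P (elementary_integral ps (\<lambda>s \<omega>. \<Sum>r=1..n. W r s \<omega> *\<^sub>R g r)) \<le>
      ennreal (\<Sum>r=1..n. (norm (g r))\<^sup>2) * mean_square (time_interval t) (elementary_integrand ps)" .
qed (simp add: sum_nonneg)

lemma finite_noise_variance:
  fixes g :: "nat \<Rightarrow> 'b::real_inner"
  assumes "prob_space P" and W: "independent_brownian_motions P W {1..}" and t: "t \<ge> 0"
  shows "mean_square P (\<lambda>\<omega>. \<Sum>r=1..n. W r t \<omega> *\<^sub>R g r) = ennreal (t * (\<Sum>r=1..n. (norm (g r))\<^sup>2))"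
proof -
  interpret prob_space P by fact
  have cov: "integrable P (\<lambda>\<omega>. W r t \<omega> * W q t \<omega>)"
    "expectation (\<lambda>\<omega>. W r t \<omega> * W q t \<omega>) = (if r = q then t else 0)"
    if "r \<in> {1..n}" "q \<in> {1..n}" for r q
    using independent_brownian_covariance[OF W, of r q t t] that t by auto
  have "mean_square P (\<lambda>\<omega>. \<Sum>r=1..n. W r t \<omega> *\<^sub>R g r) =
      ennreal (\<Sum>r=1..n. \<Sum>q=1..n. expectation (\<lambda>\<omega>. W r t \<omega> * W q t \<omega>) * inner (g r) (g q))"
    using cov(1) by (rule mean_square_gram)
  also have "(\<Sum>r=1..n. \<Sum>q=1..n. expectation (\<lambda>\<omega>. W r t \<omega> * W q t \<omega>) * inner (g r) (g q)) =
      (\<Sum>r=1..n. \<Sum>q=1..n. if r = q then t * inner (g r) (g q) else 0)"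
    by (intro sum.cong refl) (simp add: cov)
  also have "\<dots> = (\<Sum>r=1..n. t * (norm (g r))\<^sup>2)"
    by (intro sum.cong refl) (simp add: sum.delta power2_norm_eq_inner)
  finally show ?thesis by (simp add: sum_distrib_left)
qed

lemma mean_square_scaled_blinfun:
  fixes X :: "'a \<Rightarrow> L2" and B :: "L2 \<Rightarrow>\<^sub>L L2"
  assumes [measurable]: "X \<in> borel_measurable M"
  shows "mean_square M (\<lambda>\<omega>. B (X \<omega>)) \<le> ennreal ((norm B)\<^sup>2) * mean_square M X"
proof -
  have "mean_square M (\<lambda>\<omega>. B (X \<omega>)) \<le> (\<integral>\<^sup>+ \<omega>. ennreal ((norm B)\<^sup>2) * ennreal ((norm (X \<omega>))\<^sup>2) \<partial>M)"
    unfolding E_nonneg_def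
  proof (rule nn_integral_mono)
    fix \<omega>
    have "(norm (B (X \<omega>)))\<^sup>2 \<le> (norm B * norm (X \<omega>))\<^sup>2" by (intro power_mono norm_blinfun) simp
    then show "ennreal ((norm (B (X \<omega>)))\<^sup>2) \<le> ennreal ((norm B)\<^sup>2) * ennreal ((norm (X \<omega>))\<^sup>2)"
      by (simp add: power_mult_distrib ennreal_leI flip: ennreal_mult)
  qed
  also have "\<dots> = ennreal ((norm B)\<^sup>2) * mean_square M X"
    unfolding E_nonneg_def by (simp add: nn_integral_cmult)
  finally show ?thesis .
qed

lemma elementary_integral_tendsto:
  assumes V: "\<And>n s. s \<in> {0..t} \<Longrightarrow> V n s \<in> borel_measurable P"
    and lim: "\<And>s. s \<in> {0..t} \<Longrightarrow> (\<lambda>n. mean_square P (V n s)) \<longlonglongrightarrow> 0"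
    and ps: "pieces_within t ps"
  shows "(\<lambda>n. mean_square P (elementary_integral ps (V n))) \<longlonglongrightarrow> 0"
  using ps
proof (induction ps)
  case Nil
  then show ?case by (simp add: elementary_integral_simps E_nonneg_def)
next
  case (Cons p ps)
  obtain a b B where p: "p = (a, b, B)" by (cases p) auto
  have ab: "a \<in> {0..t}" "b \<in> {0..t}" and ps: "pieces_within t ps"
    using Cons.prems by (auto simp: pieces_within_def p)
  have [measurable]: "V n a \<in> borel_measurable P" "V n b \<in> borel_measurable P"
      "elementary_integral ps (V n) \<in> borel_measurable P" for n
    using V ab measurable_elementary_integral[OF ps V] by auto
  have 1: "(\<lambda>n. 2 * mean_square P (V n b) + 2 * mean_square P (V n a)) \<longlonglongrightarrow> 0"
    by (intro ennreal_tendsto_0_combine lim ab) auto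
  have 2: "(\<lambda>n. mean_square P (\<lambda>\<omega>. V n b \<omega> - V n a \<omega>)) \<longlonglongrightarrow> 0"
    by (rule ennreal_tendsto_0_squeeze[OF mean_square_triangle 1]) (auto intro: norm_triangle_ineq4)
  have 3: "(\<lambda>n. mean_square P (\<lambda>\<omega>. B (V n b \<omega> - V n a \<omega>))) \<longlonglongrightarrow> 0"
    by (rule ennreal_tendsto_0_squeeze[OF mean_square_scaled_blinfun])
       (use ennreal_tendsto_cmult[OF _ 2, of "ennreal ((norm B)\<^sup>2)"] in auto)
  have 4: "(\<lambda>n. 2 * mean_square P (\<lambda>\<omega>. B (V n b \<omega> - V n a \<omega>)) +
      2 * mean_square P (elementary_integral ps (V n))) \<longlonglongrightarrow> 0"
    by (intro ennreal_tendsto_0_combine 3 Cons.IH[OF ps]) auto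
  show ?case
    unfolding p elementary_integral_simps
    by (rule ennreal_tendsto_0_squeeze[OF mean_square_triangle 4]) (auto intro: norm_triangle_ineq)
qed

text \<open>An elementary integral uses finitely many values of the process, so it depends continuously on them
  in mean square. The factor 2 comes from splitting off the error with \<open>mean_square_triangle\<close>.\<close>
lemma ito_bounded_limit:
  assumes V: "\<And>n s. s \<in> {0..T} \<Longrightarrow> V n s \<in> borel_measurable P"
    and v: "\<And>s. s \<in> {0..T} \<Longrightarrow> v s \<in> borel_measurable P"
    and lim: "\<And>s. s \<in> {0..T} \<Longrightarrow> (\<lambda>n. mean_square P (\<lambda>\<omega>. V n s \<omega> - v s \<omega>)) \<longlonglongrightarrow> 0"
    and ito: "\<forall>\<^sub>F n in sequentially. ito_bounded P T \<kappa> (V n)"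
  shows "ito_bounded P T (2 * \<kappa>) v"
  unfolding ito_bounded_def
proof (intro conjI ballI allI impI v)
  show "0 \<le> 2 * \<kappa>"
    using eventually_happens'[OF _ ito] by (auto simp: ito_bounded_def)
  then have \<kappa>: "\<kappa> \<ge> 0" by simp
  fix t ps assume t: "t \<in> {0..T}" and ps: "pieces_within t ps"
  let ?D = "\<lambda>n t \<omega>. V n t \<omega> - v t \<omega>"
  have sub: "s \<in> {0..t} \<Longrightarrow> s \<in> {0..T}" for s using t by auto
  have [measurable]: "elementary_integral ps (V n) \<in> borel_measurable P"
    "elementary_integral ps v \<in> borel_measurable P" "elementary_integral ps (?D n) \<in> borel_measurable P" for n
    by (intro measurable_elementary_integral[OF ps] V v borel_measurable_diff sub; assumption)+
  have D: "(\<lambda>n. mean_square P (elementary_integral ps (?D n))) \<longlonglongrightarrow> 0"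
    by (rule elementary_integral_tendsto[OF _ _ ps]) (use V v lim sub in auto)
  have "(\<lambda>n. 2 * mean_square P (elementary_integral ps (?D n))) \<longlonglongrightarrow> 0"
    using ennreal_tendsto_cmult[OF _ D, of 2] by simp
  then show "mean_square P (elementary_integral ps v) \<le>
      ennreal (2 * \<kappa>) * mean_square (time_interval t) (elementary_integrand ps)"
  proof (rule ennreal_le_limI)
    show "\<forall>\<^sub>F n in sequentially. mean_square P (elementary_integral ps v) \<le>
        ennreal (2 * \<kappa>) * mean_square (time_interval t) (elementary_integrand ps) +
        2 * mean_square P (elementary_integral ps (?D n))"
      using ito
    proof eventually_elim
      case (elim n)
      have "mean_square P (elementary_integral ps v) \<le>
          2 * mean_square P (elementary_integral ps (V n)) + 2 * mean_square P (elementary_integral ps (?D n))"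
        by (rule mean_square_triangle)
           (use norm_triangle_ineq4[of "elementary_integral ps (V n) \<omega>" "elementary_integral ps (V n) \<omega> - elementary_integral ps v \<omega>" for \<omega>]
             in \<open>auto simp: elementary_integral_diff\<close>)
      also have "\<dots> \<le> 2 * (ennreal \<kappa> * mean_square (time_interval t) (elementary_integrand ps)) +
          2 * mean_square P (elementary_integral ps (?D n))"
        using elim t ps by (intro add_right_mono mult_left_mono) (auto simp: ito_bounded_def)
      finally show ?case using \<kappa> by (simp add: ennreal_mult mult.assoc)
    qed
  qed
qed

lemma ito_bounded_mono:
  assumes v: "ito_bounded P T \<kappa> v" and le: "\<kappa> \<le> \<kappa>'"
  shows "ito_bounded P T \<kappa>' v"
  unfolding ito_bounded_def
proof (intro conjI ballI allI impI)
  fix t ps assume "t \<in> {0..T}" "pieces_within t ps"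
  then have "mean_square P (elementary_integral ps v) \<le>
      ennreal \<kappa> * mean_square (time_interval t) (elementary_integrand ps)"
    using v by (simp add: ito_bounded_def)
  also have "\<dots> \<le> ennreal \<kappa>' * mean_square (time_interval t) (elementary_integrand ps)"
    using le by (intro mult_right_mono ennreal_leI) auto
  finally show "mean_square P (elementary_integral ps v) \<le>
      ennreal \<kappa>' * mean_square (time_interval t) (elementary_integrand ps)" .
qed (use v le in \<open>auto simp: ito_bounded_def\<close>)

text \<open>The partial sums have the trace \<open>\<Sum>\<^sub>r \<parallel>g\<^sub>r\<parallel>\<^sup>2\<close>, which equals their variance at time \<open>T\<close> divided by \<open>T\<close>; it is
  therefore controlled by the variance of the limit at the single time \<open>T\<close>. The constant 8 is a product
  of three factors 2: two from comparing the partial sum with its limit, one from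
  \<open>ito_bounded_limit\<close>.\<close>
lemma ito_bounded_noise:
  assumes "prob_space P" and W: "independent_brownian_motions P W {1..}" and T: "T > 0"
    and v: "\<And>t. t \<in> {0..T} \<Longrightarrow> mean_square_limit P (\<lambda>n \<omega>. \<Sum>r=1..n. W r t \<omega> *\<^sub>R g r) (v t)"
    and small: "mean_square P (v T) \<le> ennreal \<epsilon>" and "\<epsilon> > 0"
  shows "ito_bounded P T (8 * \<epsilon> / T) v"
proof -
  define U where "U n t \<omega> = (\<Sum>r=1..n. W r t \<omega> *\<^sub>R g r)" for n t \<omega>
  have [measurable]: "W r t \<in> borel_measurable P" if "r \<in> {1..}" "t \<ge> 0" for r t
    using W that by (auto simp: independent_brownian_motions_def brownian_motion_def)
  have U_meas: "U n t \<in> borel_measurable P" if "t \<in> {0..T}" for n t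
    unfolding U_def[abs_def] using that by (intro borel_measurable_sum borel_measurable_scaleR) auto
  have v_meas: "v t \<in> borel_measurable P" and lim: "(\<lambda>n. mean_square P (\<lambda>\<omega>. U n t \<omega> - v t \<omega>)) \<longlonglongrightarrow> 0"
    if "t \<in> {0..T}" for t
    using v[OF that] by (simp_all add: mean_square_limit_def U_def)
  have T': "T \<in> {0..T}" using T by simp
  note [measurable] = U_meas[OF T'] v_meas[OF T']
  have "\<forall>\<^sub>F n in sequentially. ito_bounded P T (4 * \<epsilon> / T) (U n)"
    using ennreal_tendsto_0D[OF lim[OF T'] \<open>\<epsilon> > 0\<close>]
  proof eventually_elim
    case (elim n)
    have "ennreal (T * (\<Sum>r=1..n. (norm (g r))\<^sup>2)) = mean_square P (U n T)"
      unfolding U_def using T by (intro finite_noise_variance[symmetric] assms) simp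
    also have "\<dots> \<le> 2 * mean_square P (\<lambda>\<omega>. U n T \<omega> - v T \<omega>) + 2 * mean_square P (v T)"
      by (rule mean_square_triangle)
         (use norm_triangle_ineq[of "U n T \<omega> - v T \<omega>" "v T \<omega>" for \<omega>] in auto)
    also have "\<dots> \<le> 2 * ennreal \<epsilon> + 2 * ennreal \<epsilon>"
      using elim small by (intro add_mono mult_left_mono) auto
    also have "\<dots> = ennreal (4 * \<epsilon>)"
      using \<open>\<epsilon> > 0\<close> by (simp add: ennreal_mult flip: distrib_right)
    finally have "T * (\<Sum>r=1..n. (norm (g r))\<^sup>2) \<le> 4 * \<epsilon>"
      using \<open>\<epsilon> > 0\<close> by (simp add: ennreal_le_iff)
    then have trace: "(\<Sum>r=1..n. (norm (g r))\<^sup>2) \<le> 4 * \<epsilon> / T" using T by (simp add: field_simps)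
    have "ito_bounded P T (\<Sum>r=1..n. (norm (g r))\<^sup>2) (U n)"
      unfolding U_def[abs_def] by (rule ito_bounded_finite_noise[OF assms(1,2)])
    with trace show ?case by (rule ito_bounded_mono[rotated])
  qed
  then have "ito_bounded P T (2 * (4 * \<epsilon> / T)) v"
    by (rule ito_bounded_limit[rotated 3]) (use U_meas v_meas lim in auto)
  then show ?thesis by simp
qed

section \<open>Stochastic integrals\<close>

lemma mean_square_time_interval_le:
  assumes "t \<ge> 0" "\<And>s. s \<in> {0..t} \<Longrightarrow> norm (F s) \<le> c" "c \<ge> 0"
  shows "mean_square (time_interval t) F \<le> ennreal (c\<^sup>2 * t)"
proof -
  have "mean_square (time_interval t) F \<le> mean_square (time_interval t) (\<lambda>s. c)"
    by (rule mean_square_mono) (use assms in \<open>auto intro!: AE_I2 simp: space_restrict_space\<close>)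
  also have "\<dots> = ennreal (c\<^sup>2) * emeasure (time_interval t) {0..t}"
    by (simp add: E_nonneg_def nn_integral_const space_restrict_space)
  also have "\<dots> = ennreal (c\<^sup>2 * t)"
    using assms(1) by (simp add: emeasure_restrict_space ennreal_mult)
  finally show ?thesis .
qed

text \<open>The step function has finitely many values \<open>B\<close>, and on the set where it equals \<open>B\<close> the norm is
  the continuous function \<open>\<parallel>B - F s\<parallel>\<close>.\<close>
lemma measurable_norm_elementary_integrand_diff:
  assumes F: "continuous_on {0..t} F"
  shows "(\<lambda>s. norm (elementary_integrand ps s - F s)) \<in> borel_measurable (time_interval t)"
proof -
  let ?S = "elementary_integrand ps"
  have S: "finite (range ?S)" "\<And>B. ?S -` {B} \<in> sets lborel"
    using simple_functionD[OF simple_function_elementary_integrand[of ps]] by auto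
  have eq: "norm (?S s - F s) = (\<Sum>B\<in>range ?S. indicator (?S -` {B}) s * norm (B - F s))" for s
  proof -
    have "(\<Sum>B\<in>range ?S. indicator (?S -` {B}) s * norm (B - F s)) =
        (\<Sum>B\<in>range ?S. if ?S s = B then norm (B - F s) else 0)"
      by (intro sum.cong) (auto simp: indicator_def)
    then show ?thesis using S(1) by (simp add: sum.delta)
  qed
  have "(\<lambda>s. norm (B - F s)) \<in> borel_measurable (restrict_space borel {0..t})" for B
    by (intro borel_measurable_continuous_on_restrict continuous_intros F)
  then have "(\<lambda>s. norm (B - F s)) \<in> borel_measurable (time_interval t)" for B
    by (simp cong: measurable_cong_sets add: sets_restrict_space)
  moreover have "indicator (?S -` {B}) \<in> borel_measurable (time_interval t)" for B
    using S(2) by (intro measurable_restrict_space1 borel_measurable_indicator)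
  ultimately show ?thesis
    unfolding eq by (intro borel_measurable_sum borel_measurable_times)
qed

lemma measurable_norm_continuous:
  fixes F :: "real \<Rightarrow> L2 \<Rightarrow>\<^sub>L L2"
  assumes F: "continuous_on {0..t} F"
  shows "(\<lambda>s. norm (F s)) \<in> borel_measurable (time_interval t)"
  using measurable_norm_elementary_integrand_diff[OF F, of "[]"] by (simp add: elementary_integrand_simps)

lemma mean_square_elementary_integrand_diff_finite:
  assumes F: "continuous_on {0..t} F" and t: "t \<ge> 0"
  shows "mean_square (time_interval t) (\<lambda>s. elementary_integrand ps s - F s) < \<infinity>"
proof -
  have "bounded (range (elementary_integrand ps))"
    using simple_functionD(1)[OF simple_function_elementary_integrand[of ps]]
    by (intro finite_imp_bounded) simp
  then obtain b where b: "b > 0" "\<And>s. norm (elementary_integrand ps s) \<le> b"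
    unfolding bounded_pos by auto
  have "bounded (F ` {0..t})"
    by (intro compact_imp_bounded compact_continuous_image F) simp
  then obtain c where c: "c > 0" "\<And>s. s \<in> {0..t} \<Longrightarrow> norm (F s) \<le> c"
    unfolding bounded_pos by auto
  have "mean_square (time_interval t) (\<lambda>s. elementary_integrand ps s - F s) \<le> ennreal ((b + c)\<^sup>2 * t)"
  proof (rule mean_square_time_interval_le[OF t])
    fix s assume "s \<in> {0..t}"
    then show "norm (elementary_integrand ps s - F s) \<le> b + c"
      using b(2)[of s] c(2)[of s] norm_triangle_ineq4[of "elementary_integrand ps s" "F s"] by linarith
  qed (use b c in simp)
  then show ?thesis by (simp add: order_le_less_trans)
qed

definition step_pieces :: "nat \<Rightarrow> (nat \<Rightarrow> real) \<Rightarrow> (nat \<Rightarrow> L2 \<Rightarrow>\<^sub>L L2) \<Rightarrow> piece list" where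
  "step_pieces n \<tau> B = map (\<lambda>i. (\<tau> i, \<tau> (Suc i), B i)) [0..<n]"

definition partition_pieces :: "real \<Rightarrow> piece list \<Rightarrow> bool" where
  "partition_pieces t ps \<longleftrightarrow>
     (\<exists>n \<tau> B. \<tau> 0 = 0 \<and> \<tau> n = t \<and> (\<forall>i<n. \<tau> i \<le> \<tau> (Suc i)) \<and> ps = step_pieces n \<tau> B)"

lemma step_integrand_eq: "step_integrand n \<tau> B s = elementary_integrand (step_pieces n \<tau> B) s"
  by (simp add: step_integrand_def elementary_integrand_def step_pieces_def comp_def
      interv_sum_list_conv_sum_set_nat atLeast0LessThan)

lemma step_stochastic_integral_eq:
  "step_stochastic_integral n \<tau> B w \<omega> = elementary_integral (step_pieces n \<tau> B) w \<omega>"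
  by (simp add: step_stochastic_integral_def elementary_integral_def step_pieces_def comp_def
      interv_sum_list_conv_sum_set_nat atLeast0LessThan)

lemma partition_pieces_within:
  assumes "partition_pieces t ps"
  shows "pieces_within t ps"
proof -
  obtain n \<tau> B where \<tau>: "\<tau> 0 = 0" "\<tau> n = t" "\<forall>i<n. \<tau> i \<le> \<tau> (Suc i)" and ps: "ps = step_pieces n \<tau> B"
    using assms by (auto simp: partition_pieces_def)
  have mono: "\<tau> i \<le> \<tau> j" if "i \<le> j" "j \<le> n" for i j
    using that(1,2)
  proof (induction j rule: dec_induct)
    case (step k)
    then show ?case using \<tau>(3)[rule_format, of k] by simp
  qed simp
  have "0 \<le> \<tau> i \<and> \<tau> i \<le> \<tau> (Suc i) \<and> \<tau> (Suc i) \<le> t" if "i < n" for i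
    using mono[of 0 i] mono[of i "Suc i"] mono[of "Suc i" n] that \<tau>(1,2) by auto
  then show ?thesis by (auto simp: pieces_within_def ps step_pieces_def)
qed

text \<open>For continuous integrands the integrability condition in the definition holds automatically, and the
  two convergences become convergences of mean squares.\<close>
lemma has_stochastic_integral_iff:
  assumes F: "continuous_on {0..t} F" and t: "t \<ge> 0"
  shows "has_stochastic_integral P w t F J \<longleftrightarrow> J \<in> borel_measurable P \<and>
    (\<exists>ps. (\<forall>m. partition_pieces t (ps m)) \<and>
      (\<lambda>m. mean_square (time_interval t) (\<lambda>s. elementary_integrand (ps m) s - F s)) \<longlonglongrightarrow> 0 \<and>
      (\<lambda>m. mean_square P (\<lambda>\<omega>. elementary_integral (ps m) w \<omega> - J \<omega>)) \<longlonglongrightarrow> 0)"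
proof -
  let ?e = "\<lambda>ps s. (norm (elementary_integrand ps s - F s))\<^sup>2"
  have int: "integrable (time_interval t) (?e ps)" for ps
    using mean_square_elementary_integrand_diff_finite[OF F t, of ps]
      measurable_norm_elementary_integrand_diff[OF F, of ps]
    by (simp add: integrable_iff_bounded E_nonneg_def)
  have sint: "set_integrable lborel {0..t} (?e ps)" for ps
    using int[of ps] by (simp add: integrable_restrict_space set_integrable_def)
  have LB: "ennreal (LBINT s:{0..t}. ?e ps s) = mean_square (time_interval t) (\<lambda>s. elementary_integrand ps s - F s)" for ps
  proof -
    have "(LBINT s:{0..t}. ?e ps s) = (LINT s|time_interval t. ?e ps s)"
      by (simp add: integral_restrict_space set_lebesgue_integral_def)
    also have "ennreal \<dots> = mean_square (time_interval t) (\<lambda>s. elementary_integrand ps s - F s)"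
      unfolding E_nonneg_def by (rule nn_integral_eq_integral[symmetric]) (use int in auto)
    finally show ?thesis .
  qed
  have LB_lim: "(\<lambda>m. LBINT s:{0..t}. ?e (ps m) s) \<longlonglongrightarrow> 0 \<longleftrightarrow>
      (\<lambda>m. mean_square (time_interval t) (\<lambda>s. elementary_integrand (ps m) s - F s)) \<longlonglongrightarrow> 0" for ps
  proof -
    have "0 \<le> (LBINT s:{0..t}. ?e (ps m) s)" for m
      unfolding set_lebesgue_integral_def by (intro integral_nonneg_AE) auto
    then have "(\<lambda>m. LBINT s:{0..t}. ?e (ps m) s) \<longlonglongrightarrow> 0 \<longleftrightarrow>
        (\<lambda>m. ennreal (LBINT s:{0..t}. ?e (ps m) s)) \<longlonglongrightarrow> ennreal 0"
      by (subst tendsto_ennreal_iff) auto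
    then show ?thesis by (simp only: LB ennreal_0)
  qed
  show ?thesis
  proof
    assume "has_stochastic_integral P w t F J"
    then obtain n \<tau> B where
      part: "\<forall>m. \<tau> m 0 = 0 \<and> \<tau> m (n m) = t \<and> (\<forall>i<n m. \<tau> m i \<le> \<tau> m (Suc i))"
      and l1: "(\<lambda>m. LBINT s:{0..t}. (norm (step_integrand (n m) (\<tau> m) (B m) s - F s))\<^sup>2) \<longlonglongrightarrow> 0"
      and l2: "mean_square_limit P (\<lambda>m. step_stochastic_integral (n m) (\<tau> m) (B m) w) J"
      unfolding has_stochastic_integral_def by blast
    define ps where "ps m = step_pieces (n m) (\<tau> m) (B m)" for m
    have "\<forall>m. partition_pieces t (ps m)"
      using part unfolding partition_pieces_def ps_def by blast
    moreover have "(\<lambda>m. LBINT s:{0..t}. ?e (ps m) s) \<longlonglongrightarrow> 0"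
      using l1 by (simp add: step_integrand_eq ps_def)
    ultimately show "J \<in> borel_measurable P \<and>
    (\<exists>ps. (\<forall>m. partition_pieces t (ps m)) \<and>
      (\<lambda>m. mean_square (time_interval t) (\<lambda>s. elementary_integrand (ps m) s - F s)) \<longlonglongrightarrow> 0 \<and>
      (\<lambda>m. mean_square P (\<lambda>\<omega>. elementary_integral (ps m) w \<omega> - J \<omega>)) \<longlonglongrightarrow> 0)"
      using l2 unfolding LB_lim mean_square_limit_def step_stochastic_integral_eq ps_def[symmetric] by blast
  next
    assume "J \<in> borel_measurable P \<and>
    (\<exists>ps. (\<forall>m. partition_pieces t (ps m)) \<and>
      (\<lambda>m. mean_square (time_interval t) (\<lambda>s. elementary_integrand (ps m) s - F s)) \<longlonglongrightarrow> 0 \<and>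
      (\<lambda>m. mean_square P (\<lambda>\<omega>. elementary_integral (ps m) w \<omega> - J \<omega>)) \<longlonglongrightarrow> 0)"
    then obtain ps where J: "J \<in> borel_measurable P" and part: "\<forall>m. partition_pieces t (ps m)"
      and l1: "(\<lambda>m. LBINT s:{0..t}. ?e (ps m) s) \<longlonglongrightarrow> 0"
      and l2: "(\<lambda>m. mean_square P (\<lambda>\<omega>. elementary_integral (ps m) w \<omega> - J \<omega>)) \<longlonglongrightarrow> 0"
      unfolding LB_lim by blast
    obtain n \<tau> B where \<tau>: "\<forall>m. \<tau> m 0 = 0 \<and> \<tau> m (n m) = t \<and> (\<forall>i<n m. \<tau> m i \<le> \<tau> m (Suc i))"
      and ps: "\<And>m. ps m = step_pieces (n m) (\<tau> m) (B m)"
      using part unfolding partition_pieces_def by metis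
    show "has_stochastic_integral P w t F J"
      unfolding has_stochastic_integral_def mean_square_limit_def
      by (rule exI[of _ n], rule exI[of _ \<tau>], rule exI[of _ B])
         (use \<tau> J l1 l2 sint in \<open>simp add: step_integrand_eq step_stochastic_integral_eq flip: ps\<close>)
  qed
qed

text \<open>With step functions \<open>S\<close> and \<open>S'\<close> close to \<open>F\<close> and \<open>G\<close>, the difference of the integrals is close to
  \<open>\<integral> S d(u - v) + \<integral> (S - S') dv\<close>, to which the two Ito inequalities apply. The case \<open>u = v\<close>, \<open>F = G\<close> shows
  that the integral does not depend on the approximating step functions.\<close>
lemma stochastic_integral_difference_bound:
  assumes J: "has_stochastic_integral P u t F J" and K: "has_stochastic_integral P v t G K"
    and t: "t \<in> {0..T}" and F: "continuous_on {0..t} F" and G: "continuous_on {0..t} G"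
    and u: "\<And>s. s \<in> {0..T} \<Longrightarrow> u s \<in> borel_measurable P"
    and v: "ito_bounded P T \<kappa> v" and uv: "ito_bounded P T \<delta> (\<lambda>s \<omega>. u s \<omega> - v s \<omega>)"
    and L: "\<And>s. s \<in> {0..t} \<Longrightarrow> norm (F s) \<le> L" and \<eta>: "\<And>s. s \<in> {0..t} \<Longrightarrow> norm (F s - G s) \<le> \<eta>"
  shows "mean_square P (\<lambda>\<omega>. J \<omega> - K \<omega>) \<le> ennreal (8 * (\<delta> * (L\<^sup>2 * t) + \<kappa> * (\<eta>\<^sup>2 * t)))"
proof -
  have t0: "t \<ge> 0" using t by simp
  have pos: "\<delta> \<ge> 0" "\<kappa> \<ge> 0" using v uv by (auto simp: ito_bounded_def)
  have L0: "L \<ge> 0" "\<eta> \<ge> 0" using L[of 0] \<eta>[of 0] t0 by (auto intro: order_trans[OF norm_ge_zero])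
  have u': "u s \<in> borel_measurable P" and v': "v s \<in> borel_measurable P" if "s \<in> {0..t}" for s
    using u v that t by (auto simp: ito_bounded_def)
  obtain ps where [measurable]: "J \<in> borel_measurable P" and ps: "\<And>m. partition_pieces t (ps m)"
    and ps_lim: "(\<lambda>m. mean_square (time_interval t) (\<lambda>s. elementary_integrand (ps m) s - F s)) \<longlonglongrightarrow> 0"
      (is "?e \<longlonglongrightarrow> 0")
    and J_lim: "(\<lambda>m. mean_square P (\<lambda>\<omega>. elementary_integral (ps m) u \<omega> - J \<omega>)) \<longlonglongrightarrow> 0" (is "?x \<longlonglongrightarrow> 0")
    using J unfolding has_stochastic_integral_iff[OF F t0] by blast
  obtain qs where [measurable]: "K \<in> borel_measurable P" and qs: "\<And>m. partition_pieces t (qs m)"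
    and qs_lim: "(\<lambda>m. mean_square (time_interval t) (\<lambda>s. elementary_integrand (qs m) s - G s)) \<longlonglongrightarrow> 0"
      (is "?f \<longlonglongrightarrow> 0")
    and K_lim: "(\<lambda>m. mean_square P (\<lambda>\<omega>. elementary_integral (qs m) v \<omega> - K \<omega>)) \<longlonglongrightarrow> 0" (is "?y \<longlonglongrightarrow> 0")
    using K unfolding has_stochastic_integral_iff[OF G t0] by blast
  note [measurable] = measurable_elementary_integral[OF partition_pieces_within[OF ps] u']
    measurable_elementary_integral[OF partition_pieces_within[OF ps] v']
    measurable_elementary_integral[OF partition_pieces_within[OF qs] v']
  let ?ti = "time_interval t"
  have msL: "mean_square ?ti F \<le> ennreal (L\<^sup>2 * t)"
    by (rule mean_square_time_interval_le[OF t0 L L0(1)])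
  have ms\<eta>: "mean_square ?ti (\<lambda>s. F s - G s) \<le> ennreal (\<eta>\<^sup>2 * t)"
    by (rule mean_square_time_interval_le[OF t0 \<eta> L0(2)])
  have noise: "mean_square P (\<lambda>\<omega>. elementary_integral (ps m) u \<omega> - elementary_integral (ps m) v \<omega>) \<le>
      ennreal \<delta> * (2 * ?e m + 2 * ennreal (L\<^sup>2 * t))" for m
  proof -
    have "mean_square P (elementary_integral (ps m) (\<lambda>s \<omega>. u s \<omega> - v s \<omega>)) \<le>
        ennreal \<delta> * mean_square ?ti (elementary_integrand (ps m))"
      using uv t partition_pieces_within[OF ps] by (simp add: ito_bounded_def)
    also have "mean_square ?ti (elementary_integrand (ps m)) \<le> 2 * ?e m + 2 * mean_square ?ti F"
      by (rule mean_square_triangle)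
         (use norm_triangle_ineq[of "elementary_integrand (ps m) s - F s" "F s" for s]
            measurable_norm_elementary_integrand_diff[OF F] measurable_norm_continuous[OF F] in auto)
    also have "\<dots> \<le> 2 * ?e m + 2 * ennreal (L\<^sup>2 * t)"
      by (intro add_left_mono mult_left_mono msL) auto
    finally show ?thesis by (simp add: elementary_integral_diff mult_left_mono)
  qed
  have integrand: "mean_square P (\<lambda>\<omega>. elementary_integral (ps m) v \<omega> - elementary_integral (qs m) v \<omega>) \<le>
      ennreal \<kappa> * (2 * (2 * ?e m + 2 * ?f m) + 2 * ennreal (\<eta>\<^sup>2 * t))" for m
  proof -
    let ?rs = "ps m @ negate_pieces (qs m)"
    have rs: "elementary_integrand ?rs s = elementary_integrand (ps m) s - elementary_integrand (qs m) s"
      "elementary_integral ?rs v \<omega> = elementary_integral (ps m) v \<omega> - elementary_integral (qs m) v \<omega>" for s \<omega>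
      by (simp_all add: elementary_integrand_simps elementary_integrand_negate
          elementary_integral_simps elementary_integral_negate)
    have "pieces_within t ?rs"
      using partition_pieces_within[OF ps] partition_pieces_within[OF qs]
      by (simp add: pieces_within_append pieces_within_negate)
    then have "mean_square P (elementary_integral ?rs v) \<le> ennreal \<kappa> * mean_square ?ti (elementary_integrand ?rs)"
      using v t by (simp add: ito_bounded_def)
    also have "mean_square ?ti (elementary_integrand ?rs) \<le>
        2 * mean_square ?ti (\<lambda>s. norm (elementary_integrand (ps m) s - F s) + norm (elementary_integrand (qs m) s - G s))
        + 2 * mean_square ?ti (\<lambda>s. F s - G s)"
    proof (rule mean_square_triangle)
      have "norm (p - q) \<le> norm (norm (p - f) + norm (q - g)) + norm (f - g)" for p q f g :: "L2 \<Rightarrow>\<^sub>L L2"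
        using norm_triangle_ineq4[of "p - f" "q - g"] norm_triangle_ineq[of "(p - f) - (q - g)" "f - g"]
        by (simp add: algebra_simps)
      then show "AE s in ?ti. norm (elementary_integrand ?rs s) \<le>
          norm (norm (elementary_integrand (ps m) s - F s) + norm (elementary_integrand (qs m) s - G s)) +
          norm (F s - G s)"
        unfolding rs by simp
    qed (use measurable_norm_elementary_integrand_diff[OF F] measurable_norm_elementary_integrand_diff[OF G]
        measurable_norm_continuous[OF continuous_on_diff[OF F G]] in auto)
    also have "mean_square ?ti (\<lambda>s. norm (elementary_integrand (ps m) s - F s) + norm (elementary_integrand (qs m) s - G s)) \<le>
        2 * ?e m + 2 * ?f m"
      by (rule mean_square_triangle)
         (use measurable_norm_elementary_integrand_diff[OF F] measurable_norm_elementary_integrand_diff[OF G] in auto)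
    also note ms\<eta>
    finally show ?thesis unfolding rs by (simp add: mult_left_mono add_mono)
  qed
  have bound: "mean_square P (\<lambda>\<omega>. J \<omega> - K \<omega>) \<le>
      ennreal (8 * (\<delta> * (L\<^sup>2 * t) + \<kappa> * (\<eta>\<^sup>2 * t))) +
      ((4 * ?x m + 4 * ?y m) + ((8 * ennreal \<delta> + 16 * ennreal \<kappa>) * ?e m + 16 * ennreal \<kappa> * ?f m))" for m
  proof -
    let ?I = "elementary_integral (ps m) u" and ?I' = "elementary_integral (ps m) v" and ?I'' = "elementary_integral (qs m) v"
    have "mean_square P (\<lambda>\<omega>. J \<omega> - K \<omega>) \<le>
        2 * mean_square P (\<lambda>\<omega>. norm (?I \<omega> - J \<omega>) + norm (?I'' \<omega> - K \<omega>)) +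
        2 * mean_square P (\<lambda>\<omega>. ?I \<omega> - ?I'' \<omega>)"
    proof (rule mean_square_triangle)
      have "norm (j - k) \<le> norm (norm (i - j) + norm (i' - k)) + norm (i - i')" for i i' j k :: L2
        using norm_triangle_ineq4[of "i' - k" "i - j"] norm_triangle_ineq[of "(i' - k) - (i - j)" "i - i'"]
        by (simp add: algebra_simps)
      then show "AE \<omega> in P. norm (J \<omega> - K \<omega>) \<le> norm (norm (?I \<omega> - J \<omega>) + norm (?I'' \<omega> - K \<omega>)) +
          norm (?I \<omega> - ?I'' \<omega>)" by simp
    qed measurable
    also have "mean_square P (\<lambda>\<omega>. norm (?I \<omega> - J \<omega>) + norm (?I'' \<omega> - K \<omega>)) \<le> 2 * ?x m + 2 * ?y m"
      by (rule mean_square_triangle) auto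
    also have "mean_square P (\<lambda>\<omega>. ?I \<omega> - ?I'' \<omega>) \<le>
        2 * mean_square P (\<lambda>\<omega>. ?I \<omega> - ?I' \<omega>) + 2 * mean_square P (\<lambda>\<omega>. ?I' \<omega> - ?I'' \<omega>)"
      by (rule mean_square_diff_triangle) measurable
    also note noise
    also note integrand
    finally have "mean_square P (\<lambda>\<omega>. J \<omega> - K \<omega>) \<le> 2 * (2 * ?x m + 2 * ?y m) +
        2 * (2 * (ennreal \<delta> * (2 * ?e m + 2 * ennreal (L\<^sup>2 * t))) +
          2 * (ennreal \<kappa> * (2 * (2 * ?e m + 2 * ?f m) + 2 * ennreal (\<eta>\<^sup>2 * t))))"
      by (simp add: add_mono mult_left_mono)
    also have "\<dots> = (8 * (ennreal \<delta> * ennreal (L\<^sup>2 * t)) + 8 * (ennreal \<kappa> * ennreal (\<eta>\<^sup>2 * t))) +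
      ((4 * ?x m + 4 * ?y m) + ((8 * ennreal \<delta> + 16 * ennreal \<kappa>) * ?e m + 16 * ennreal \<kappa> * ?f m))"
      by (simp add: distrib_left distrib_right mult_ac add_ac)
    also have "8 * (ennreal \<delta> * ennreal (L\<^sup>2 * t)) + 8 * (ennreal \<kappa> * ennreal (\<eta>\<^sup>2 * t)) =
        ennreal (8 * (\<delta> * (L\<^sup>2 * t) + \<kappa> * (\<eta>\<^sup>2 * t)))"
      using pos t0 by (simp add: ennreal_mult ennreal_plus distrib_left)
    finally show ?thesis .
  qed
  show ?thesis
  proof (rule ennreal_le_limI)
    have "(\<lambda>m. 4 * ?x m + 4 * ?y m) \<longlonglongrightarrow> 0"
      by (intro ennreal_tendsto_0_combine J_lim K_lim) auto
    moreover have "(\<lambda>m. (8 * ennreal \<delta> + 16 * ennreal \<kappa>) * ?e m + 16 * ennreal \<kappa> * ?f m) \<longlonglongrightarrow> 0"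
      by (intro ennreal_tendsto_0_combine ps_lim qs_lim) (auto simp: ennreal_mult_less_top)
    ultimately show "(\<lambda>m. (4 * ?x m + 4 * ?y m) + ((8 * ennreal \<delta> + 16 * ennreal \<kappa>) * ?e m + 16 * ennreal \<kappa> * ?f m)) \<longlonglongrightarrow> 0"
      using tendsto_add by fastforce
  qed (use bound in simp)
qed

text \<open>The diagonal argument: for each \<open>n\<close> a single step function is chosen whose distance to \<open>F n\<close>, and
  the distance of whose integral against \<open>w n\<close> to \<open>J n\<close>, is at most \<open>1 / (n + 1)\<close>. Their integrals
  against \<open>v\<close> converge to \<open>K\<close> because the Ito constants of \<open>v - w n\<close> tend to 0 while the step
  functions stay bounded in mean square.\<close>
lemma stochastic_integral_limit:
  assumes t: "t \<in> {0..T}"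
    and J: "\<And>n. has_stochastic_integral P (w n) t (F n) (J n)"
    and F: "\<And>n. continuous_on {0..t} (F n)" and G: "continuous_on {0..t} G"
    and FG: "\<And>e. e > 0 \<Longrightarrow> \<forall>\<^sub>F n in sequentially. \<forall>s\<in>{0..t}. norm (F n s - G s) \<le> e"
    and w: "\<And>n s. s \<in> {0..T} \<Longrightarrow> w n s \<in> borel_measurable P"
    and v: "\<And>s. s \<in> {0..T} \<Longrightarrow> v s \<in> borel_measurable P"
    and wv: "\<And>e. e > 0 \<Longrightarrow> \<forall>\<^sub>F n in sequentially. ito_bounded P T e (\<lambda>s \<omega>. v s \<omega> - w n s \<omega>)"
    and K[measurable]: "K \<in> borel_measurable P" and JK: "(\<lambda>n. mean_square P (\<lambda>\<omega>. J n \<omega> - K \<omega>)) \<longlonglongrightarrow> 0"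
  shows "has_stochastic_integral P v t G K"
proof -
  have t0: "t \<ge> 0" using t by simp
  let ?ti = "time_interval t"
  have sub: "s \<in> {0..t} \<Longrightarrow> s \<in> {0..T}" for s using t by auto
  have [measurable]: "J n \<in> borel_measurable P" for n
    using J[of n] unfolding has_stochastic_integral_iff[OF F t0] by blast
  have "\<forall>n. \<exists>ps. partition_pieces t ps \<and>
      mean_square ?ti (\<lambda>s. elementary_integrand ps s - F n s) \<le> ennreal (1 / real (Suc n)) \<and>
      mean_square P (\<lambda>\<omega>. elementary_integral ps (w n) \<omega> - J n \<omega>) \<le> ennreal (1 / real (Suc n))"
    (is "\<forall>n. \<exists>ps. ?Q n ps")
  proof
    fix n
    obtain ps where ps: "\<And>m. partition_pieces t (ps m)"
      and 1: "(\<lambda>m. mean_square ?ti (\<lambda>s. elementary_integrand (ps m) s - F n s)) \<longlonglongrightarrow> 0"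
      and 2: "(\<lambda>m. mean_square P (\<lambda>\<omega>. elementary_integral (ps m) (w n) \<omega> - J n \<omega>)) \<longlonglongrightarrow> 0"
      using J[of n] unfolding has_stochastic_integral_iff[OF F t0] by blast
    have "1 / real (Suc n) > 0" by simp
    from eventually_happens'[OF sequentially_bot eventually_conj[OF ennreal_tendsto_0D[OF 1 this] ennreal_tendsto_0D[OF 2 this]]]
    obtain m where m: "mean_square ?ti (\<lambda>s. elementary_integrand (ps m) s - F n s) \<le> ennreal (1 / real (Suc n)) \<and>
        mean_square P (\<lambda>\<omega>. elementary_integral (ps m) (w n) \<omega> - J n \<omega>) \<le> ennreal (1 / real (Suc n))"
      by (rule exE)
    show "\<exists>ps. ?Q n ps" by (rule exI[of _ "ps m"], rule conjI[OF ps m])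
  qed
  from choice[OF this] obtain ps where *: "\<forall>n. ?Q n (ps n)" ..
  have ps: "\<And>n. partition_pieces t (ps n)"
    and ps_F: "\<And>n. mean_square ?ti (\<lambda>s. elementary_integrand (ps n) s - F n s) \<le> ennreal (1 / real (Suc n))"
    and ps_J: "\<And>n. mean_square P (\<lambda>\<omega>. elementary_integral (ps n) (w n) \<omega> - J n \<omega>) \<le> ennreal (1 / real (Suc n))"
    by (rule *[THEN spec, THEN conjunct1], rule *[THEN spec, THEN conjunct2, THEN conjunct1],
        rule *[THEN spec, THEN conjunct2, THEN conjunct2])
  note [measurable] = measurable_elementary_integral[OF partition_pieces_within[OF ps] w[OF sub]]
    measurable_elementary_integral[OF partition_pieces_within[OF ps] v[OF sub]]
  have inv0: "(\<lambda>n. ennreal (1 / real (Suc n))) \<longlonglongrightarrow> 0"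
    using tendsto_ennrealI[OF LIMSEQ_inverse_real_of_nat] by (simp add: inverse_eq_divide)
  have FG0: "(\<lambda>n. mean_square ?ti (\<lambda>s. F n s - G s)) \<longlonglongrightarrow> 0"
  proof (rule ennreal_tendsto_0I)
    fix e :: real assume e: "e > 0"
    define d where "d = sqrt (e / (t + 1))"
    have d: "d > 0" "d\<^sup>2 * t \<le> e"
      using e t0 by (auto simp: d_def field_simps)
    show "\<forall>\<^sub>F n in sequentially. mean_square ?ti (\<lambda>s. F n s - G s) \<le> ennreal e"
      using FG[OF d(1)]
    proof eventually_elim
      case (elim n)
      then have "mean_square ?ti (\<lambda>s. F n s - G s) \<le> ennreal (d\<^sup>2 * t)"
        using d by (intro mean_square_time_interval_le t0) auto
      also have "\<dots> \<le> ennreal e" using d(2) by (rule ennreal_leI)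
      finally show ?case .
    qed
  qed
  have ps_F0: "(\<lambda>n. mean_square ?ti (\<lambda>s. elementary_integrand (ps n) s - F n s)) \<longlonglongrightarrow> 0"
    by (rule ennreal_tendsto_0_squeeze[OF ps_F inv0])
  have ps_J0: "(\<lambda>n. mean_square P (\<lambda>\<omega>. elementary_integral (ps n) (w n) \<omega> - J n \<omega>)) \<longlonglongrightarrow> 0"
    by (rule ennreal_tendsto_0_squeeze[OF ps_J inv0])
  have 1: "(\<lambda>n. mean_square ?ti (\<lambda>s. elementary_integrand (ps n) s - G s)) \<longlonglongrightarrow> 0"
    by (rule ennreal_tendsto_0_squeeze[OF mean_square_diff_triangle ennreal_tendsto_0_combine[OF ps_F0 FG0]])
       (use measurable_norm_elementary_integrand_diff[OF F] measurable_norm_continuous[OF continuous_on_diff[OF F G]] in auto)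
  have G_fin: "mean_square ?ti G < \<infinity>"
    using mean_square_elementary_integrand_diff_finite[OF G t0, of "[]"] by (simp add: elementary_integrand_simps)
  then obtain g where g: "g \<ge> 0" "mean_square ?ti G = ennreal g"
    by (auto simp: less_top_ennreal)
  have 2: "(\<lambda>n. mean_square P (\<lambda>\<omega>. elementary_integral (ps n) v \<omega> - elementary_integral (ps n) (w n) \<omega>)) \<longlonglongrightarrow> 0"
  proof (rule ennreal_tendsto_0I)
    fix e :: real assume e: "e > 0"
    define d where "d = e / (2 + 2 * g)"
    have d: "d > 0" "d * (2 + 2 * g) = e" using e g(1) by (auto simp: d_def)
    show "\<forall>\<^sub>F n in sequentially. mean_square P (\<lambda>\<omega>. elementary_integral (ps n) v \<omega> - elementary_integral (ps n) (w n) \<omega>) \<le> ennreal e"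
      using wv[OF d(1)] ennreal_tendsto_0D[OF 1 zero_less_one]
    proof eventually_elim
      case (elim n)
      have "mean_square P (elementary_integral (ps n) (\<lambda>s \<omega>. v s \<omega> - w n s \<omega>)) \<le>
          ennreal d * mean_square ?ti (elementary_integrand (ps n))"
        using elim(1) t partition_pieces_within[OF ps] by (simp add: ito_bounded_def)
      also have "mean_square ?ti (elementary_integrand (ps n)) \<le>
          2 * mean_square ?ti (\<lambda>s. elementary_integrand (ps n) s - G s) + 2 * mean_square ?ti G"
        by (rule mean_square_triangle)
           (use norm_triangle_ineq[of "elementary_integrand (ps n) s - G s" "G s" for s]
              measurable_norm_elementary_integrand_diff[OF G] measurable_norm_continuous[OF G] in auto)
      also have "\<dots> \<le> 2 * ennreal 1 + 2 * ennreal g"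
        using elim(2) g(2) by (intro add_mono mult_left_mono) auto
      also have "ennreal d * (2 * ennreal 1 + 2 * ennreal g) = ennreal (d * (2 + 2 * g))"
        using d(1) g(1) by (simp add: ennreal_mult ennreal_plus)
      also have "\<dots> = ennreal e" by (simp only: d(2))
      finally show ?case by (simp add: elementary_integral_diff mult_left_mono)
    qed
  qed
  have 3: "(\<lambda>n. mean_square P (\<lambda>\<omega>. elementary_integral (ps n) (w n) \<omega> - K \<omega>)) \<longlonglongrightarrow> 0"
    by (rule ennreal_tendsto_0_squeeze[OF mean_square_diff_triangle ennreal_tendsto_0_combine[OF ps_J0 JK]]) auto
  have 4: "(\<lambda>n. mean_square P (\<lambda>\<omega>. elementary_integral (ps n) v \<omega> - K \<omega>)) \<longlonglongrightarrow> 0"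
    by (rule ennreal_tendsto_0_squeeze[OF mean_square_diff_triangle ennreal_tendsto_0_combine[OF 2 3]]) auto
  show ?thesis
    unfolding has_stochastic_integral_iff[OF G t0] using K ps 1 4 by blast
qed

section \<open>Stability and uniqueness of mild solutions\<close>

lemma ito_bounded_zero:
  assumes "\<kappa> \<ge> 0"
  shows "ito_bounded P T \<kappa> (\<lambda>t \<omega>. 0)"
proof -
  have "elementary_integral ps (\<lambda>t \<omega>. 0) \<omega> = 0" for ps and \<omega> :: 'a
    by (induction ps) (auto simp: elementary_integral_simps blinfun.zero_right)
  then show ?thesis using assms by (simp add: ito_bounded_def E_nonneg_def)
qed

text \<open>Exchanging the two sums turns the coefficients of a step noise into vectors \<open>g\<^sub>r\<close>; in this form the noises of
  systems with different partitions can be subtracted.\<close>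
lemma step_noise_series:
  assumes "step_noise P N c W w"
  shows "\<exists>g. \<forall>t\<ge>0. mean_square_limit P (\<lambda>n \<omega>. \<Sum>r=1..n. W r t \<omega> *\<^sub>R g r) (w t)"
proof -
  define g where "g r = (\<Sum>k=1..N. c k r *\<^sub>R cell_fun N k)" for r
  have "(\<lambda>n \<omega>. \<Sum>k=1..N. (\<Sum>r=1..n. c k r * W r t \<omega>) *\<^sub>R cell_fun N k) =
      (\<lambda>n \<omega>. \<Sum>r=1..n. W r t \<omega> *\<^sub>R g r)" for t
  proof (intro ext)
    fix n \<omega>
    have "(\<Sum>k=1..N. (\<Sum>r=1..n. c k r * W r t \<omega>) *\<^sub>R cell_fun N k) =
        (\<Sum>k=1..N. \<Sum>r=1..n. W r t \<omega> *\<^sub>R (c k r *\<^sub>R cell_fun N k))"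
      by (simp add: scaleR_sum_left mult.commute)
    also have "\<dots> = (\<Sum>r=1..n. W r t \<omega> *\<^sub>R g r)"
      unfolding g_def scaleR_sum_right by (rule sum.swap)
    finally show "(\<Sum>k=1..N. (\<Sum>r=1..n. c k r * W r t \<omega>) *\<^sub>R cell_fun N k) = (\<Sum>r=1..n. W r t \<omega> *\<^sub>R g r)" .
  qed
  then show ?thesis using assms unfolding step_noise_def by (intro exI[of _ g]) (simp only:)
qed

lemma noise_series_diff:
  fixes u v :: "'a \<Rightarrow> L2"
  assumes W: "independent_brownian_motions P W {1..}" and t: "t \<ge> 0"
    and u: "mean_square_limit P (\<lambda>n \<omega>. \<Sum>r=1..n. W r t \<omega> *\<^sub>R g r) u"
    and v: "mean_square_limit P (\<lambda>n \<omega>. \<Sum>r=1..n. W r t \<omega> *\<^sub>R h r) v"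
  shows "mean_square_limit P (\<lambda>n \<omega>. \<Sum>r=1..n. W r t \<omega> *\<^sub>R (g r - h r)) (\<lambda>\<omega>. u \<omega> - v \<omega>)"
proof -
  have [measurable]: "u \<in> borel_measurable P" "v \<in> borel_measurable P"
    using u v by (auto simp: mean_square_limit_def)
  have [measurable]: "W r t \<in> borel_measurable P" if "r \<in> {1..}" for r
    using W that t by (auto simp: independent_brownian_motions_def brownian_motion_def)
  define U where "U k n \<omega> = (\<Sum>r=1..n. W r t \<omega> *\<^sub>R k r)" for k :: "nat \<Rightarrow> L2" and n \<omega>
  have [measurable]: "U k n \<in> borel_measurable P" for k n
    unfolding U_def[abs_def] by (intro borel_measurable_sum borel_measurable_scaleR) auto
  have U_diff: "U (\<lambda>r. g r - h r) n \<omega> = U g n \<omega> - U h n \<omega>" for n \<omega>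
    by (simp add: U_def scaleR_diff_right sum_subtractf)
  have lim: "(\<lambda>n. 2 * mean_square P (\<lambda>\<omega>. U g n \<omega> - u \<omega>) + 2 * mean_square P (\<lambda>\<omega>. U h n \<omega> - v \<omega>)) \<longlonglongrightarrow> 0"
    using u v by (intro ennreal_tendsto_0_combine) (auto simp: mean_square_limit_def U_def)
  have "(\<lambda>n. mean_square P (\<lambda>\<omega>. U (\<lambda>r. g r - h r) n \<omega> - (u \<omega> - v \<omega>))) \<longlonglongrightarrow> 0"
  proof (rule ennreal_tendsto_0_squeeze[OF mean_square_triangle lim])
    have "norm ((p - q) - (c - d)) \<le> norm (p - c) + norm (q - d)" for p q c d :: L2
      using norm_triangle_ineq4[of "p - c" "q - d"] by (simp add: algebra_simps)
    then show "AE \<omega> in P. norm (U (\<lambda>r. g r - h r) n \<omega> - (u \<omega> - v \<omega>)) \<le> norm (U g n \<omega> - u \<omega>) + norm (U h n \<omega> - v \<omega>)" for n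
      unfolding U_diff by simp
  qed measurable
  then show ?thesis by (simp add: mean_square_limit_def U_def)
qed

lemma noise_series_finite_variance:
  fixes u :: "'a \<Rightarrow> L2"
  assumes P: "prob_space P" and W: "independent_brownian_motions P W {1..}" and t: "t \<ge> 0"
    and u: "mean_square_limit P (\<lambda>n \<omega>. \<Sum>r=1..n. W r t \<omega> *\<^sub>R g r) u"
  shows "mean_square P u < \<infinity>"
proof -
  have [measurable]: "u \<in> borel_measurable P"
    using u by (auto simp: mean_square_limit_def)
  have [measurable]: "W r t \<in> borel_measurable P" if "r \<in> {1..}" for r
    using W that t by (auto simp: independent_brownian_motions_def brownian_motion_def)
  define U where "U n \<omega> = (\<Sum>r=1..n. W r t \<omega> *\<^sub>R g r)" for n \<omega>
  have [measurable]: "U n \<in> borel_measurable P" for n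
    unfolding U_def[abs_def] by (intro borel_measurable_sum borel_measurable_scaleR) auto
  have "(\<lambda>n. mean_square P (\<lambda>\<omega>. U n \<omega> - u \<omega>)) \<longlonglongrightarrow> 0"
    using u by (simp add: mean_square_limit_def U_def)
  from eventually_happens'[OF sequentially_bot ennreal_tendsto_0D[OF this zero_less_one]]
  obtain n where n: "mean_square P (\<lambda>\<omega>. U n \<omega> - u \<omega>) \<le> ennreal 1" by blast
  have "mean_square P u \<le> 2 * mean_square P (U n) + 2 * mean_square P (\<lambda>\<omega>. U n \<omega> - u \<omega>)"
    by (rule mean_square_triangle)
       (use norm_triangle_ineq4[of "U n \<omega>" "U n \<omega> - u \<omega>" for \<omega>] in auto)
  also have "\<dots> \<le> 2 * mean_square P (U n) + 2 * ennreal 1"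
    using n by (intro add_left_mono mult_left_mono) auto
  also have "\<dots> < \<infinity>"
    unfolding U_def finite_noise_variance[OF P W t] by (simp add: ennreal_mult_less_top)
  finally show ?thesis .
qed

lemma mild_solutionD:
  assumes "mild_solution P T A \<Phi> w x0 x" "t \<in> {0..T}"
  shows "\<exists>J. has_stochastic_integral P w t (\<Phi> t) J \<and> (AE \<omega> in P. x t \<omega> = \<Phi> t 0 x0 + J \<omega>)"
  using assms by (simp add: mild_solution_def)

text \<open>The bound separates the three sources of error: the homogeneous parts (\<open>\<rho>\<close>), the noises (\<open>\<delta>\<close>) and the
  integrands (\<open>\<eta>\<close>).\<close>
lemma mild_solution_difference_bound:
  assumes P: "prob_space P"
    and x: "mild_solution P T A \<Phi> u x0 x" and y: "mild_solution P T B \<Psi> v y0 y"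
    and A: "bounded (A ` {0..T})" and B: "bounded (B ` {0..T})"
    and t: "t \<in> {0..T}"
    and u: "\<And>s. s \<in> {0..T} \<Longrightarrow> u s \<in> borel_measurable P"
    and v: "ito_bounded P T \<kappa> v" and uv: "ito_bounded P T \<delta> (\<lambda>s \<omega>. u s \<omega> - v s \<omega>)"
    and \<rho>: "norm (\<Phi> t 0 x0 - \<Psi> t 0 y0) \<le> \<rho>"
    and L: "\<And>s. s \<in> {0..t} \<Longrightarrow> norm (\<Phi> t s) \<le> L"
    and \<eta>: "\<And>s. s \<in> {0..t} \<Longrightarrow> norm (\<Phi> t s - \<Psi> t s) \<le> \<eta>"
  shows "mean_square P (\<lambda>\<omega>. x t \<omega> - y t \<omega>) \<le>
    ennreal (2 * \<rho>\<^sup>2 + 16 * (\<delta> * (L\<^sup>2 * t) + \<kappa> * (\<eta>\<^sup>2 * t)))"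
proof -
  have cont: "continuous_on {0..t} (\<Phi> t)" "continuous_on {0..t} (\<Psi> t)"
    using x y A B t by (auto simp: mild_solution_def intro: solution_operator_continuous)
  have t0: "t \<ge> 0" using t by simp
  have pos: "\<delta> \<ge> 0" "\<kappa> \<ge> 0" using v uv by (auto simp: ito_bounded_def)
  obtain J where J: "has_stochastic_integral P u t (\<Phi> t) J" and xJ: "AE \<omega> in P. x t \<omega> = \<Phi> t 0 x0 + J \<omega>"
    using mild_solutionD[OF x t] by (elim exE conjE) (rule that)
  obtain K where K: "has_stochastic_integral P v t (\<Psi> t) K" and yK: "AE \<omega> in P. y t \<omega> = \<Psi> t 0 y0 + K \<omega>"
    using mild_solutionD[OF y t] by (elim exE conjE) (rule that)
  have [measurable]: "J \<in> borel_measurable P" "K \<in> borel_measurable P"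
    using J K unfolding has_stochastic_integral_iff[OF cont(1) t0] has_stochastic_integral_iff[OF cont(2) t0]
    by blast+
  have "mean_square P (\<lambda>\<omega>. x t \<omega> - y t \<omega>) \<le>
      2 * mean_square P (\<lambda>\<omega>. \<Phi> t 0 x0 - \<Psi> t 0 y0) + 2 * mean_square P (\<lambda>\<omega>. J \<omega> - K \<omega>)"
  proof (rule mean_square_triangle)
    show "AE \<omega> in P. norm (x t \<omega> - y t \<omega>) \<le> norm (\<Phi> t 0 x0 - \<Psi> t 0 y0) + norm (J \<omega> - K \<omega>)"
      using xJ yK
    proof eventually_elim
      case (elim \<omega>)
      then have "x t \<omega> - y t \<omega> = (\<Phi> t 0 x0 - \<Psi> t 0 y0) + (J \<omega> - K \<omega>)" by simp
      then show ?case by (metis norm_triangle_ineq)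
    qed
  qed measurable
  also have "\<dots> \<le> 2 * ennreal (\<rho>\<^sup>2) + 2 * ennreal (8 * (\<delta> * (L\<^sup>2 * t) + \<kappa> * (\<eta>\<^sup>2 * t)))"
  proof (intro add_mono mult_left_mono)
    show "mean_square P (\<lambda>\<omega>. \<Phi> t 0 x0 - \<Psi> t 0 y0) \<le> ennreal (\<rho>\<^sup>2)"
      unfolding mean_square_const[OF P] using \<rho> by (intro ennreal_leI power_mono) auto
    show "mean_square P (\<lambda>\<omega>. J \<omega> - K \<omega>) \<le> ennreal (8 * (\<delta> * (L\<^sup>2 * t) + \<kappa> * (\<eta>\<^sup>2 * t)))"
      by (rule stochastic_integral_difference_bound[OF J K t cont u v uv L \<eta>])
  qed auto
  also have "\<dots> = ennreal (2 * \<rho>\<^sup>2 + 16 * (\<delta> * (L\<^sup>2 * t) + \<kappa> * (\<eta>\<^sup>2 * t)))"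
  proof -
    define z where "z = \<delta> * (L\<^sup>2 * t) + \<kappa> * (\<eta>\<^sup>2 * t)"
    have "z \<ge> 0" using pos t0 by (simp add: z_def)
    have "2 * ennreal (\<rho>\<^sup>2) + 2 * ennreal (8 * z) = ennreal (2 * \<rho>\<^sup>2) + ennreal (2 * (8 * z))"
      using \<open>z \<ge> 0\<close> by (simp only: ennreal_mult ennreal_numeral zero_le_numeral zero_le_power2 mult_nonneg_nonneg)
    also have "\<dots> = ennreal (2 * \<rho>\<^sup>2 + 16 * z)"
      using \<open>z \<ge> 0\<close> by (subst ennreal_plus[symmetric]) auto
    finally show ?thesis by (simp only: z_def)
  qed
  finally show ?thesis .
qed

lemma mild_solution_unique:
  assumes P: "prob_space P"
    and x: "mild_solution P T A \<Phi> v x0 x" and y: "mild_solution P T A \<Phi> v x0 y"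
    and A: "bounded (A ` {0..T})" and v: "ito_bounded P T \<kappa> v" and t: "t \<in> {0..T}"
  shows "AE \<omega> in P. y t \<omega> = x t \<omega>"
proof -
  have [measurable]: "x t \<in> borel_measurable P" "y t \<in> borel_measurable P"
    using x y t by (auto simp: mild_solution_def)
  have "solution_operator T A \<Phi>" using x by (simp add: mild_solution_def)
  from solution_operator_bounded[OF this A]
  obtain L where "\<forall>s t. 0 \<le> s \<and> s \<le> t \<and> t \<le> T \<longrightarrow> norm (\<Phi> t s) \<le> L" ..
  then have L: "norm (\<Phi> t s) \<le> L" if "s \<in> {0..t}" for s using that t by simp
  have "mean_square P (\<lambda>\<omega>. y t \<omega> - x t \<omega>) \<le> ennreal (2 * 0\<^sup>2 + 16 * (0 * (L\<^sup>2 * t) + \<kappa> * (0\<^sup>2 * t)))"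
  proof (rule mild_solution_difference_bound[OF P y x A A t _ v])
    show "ito_bounded P T 0 (\<lambda>s \<omega>. v s \<omega> - v s \<omega>)" using ito_bounded_zero[of 0 P T] by simp
    show "v s \<in> borel_measurable P" if "s \<in> {0..T}" for s using v that by (simp add: ito_bounded_def)
  qed (use L in auto)
  then have "mean_square P (\<lambda>\<omega>. y t \<omega> - x t \<omega>) = 0" by simp
  then show ?thesis by (subst (asm) mean_square_eq_0_iff) auto
qed

lemma ito_bounded_from_difference:
  assumes uv: "ito_bounded P T \<delta> (\<lambda>s \<omega>. u s \<omega> - v s \<omega>)" and v: "ito_bounded P T \<kappa> v"
    and u: "\<And>s. s \<in> {0..T} \<Longrightarrow> u s \<in> borel_measurable P"
  shows "ito_bounded P T (2 * \<delta> + 2 * \<kappa>) u"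
  unfolding ito_bounded_def
proof (intro conjI ballI allI impI u)
  have pos: "\<delta> \<ge> 0" "\<kappa> \<ge> 0" using uv v by (simp_all add: ito_bounded_def)
  then show "0 \<le> 2 * \<delta> + 2 * \<kappa>" by simp
  fix t ps assume t: "t \<in> {0..T}" and ps: "pieces_within t ps"
  have v': "v s \<in> borel_measurable P" if "s \<in> {0..T}" for s using v that by (simp add: ito_bounded_def)
  have sub: "s \<in> {0..t} \<Longrightarrow> s \<in> {0..T}" for s using t by auto
  have [measurable]: "elementary_integral ps u \<in> borel_measurable P" "elementary_integral ps v \<in> borel_measurable P"
    by (intro measurable_elementary_integral[OF ps] u v' sub; assumption)+
  let ?S = "mean_square (time_interval t) (elementary_integrand ps)"
  have "mean_square P (elementary_integral ps u) \<le>
      2 * mean_square P (elementary_integral ps (\<lambda>s \<omega>. u s \<omega> - v s \<omega>)) + 2 * mean_square P (elementary_integral ps v)"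
    by (rule mean_square_triangle)
       (use norm_triangle_ineq[of "elementary_integral ps u \<omega> - elementary_integral ps v \<omega>" "elementary_integral ps v \<omega>" for \<omega>]
         in \<open>auto simp: elementary_integral_diff\<close>)
  also have "\<dots> \<le> 2 * (ennreal \<delta> * ?S) + 2 * (ennreal \<kappa> * ?S)"
    using uv v t ps by (intro add_mono mult_left_mono) (auto simp: ito_bounded_def)
  also have "\<dots> = ennreal (2 * \<delta> + 2 * \<kappa>) * ?S"
    using pos by (simp add: ennreal_mult distrib_right mult.assoc)
  finally show "mean_square P (elementary_integral ps u) \<le> ennreal (2 * \<delta> + 2 * \<kappa>) * ?S" .
qed

lemma ito_bounded_minus_commute:
  assumes "ito_bounded P T \<kappa> (\<lambda>s \<omega>. u s \<omega> - v s \<omega>)"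
  shows "ito_bounded P T \<kappa> (\<lambda>s \<omega>. v s \<omega> - u s \<omega>)"
proof -
  have "(\<lambda>\<omega>. v s \<omega> - u s \<omega>) \<in> borel_measurable P" if "(\<lambda>\<omega>. u s \<omega> - v s \<omega>) \<in> borel_measurable P" for s
    using borel_measurable_uminus[OF that] by simp
  then show ?thesis
    using assms unfolding ito_bounded_def
    by (simp add: elementary_integral_diff norm_minus_commute)
qed

section \<open>Convergence of a sequence of systems\<close>

text \<open>Graphon operators enter as bounded generators and step noises through their series representation:
  differences of step noises over different partitions are no longer step noises of this kind, but they are
  series over the same Brownian motions.\<close>
locale convergent_systems =
  fixes P :: "'a measure" and T :: real and W :: "nat \<Rightarrow> real \<Rightarrow> 'a \<Rightarrow> real"
    and A :: "nat \<Rightarrow> real \<Rightarrow> L2 \<Rightarrow>\<^sub>L L2" and \<Phi> :: "nat \<Rightarrow> real \<Rightarrow> real \<Rightarrow> L2 \<Rightarrow>\<^sub>L L2"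
    and w :: "nat \<Rightarrow> real \<Rightarrow> 'a \<Rightarrow> L2" and x0 :: "nat \<Rightarrow> L2" and x :: "nat \<Rightarrow> real \<Rightarrow> 'a \<Rightarrow> L2"
  assumes prob: "prob_space P" and T: "T > 0"
    and W: "independent_brownian_motions P W {1..}"
    and A: "N \<ge> 1 \<Longrightarrow> bounded (A N ` {0..T})"
    and w: "N \<ge> 1 \<Longrightarrow> \<exists>g. \<forall>t\<ge>0. mean_square_limit P (\<lambda>n \<omega>. \<Sum>r=1..n. W r t \<omega> *\<^sub>R g r) (w N t)"
    and x: "N \<ge> 1 \<Longrightarrow> mild_solution P T (A N) (\<Phi> N) (w N) (x0 N) (x N)"
    and cauchy: "e > 0 \<Longrightarrow> \<exists>N0. \<forall>N M. N > M \<and> M > N0 \<longrightarrow>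
        norm (x0 N - x0 M) \<le> e \<and>
        (\<forall>s t. 0 \<le> s \<and> s \<le> t \<and> t \<le> T \<longrightarrow> norm (\<Phi> N t s - \<Phi> M t s) \<le> e) \<and>
        mean_square P (\<lambda>\<omega>. w N T \<omega> - w M T \<omega>) \<le> ennreal e"
begin

lemma \<Phi>: "N \<ge> 1 \<Longrightarrow> solution_operator T (A N) (\<Phi> N)"
  using x by (simp add: mild_solution_def)

lemma x_measurable: "N \<ge> 1 \<Longrightarrow> t \<in> {0..T} \<Longrightarrow> x N t \<in> borel_measurable P"
  using x by (simp add: mild_solution_def)

lemma w_measurable: "N \<ge> 1 \<Longrightarrow> t \<in> {0..T} \<Longrightarrow> w N t \<in> borel_measurable P"
  using w[of N] by (auto simp: mean_square_limit_def)

lemma noise_ito_bounded: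
  assumes "N \<ge> 1"
  shows "\<exists>\<kappa>. ito_bounded P T \<kappa> (w N)"
proof -
  obtain g where g: "\<And>t. t \<ge> 0 \<Longrightarrow> mean_square_limit P (\<lambda>n \<omega>. \<Sum>r=1..n. W r t \<omega> *\<^sub>R g r) (w N t)"
    using w[OF assms] by blast
  have "mean_square P (w N T) < \<infinity>"
    by (rule noise_series_finite_variance[OF prob W _ g]) (use T in auto)
  then obtain b where b: "b \<ge> 0" "mean_square P (w N T) = ennreal b" by (auto simp: less_top_ennreal)
  have "ito_bounded P T (8 * (b + 1) / T) (w N)"
    by (rule ito_bounded_noise[OF prob W T g]) (use b in \<open>auto intro: ennreal_leI\<close>)
  then show ?thesis by blast
qed

lemma noise_difference_ito_bounded:
  assumes NM: "N \<ge> 1" "M \<ge> 1" and e: "e > 0"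
    and small: "mean_square P (\<lambda>\<omega>. w N T \<omega> - w M T \<omega>) \<le> ennreal (e * T / 8)"
  shows "ito_bounded P T e (\<lambda>s \<omega>. w N s \<omega> - w M s \<omega>)"
proof -
  obtain g where g: "\<And>t. t \<ge> 0 \<Longrightarrow> mean_square_limit P (\<lambda>n \<omega>. \<Sum>r=1..n. W r t \<omega> *\<^sub>R g r) (w N t)"
    using w[OF NM(1)] by blast
  obtain h where h: "\<And>t. t \<ge> 0 \<Longrightarrow> mean_square_limit P (\<lambda>n \<omega>. \<Sum>r=1..n. W r t \<omega> *\<^sub>R h r) (w M t)"
    using w[OF NM(2)] by blast
  have "ito_bounded P T (8 * (e * T / 8) / T) (\<lambda>s \<omega>. w N s \<omega> - w M s \<omega>)"
  proof (rule ito_bounded_noise[where v = "\<lambda>s \<omega>. w N s \<omega> - w M s \<omega>", OF prob W T _ small])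
    show "mean_square_limit P (\<lambda>n \<omega>. \<Sum>r=1..n. W r t \<omega> *\<^sub>R (g r - h r)) (\<lambda>\<omega>. w N t \<omega> - w M t \<omega>)"
      if "t \<in> {0..T}" for t
      using that by (intro noise_series_diff[OF W] g h) auto
  qed (use e T in simp)
  then show ?thesis using T by simp
qed

text \<open>The Cauchy conditions in symmetric form, with closeness of the noises expressed by the Ito constant of
  their difference.\<close>
lemma eventually_close:
  assumes e: "e > 0"
  shows "\<exists>N0\<ge>1. \<forall>N>N0. \<forall>M>N0. norm (x0 N - x0 M) \<le> e \<and>
    (\<forall>s t. 0 \<le> s \<and> s \<le> t \<and> t \<le> T \<longrightarrow> norm (\<Phi> N t s - \<Phi> M t s) \<le> e) \<and>
    ito_bounded P T e (\<lambda>s \<omega>. w N s \<omega> - w M s \<omega>)" (is "\<exists>N0\<ge>1. \<forall>N>N0. \<forall>M>N0. ?close N M")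
proof -
  \<comment> \<open>the variance \<open>e T / 8\<close> at time \<open>T\<close> is what \<open>noise_difference_ito_bounded\<close> needs for the constant \<open>e\<close>\<close>
  define d where "d = min e (e * T / 8)"
  have d: "d > 0" "d \<le> e" "d \<le> e * T / 8" using e T by (auto simp: d_def)
  obtain N0 where N0: "\<forall>N M. N > M \<and> M > N0 \<longrightarrow>
        norm (x0 N - x0 M) \<le> d \<and>
        (\<forall>s t. 0 \<le> s \<and> s \<le> t \<and> t \<le> T \<longrightarrow> norm (\<Phi> N t s - \<Phi> M t s) \<le> d) \<and>
        mean_square P (\<lambda>\<omega>. w N T \<omega> - w M T \<omega>) \<le> ennreal d"
    using cauchy[OF d(1)] ..
  have less: "?close N M" if NM: "M < N" "max 1 N0 < M" for N M
  proof -
    have "M > N0" "N \<ge> 1" "M \<ge> 1" using NM by auto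
    with N0 NM have c: "norm (x0 N - x0 M) \<le> d"
      "\<forall>s t. 0 \<le> s \<and> s \<le> t \<and> t \<le> T \<longrightarrow> norm (\<Phi> N t s - \<Phi> M t s) \<le> d"
      "mean_square P (\<lambda>\<omega>. w N T \<omega> - w M T \<omega>) \<le> ennreal d" by blast+
    have "ito_bounded P T e (\<lambda>s \<omega>. w N s \<omega> - w M s \<omega>)"
      by (rule noise_difference_ito_bounded[OF \<open>N \<ge> 1\<close> \<open>M \<ge> 1\<close> e order_trans[OF c(3) ennreal_leI[OF d(3)]]])
    with c(1,2) d(2) show ?thesis by (meson order_trans)
  qed
  have "?close N M" if NM: "max 1 N0 < N" "max 1 N0 < M" for N M
  proof (rule linorder_cases[of N M])
    assume "M < N"
    then show ?thesis using less NM by blast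
  next
    assume "N = M"
    then show ?thesis using e ito_bounded_zero[of e P T] by simp
  next
    assume "N < M"
    from less[OF this NM(1)] show ?thesis
      using ito_bounded_minus_commute[of P T e "w M" "w N"] by (simp add: norm_minus_commute)
  qed
  then show ?thesis by (intro exI[of _ "max 1 N0"]) auto
qed

text \<open>Bounds that are uniform in \<open>N\<close> follow by comparison with one fixed system.\<close>
lemma eventually_bounded:
  "\<exists>N1\<ge>1. \<exists>X L \<kappa>. X \<ge> 0 \<and> L \<ge> 0 \<and> \<kappa> \<ge> 0 \<and> (\<forall>N>N1. norm (x0 N) \<le> X \<and>
     (\<forall>s t. 0 \<le> s \<and> s \<le> t \<and> t \<le> T \<longrightarrow> norm (\<Phi> N t s) \<le> L) \<and> ito_bounded P T \<kappa> (w N))"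
proof -
  obtain N1 where N1: "N1 \<ge> 1" and close: "\<And>N M. N > N1 \<Longrightarrow> M > N1 \<Longrightarrow> norm (x0 N - x0 M) \<le> 1 \<and>
    (\<forall>s t. 0 \<le> s \<and> s \<le> t \<and> t \<le> T \<longrightarrow> norm (\<Phi> N t s - \<Phi> M t s) \<le> 1) \<and>
    ito_bounded P T 1 (\<lambda>s \<omega>. w N s \<omega> - w M s \<omega>)"
    using eventually_close[of 1] by auto
  define M where "M = Suc N1"
  have M: "M > N1" "M \<ge> 1" by (auto simp: M_def)
  obtain L where L: "\<And>s t. 0 \<le> s \<Longrightarrow> s \<le> t \<Longrightarrow> t \<le> T \<Longrightarrow> norm (\<Phi> M t s) \<le> L"
    using solution_operator_bounded[OF \<Phi>[OF M(2)] A[OF M(2)]] by blast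
  have L0: "L \<ge> 0" using L[of 0 0] T norm_ge_zero[of "\<Phi> M 0 0"] by linarith
  obtain \<kappa> where \<kappa>: "ito_bounded P T \<kappa> (w M)" using noise_ito_bounded[OF M(2)] ..
  have \<kappa>0: "\<kappa> \<ge> 0" using \<kappa> by (simp add: ito_bounded_def)
  have "norm (x0 N) \<le> norm (x0 M) + 1 \<and>
     (\<forall>s t. 0 \<le> s \<and> s \<le> t \<and> t \<le> T \<longrightarrow> norm (\<Phi> N t s) \<le> L + 1) \<and> ito_bounded P T (2 * 1 + 2 * \<kappa>) (w N)"
    if N: "N > N1" for N
  proof (intro conjI allI impI)
    show "norm (x0 N) \<le> norm (x0 M) + 1"
      using close[OF N M(1)] norm_triangle_ineq2[of "x0 N" "x0 M"] by linarith
    show "norm (\<Phi> N t s) \<le> L + 1" if st: "0 \<le> s \<and> s \<le> t \<and> t \<le> T" for s t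
    proof -
      have "norm (\<Phi> N t s - \<Phi> M t s) \<le> 1" using close[OF N M(1)] st by blast
      then show ?thesis using L[of s t] st norm_triangle_ineq2[of "\<Phi> N t s" "\<Phi> M t s"] by linarith
    qed
    show "ito_bounded P T (2 * 1 + 2 * \<kappa>) (w N)"
    proof (rule ito_bounded_from_difference[OF _ \<kappa>])
      show "ito_bounded P T 1 (\<lambda>s \<omega>. w N s \<omega> - w M s \<omega>)" using close[OF N M(1)] by blast
    qed (use N N1 w_measurable in auto)
  qed
  then show ?thesis
    using L0 \<kappa>0 N1
    by (intro exI[of _ N1] conjI exI[of _ "norm (x0 M) + 1"] exI[of _ "L + 1"] exI[of _ "2 * 1 + 2 * \<kappa>"]) auto
qed

text \<open>If all three differences of the data are at most \<open>d \<le> 1\<close>, then the bound for the difference of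
  two mild solutions is at most \<open>d C\<close> with \<open>C\<close> depending on the uniform bounds alone.\<close>
lemma states_cauchy:
  assumes e: "e > 0"
  shows "\<exists>N0\<ge>1. \<forall>N>N0. \<forall>M>N0. \<forall>t\<in>{0..T}. mean_square P (\<lambda>\<omega>. x N t \<omega> - x M t \<omega>) \<le> ennreal e"
proof -
  obtain N1 X L \<kappa> where N1: "N1 \<ge> 1" and pos: "X \<ge> 0" "L \<ge> 0" "\<kappa> \<ge> 0"
    and all: "\<forall>N>N1. norm (x0 N) \<le> X \<and>
      (\<forall>s t. 0 \<le> s \<and> s \<le> t \<and> t \<le> T \<longrightarrow> norm (\<Phi> N t s) \<le> L) \<and> ito_bounded P T \<kappa> (w N)"
    using eventually_bounded by (elim exE conjE) (rule that)
  have bd: "\<And>N. N > N1 \<Longrightarrow> norm (x0 N) \<le> X"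
      "\<And>N s t. N > N1 \<Longrightarrow> 0 \<le> s \<Longrightarrow> s \<le> t \<Longrightarrow> t \<le> T \<Longrightarrow> norm (\<Phi> N t s) \<le> L"
      "\<And>N. N > N1 \<Longrightarrow> ito_bounded P T \<kappa> (w N)"
    using all by auto
  \<comment> \<open>differences of size \<open>d\<close> give \<open>\<rho> = d (X + L)\<close>, \<open>\<delta> = d\<close> and \<open>\<eta> = d\<close>, and \<open>d\<^sup>2 \<le> d\<close>\<close>
  define C where "C = 2 * (X + L)\<^sup>2 + 16 * (L\<^sup>2 * T + \<kappa> * T)"
  have C: "C \<ge> 0" using pos T by (simp add: C_def)
  define d where "d = min 1 (e / (C + 1))"
  have d: "0 < d" "d \<le> 1" using e C by (auto simp: d_def)
  have "d * C \<le> e / (C + 1) * C" using C by (intro mult_right_mono) (auto simp: d_def)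
  also have "\<dots> \<le> e" using C e by (simp add: field_simps)
  finally have dC: "d * C \<le> e" .
  obtain N2 where close: "\<And>N M. N > N2 \<Longrightarrow> M > N2 \<Longrightarrow> norm (x0 N - x0 M) \<le> d \<and>
    (\<forall>s t. 0 \<le> s \<and> s \<le> t \<and> t \<le> T \<longrightarrow> norm (\<Phi> N t s - \<Phi> M t s) \<le> d) \<and>
    ito_bounded P T d (\<lambda>s \<omega>. w N s \<omega> - w M s \<omega>)"
    using eventually_close[OF d(1)] by blast
  have "mean_square P (\<lambda>\<omega>. x N t \<omega> - x M t \<omega>) \<le> ennreal e"
    if N: "N > max N1 N2" and M: "M > max N1 N2" and t: "t \<in> {0..T}" for N M t
  proof -
    have NM: "N > N1" "M > N1" "N > N2" "M > N2" "N \<ge> 1" "M \<ge> 1" using N M N1 by auto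
    have c: "norm (x0 N - x0 M) \<le> d" "ito_bounded P T d (\<lambda>s \<omega>. w N s \<omega> - w M s \<omega>)"
      "\<And>s t. 0 \<le> s \<Longrightarrow> s \<le> t \<Longrightarrow> t \<le> T \<Longrightarrow> norm (\<Phi> N t s - \<Phi> M t s) \<le> d"
      using close[OF NM(3,4)] by blast+
    have "norm (\<Phi> N t 0 (x0 N) - \<Phi> M t 0 (x0 M)) =
        norm ((\<Phi> N t 0 - \<Phi> M t 0) (x0 N) + \<Phi> M t 0 (x0 N - x0 M))"
      by (simp add: blinfun.diff_left blinfun.diff_right)
    also have "\<dots> \<le> norm ((\<Phi> N t 0 - \<Phi> M t 0) (x0 N)) + norm (\<Phi> M t 0 (x0 N - x0 M))"
      by (rule norm_triangle_ineq)
    also have "\<dots> \<le> norm (\<Phi> N t 0 - \<Phi> M t 0) * norm (x0 N) + norm (\<Phi> M t 0) * norm (x0 N - x0 M)"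
      by (intro add_mono norm_blinfun)
    also have "\<dots> \<le> d * X + L * d"
      using t d pos NM by (intro add_mono mult_mono c bd) auto
    finally have \<rho>: "norm (\<Phi> N t 0 (x0 N) - \<Phi> M t 0 (x0 M)) \<le> d * X + L * d" .
    have "mean_square P (\<lambda>\<omega>. x N t \<omega> - x M t \<omega>) \<le>
        ennreal (2 * (d * X + L * d)\<^sup>2 + 16 * (d * (L\<^sup>2 * t) + \<kappa> * (d\<^sup>2 * t)))"
      by (rule mild_solution_difference_bound[OF prob x[OF NM(5)] x[OF NM(6)] A[OF NM(5)] A[OF NM(6)]
            t w_measurable[OF NM(5)] bd(3)[OF NM(2)] c(2) \<rho> bd(2)[OF NM(1)] c(3)])
         (use t in auto)
    also have "\<dots> \<le> ennreal (d * C)"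
    proof (rule ennreal_leI)
      have d2: "d\<^sup>2 \<le> d" using d by (simp add: power2_eq_square mult_left_le)
      have "(d * X + L * d)\<^sup>2 = d\<^sup>2 * (X + L)\<^sup>2" by (simp add: power2_eq_square algebra_simps)
      also have "\<dots> \<le> d * (X + L)\<^sup>2" using d2 by (intro mult_right_mono) auto
      finally have 1: "(d * X + L * d)\<^sup>2 \<le> d * (X + L)\<^sup>2" .
      have 2: "d * (L\<^sup>2 * t) \<le> d * (L\<^sup>2 * T)" using t d by (intro mult_left_mono) auto
      have "d\<^sup>2 * t \<le> d * T" using t d d2 by (intro mult_mono) auto
      then have 3: "\<kappa> * (d\<^sup>2 * t) \<le> \<kappa> * (d * T)" using pos by (intro mult_left_mono) auto
      have "d * C = 2 * (d * (X + L)\<^sup>2) + 16 * (d * (L\<^sup>2 * T) + \<kappa> * (d * T))"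
        by (simp add: C_def algebra_simps)
      then show "2 * (d * X + L * d)\<^sup>2 + 16 * (d * (L\<^sup>2 * t) + \<kappa> * (d\<^sup>2 * t)) \<le> d * C"
        using add_mono[OF mult_left_mono[OF 1, of 2] mult_left_mono[OF add_mono[OF 2 3], of 16]] by simp
    qed
    also have "\<dots> \<le> ennreal e" by (rule ennreal_leI[OF dC])
    finally show ?thesis .
  qed
  then show ?thesis using N1 by (intro exI[of _ "max N1 N2"]) auto
qed

lemma states_L1_cauchy:
  assumes e: "e > 0"
  shows "\<exists>N0. \<forall>N M. N > N0 \<and> M > N0 \<longrightarrow>
    (\<forall>t\<in>{0..T}. E_nonneg P (\<lambda>\<omega>. norm (x N t \<omega> - x M t \<omega>)) < ennreal e)"
proof -
  obtain N0 where N0: "N0 \<ge> 1" and c: "\<And>N M t. N > N0 \<Longrightarrow> M > N0 \<Longrightarrow> t \<in> {0..T} \<Longrightarrow>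
      mean_square P (\<lambda>\<omega>. x N t \<omega> - x M t \<omega>) \<le> ennreal ((e/2)\<^sup>2/4)"
    using states_cauchy[of "(e/2)\<^sup>2/4"] e by auto
  have "E_nonneg P (\<lambda>\<omega>. norm (x N t \<omega> - x M t \<omega>)) < ennreal e"
    if NM: "N > N0" "M > N0" and t: "t \<in> {0..T}" for N M t
  proof -
    have "E_nonneg P (\<lambda>\<omega>. norm (x N t \<omega> - x M t \<omega>)) \<le> ennreal (e/2)"
      by (rule E_norm_le_sqrt[OF prob _ _ c[OF NM t]])
         (use NM N0 t e x_measurable in \<open>auto intro!: borel_measurable_diff\<close>)
    also have "\<dots> < ennreal e" using e by (intro ennreal_lessI) auto
    finally show ?thesis .
  qed
  then show ?thesis by blast
qed

text \<open>The system with index 0 is unconstrained, in particular its state need not be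
  measurable; hence the shifted sequence.\<close>
lemma limit_state_exists:
  "\<exists>x_lim. \<forall>t\<in>{0..T}. x_lim t \<in> borel_measurable P \<and>
     (\<lambda>N. mean_square P (\<lambda>\<omega>. x N t \<omega> - x_lim t \<omega>)) \<longlonglongrightarrow> 0"
proof (rule bchoice, rule ballI)
  fix t assume t: "t \<in> {0..T}"
  have "\<exists>y. y \<in> borel_measurable P \<and> (\<lambda>n. mean_square P (\<lambda>\<omega>. x (Suc n) t \<omega> - y \<omega>)) \<longlonglongrightarrow> 0"
  proof (rule mean_square_complete)
    show "finite_measure P" using prob by (rule prob_space.finite_measure)
    show "x (Suc n) t \<in> borel_measurable P" for n using x_measurable[of "Suc n" t] t by simp
    fix e :: real assume "e > 0"
    then obtain N0 where "\<And>N M. N > N0 \<Longrightarrow> M > N0 \<Longrightarrow> mean_square P (\<lambda>\<omega>. x N t \<omega> - x M t \<omega>) \<le> ennreal e"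
      using states_cauchy[of e] t by blast
    then show "\<exists>N. \<forall>m\<ge>N. \<forall>n\<ge>N. mean_square P (\<lambda>\<omega>. x (Suc m) t \<omega> - x (Suc n) t \<omega>) \<le> ennreal e"
      by (intro exI[of _ N0]) auto
  qed
  then show "\<exists>y. y \<in> borel_measurable P \<and> (\<lambda>N. mean_square P (\<lambda>\<omega>. x N t \<omega> - y \<omega>)) \<longlonglongrightarrow> 0"
    using LIMSEQ_imp_Suc by fastforce
qed

lemma limit_L1:
  assumes t: "t \<in> {0..T}" and y: "y \<in> borel_measurable P"
    and lim: "(\<lambda>N. mean_square P (\<lambda>\<omega>. x N t \<omega> - y \<omega>)) \<longlonglongrightarrow> 0"
  shows "(\<lambda>N. E_nonneg P (\<lambda>\<omega>. norm (x N t \<omega> - y \<omega>))) \<longlonglongrightarrow> 0"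
proof (rule LIMSEQ_imp_Suc)
  show "(\<lambda>n. E_nonneg P (\<lambda>\<omega>. norm (x (Suc n) t \<omega> - y \<omega>))) \<longlonglongrightarrow> 0"
    using LIMSEQ_Suc[OF lim] x_measurable t y by (intro E_norm_tendsto_0[OF prob]) auto
qed

text \<open>For fixed \<open>N\<close> the process \<open>w_lim - w N\<close> is the mean-square limit of \<open>w M - w N\<close> as \<open>M \<rightarrow> \<infinity>\<close>, so
  Ito constants pass to it.\<close>
lemma limit_noise_ito_bounded:
  assumes w_lim: "\<And>t. t \<in> {0..T} \<Longrightarrow> mean_square_limit P (\<lambda>N. w N t) (w_lim t)"
  shows "\<exists>\<kappa>. ito_bounded P T \<kappa> w_lim"
    and "e > 0 \<Longrightarrow> \<forall>\<^sub>F N in sequentially. ito_bounded P T e (\<lambda>s \<omega>. w_lim s \<omega> - w N s \<omega>)"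
proof -
  have lim_meas: "w_lim s \<in> borel_measurable P"
    and lim: "(\<lambda>n. mean_square P (\<lambda>\<omega>. w (Suc n) s \<omega> - w_lim s \<omega>)) \<longlonglongrightarrow> 0"
    if "s \<in> {0..T}" for s
    using w_lim[OF that] LIMSEQ_Suc by (auto simp: mean_square_limit_def)
  obtain N1 \<kappa> where "\<And>N. N > N1 \<Longrightarrow> ito_bounded P T \<kappa> (w N)"
    using eventually_bounded by blast
  then have ev: "\<forall>\<^sub>F n in sequentially. ito_bounded P T \<kappa> (w (Suc n))"
    unfolding eventually_sequentially by (intro exI[of _ N1]) auto
  have "ito_bounded P T (2 * \<kappa>) w_lim"
    by (rule ito_bounded_limit[OF _ _ _ ev]) (use w_measurable lim_meas lim in auto)
  then show "\<exists>\<kappa>. ito_bounded P T \<kappa> w_lim" ..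
  assume e: "e > 0"
  then obtain N0 where N0: "N0 \<ge> 1"
    "\<And>N M. N > N0 \<Longrightarrow> M > N0 \<Longrightarrow> ito_bounded P T (e/2) (\<lambda>s \<omega>. w N s \<omega> - w M s \<omega>)"
    using eventually_close[of "e/2"] by (meson half_gt_zero)
  have "ito_bounded P T (2 * (e/2)) (\<lambda>s \<omega>. w_lim s \<omega> - w N s \<omega>)" if N: "N > N0" for N
  proof (rule ito_bounded_limit)
    show "\<forall>\<^sub>F n in sequentially. ito_bounded P T (e/2) (\<lambda>s \<omega>. w (Suc n) s \<omega> - w N s \<omega>)"
      unfolding eventually_sequentially using N0(2) N by (intro exI[of _ N0]) auto
    fix s assume s: "s \<in> {0..T}"
    have [measurable]: "w N s \<in> borel_measurable P" "w_lim s \<in> borel_measurable P"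
      "w (Suc n) s \<in> borel_measurable P" for n
      using w_measurable[OF _ s] lim_meas[OF s] N N0(1) by auto
    show "(\<lambda>\<omega>. w (Suc n) s \<omega> - w N s \<omega>) \<in> borel_measurable P" for n by measurable
    show "(\<lambda>\<omega>. w_lim s \<omega> - w N s \<omega>) \<in> borel_measurable P" by measurable
    show "(\<lambda>n. mean_square P (\<lambda>\<omega>. w (Suc n) s \<omega> - w N s \<omega> - (w_lim s \<omega> - w N s \<omega>))) \<longlonglongrightarrow> 0"
      using lim[OF s] by simp
  qed
  then show "\<forall>\<^sub>F N in sequentially. ito_bounded P T e (\<lambda>s \<omega>. w_lim s \<omega> - w N s \<omega>)"
    unfolding eventually_sequentially by (intro exI[of _ "Suc N0"]) auto
qed

text \<open>The Cauchy estimate is uniform in \<open>s\<close>; letting \<open>M \<rightarrow> \<infinity>\<close> in it makes the pointwise convergence uniform.\<close>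
lemma solution_operators_uniform_limit:
  assumes \<Phi>_lim: "\<And>s t. 0 \<le> s \<Longrightarrow> s \<le> t \<Longrightarrow> t \<le> T \<Longrightarrow> (\<lambda>N. \<Phi> N t s) \<longlonglongrightarrow> \<Phi>_lim t s"
    and t: "t \<in> {0..T}" and e: "e > 0"
  shows "\<forall>\<^sub>F N in sequentially. \<forall>s\<in>{0..t}. norm (\<Phi> N t s - \<Phi>_lim t s) \<le> e"
proof -
  obtain N0 where N0: "\<And>N M s t. N > N0 \<Longrightarrow> M > N0 \<Longrightarrow> 0 \<le> s \<Longrightarrow> s \<le> t \<Longrightarrow> t \<le> T \<Longrightarrow>
      norm (\<Phi> N t s - \<Phi> M t s) \<le> e"
    using eventually_close[OF e] by blast
  have "norm (\<Phi> N t s - \<Phi>_lim t s) \<le> e" if N: "N > N0" and s: "s \<in> {0..t}" for N s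
  proof (rule LIMSEQ_le_const2)
    show "(\<lambda>M. norm (\<Phi> N t s - \<Phi> M t s)) \<longlonglongrightarrow> norm (\<Phi> N t s - \<Phi>_lim t s)"
      using s t by (intro tendsto_intros \<Phi>_lim) auto
    show "\<exists>M0. \<forall>M\<ge>M0. norm (\<Phi> N t s - \<Phi> M t s) \<le> e"
      using N0[OF N] s t by (intro exI[of _ "Suc N0"]) auto
  qed
  then show ?thesis
    unfolding eventually_sequentially by (intro exI[of _ "Suc N0"]) auto
qed

text \<open>The mild formula leaves only one candidate \<open>K\<close> for the stochastic integral; it is the mean-square
  limit of the stochastic integrals \<open>J n\<close> of the approximating systems.\<close>
lemma limit_mild_solution:
  assumes x_lim: "\<And>t. t \<in> {0..T} \<Longrightarrow> x_lim t \<in> borel_measurable P"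
      "\<And>t. t \<in> {0..T} \<Longrightarrow> (\<lambda>N. mean_square P (\<lambda>\<omega>. x N t \<omega> - x_lim t \<omega>)) \<longlonglongrightarrow> 0"
    and x0_lim: "x0 \<longlonglongrightarrow> x0_lim"
    and w_lim: "\<And>t. t \<in> {0..T} \<Longrightarrow> mean_square_limit P (\<lambda>N. w N t) (w_lim t)"
    and A_lim: "bounded (A_lim ` {0..T})" and \<Phi>_lim: "solution_operator T A_lim \<Phi>_lim"
    and \<Phi>_conv: "\<And>s t. 0 \<le> s \<Longrightarrow> s \<le> t \<Longrightarrow> t \<le> T \<Longrightarrow> (\<lambda>N. \<Phi> N t s) \<longlonglongrightarrow> \<Phi>_lim t s"
  shows "mild_solution P T A_lim \<Phi>_lim w_lim x0_lim x_lim"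
  unfolding mild_solution_def
proof (intro conjI ballI \<Phi>_lim x_lim(1))
  fix t assume t: "t \<in> {0..T}"
  have cont: "continuous_on {0..t} (\<Phi> (Suc n) t)" for n
    by (rule solution_operator_continuous[OF \<Phi> A t]) auto
  define K where "K \<omega> = x_lim t \<omega> - \<Phi>_lim t 0 x0_lim" for \<omega>
  have "\<forall>n. \<exists>J. has_stochastic_integral P (w (Suc n)) t (\<Phi> (Suc n) t) J \<and>
      (AE \<omega> in P. x (Suc n) t \<omega> = \<Phi> (Suc n) t 0 (x0 (Suc n)) + J \<omega>)"
    using mild_solutionD[OF x t] by simp
  from choice[OF this] obtain J where
    J: "\<And>n. has_stochastic_integral P (w (Suc n)) t (\<Phi> (Suc n) t) (J n)"
    and xJ: "\<And>n. AE \<omega> in P. x (Suc n) t \<omega> = \<Phi> (Suc n) t 0 (x0 (Suc n)) + J n \<omega>"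
    by blast
  have [measurable]: "x_lim t \<in> borel_measurable P" "x (Suc n) t \<in> borel_measurable P" for n
    using x_lim(1)[OF t] x_measurable[OF _ t] by auto
  have K_meas: "K \<in> borel_measurable P" unfolding K_def[abs_def] by measurable
  have "has_stochastic_integral P w_lim t (\<Phi>_lim t) K"
  proof (rule stochastic_integral_limit[OF t J cont])
    show "continuous_on {0..t} (\<Phi>_lim t)" by (rule solution_operator_continuous[OF \<Phi>_lim A_lim t])
    show "w (Suc n) s \<in> borel_measurable P" if "s \<in> {0..T}" for n s
      using w_measurable[OF _ that] by simp
    show "w_lim s \<in> borel_measurable P" if "s \<in> {0..T}" for s
      using w_lim[OF that] by (simp add: mean_square_limit_def)
    show "\<forall>\<^sub>F n in sequentially. \<forall>s\<in>{0..t}. norm (\<Phi> (Suc n) t s - \<Phi>_lim t s) \<le> e" if "e > 0" for e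
      using solution_operators_uniform_limit[OF \<Phi>_conv t that] by (subst eventually_sequentially_Suc)
    show "\<forall>\<^sub>F n in sequentially. ito_bounded P T e (\<lambda>s \<omega>. w_lim s \<omega> - w (Suc n) s \<omega>)" if "e > 0" for e
      using limit_noise_ito_bounded(2)[OF w_lim that]
      by (subst eventually_sequentially_Suc[where P = "\<lambda>N. ito_bounded P T e (\<lambda>s \<omega>. w_lim s \<omega> - w N s \<omega>)"])
    have "(\<lambda>n. norm (\<Phi>_lim t 0 x0_lim - \<Phi> (Suc n) t 0 (x0 (Suc n)))) \<longlonglongrightarrow> norm (\<Phi>_lim t 0 x0_lim - \<Phi>_lim t 0 x0_lim)"
      using t by (intro tendsto_norm tendsto_diff tendsto_const blinfun.tendsto
          LIMSEQ_Suc[OF \<Phi>_conv] LIMSEQ_Suc[OF x0_lim]) auto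
    then have "(\<lambda>n. ennreal ((norm (\<Phi>_lim t 0 x0_lim - \<Phi> (Suc n) t 0 (x0 (Suc n))))\<^sup>2)) \<longlonglongrightarrow>
        ennreal ((norm (\<Phi>_lim t 0 x0_lim - \<Phi>_lim t 0 x0_lim))\<^sup>2)"
      by (intro tendsto_ennrealI tendsto_power)
    then have init: "(\<lambda>n. mean_square P (\<lambda>\<omega>. \<Phi>_lim t 0 x0_lim - \<Phi> (Suc n) t 0 (x0 (Suc n)))) \<longlonglongrightarrow> 0"
      unfolding mean_square_const[OF prob] by simp
    show "(\<lambda>n. mean_square P (\<lambda>\<omega>. J n \<omega> - K \<omega>)) \<longlonglongrightarrow> 0"
    proof (rule ennreal_tendsto_0_squeeze[OF mean_square_triangle
          ennreal_tendsto_0_combine[OF LIMSEQ_Suc[OF x_lim(2)[OF t]] init]])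
      show "AE \<omega> in P. norm (J n \<omega> - K \<omega>) \<le>
          norm (x (Suc n) t \<omega> - x_lim t \<omega>) + norm (\<Phi>_lim t 0 x0_lim - \<Phi> (Suc n) t 0 (x0 (Suc n)))" for n
        using xJ[of n]
      proof eventually_elim
        case (elim \<omega>)
        then have "J n \<omega> - K \<omega> = (x (Suc n) t \<omega> - x_lim t \<omega>) + (\<Phi>_lim t 0 x0_lim - \<Phi> (Suc n) t 0 (x0 (Suc n)))"
          by (simp add: K_def)
        then show ?case by (metis norm_triangle_ineq)
      qed
    qed auto
  qed (rule K_meas)
  moreover have "AE \<omega> in P. x_lim t \<omega> = \<Phi>_lim t 0 x0_lim + K \<omega>" by (simp add: K_def)
  ultimately show "\<exists>J. has_stochastic_integral P w_lim t (\<Phi>_lim t) J \<and>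
      (AE \<omega> in P. x_lim t \<omega> = \<Phi>_lim t 0 x0_lim + J \<omega>)" by blast
qed

end

theorem theorem2p3:
  fixes P :: "'a measure" and T :: real
    and A :: "nat \<Rightarrow> real \<Rightarrow> nat \<Rightarrow> nat \<Rightarrow> real" and a :: "nat \<Rightarrow> real \<Rightarrow> real"
    and \<Phi> :: "nat \<Rightarrow> real \<Rightarrow> real \<Rightarrow> L2 \<Rightarrow>\<^sub>L L2"
    and W :: "nat \<Rightarrow> real \<Rightarrow> 'a \<Rightarrow> real" and c :: "nat \<Rightarrow> nat \<Rightarrow> nat \<Rightarrow> real"
    and w :: "nat \<Rightarrow> real \<Rightarrow> 'a \<Rightarrow> L2" and Q :: "nat \<Rightarrow> nat \<Rightarrow> nat \<Rightarrow> real"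
    and x0 :: "nat \<Rightarrow> L2" and x :: "nat \<Rightarrow> real \<Rightarrow> 'a \<Rightarrow> L2"
  assumes "prob_space P" and "T > 0"
    and W: "independent_brownian_motions P W {1..}"
    and A_symmetric: "\<And>N t i j. N \<ge> 1 \<Longrightarrow> t \<in> {0..T} \<Longrightarrow> i \<in> {1..N} \<Longrightarrow> j \<in> {1..N} \<Longrightarrow>
          A N t i j = A N t j i"
    and A_bounded: "\<And>N. N \<ge> 1 \<Longrightarrow> bounded ((\<lambda>t. graphon_operator N (A N t) (a N t)) ` {0..T})"
    and \<Phi>: "\<And>N. N \<ge> 1 \<Longrightarrow> solution_operator T (\<lambda>t. graphon_operator N (A N t) (a N t)) (\<Phi> N)"
    and w: "\<And>N. N \<ge> 1 \<Longrightarrow> step_noise P N (c N) W (w N)"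
    and Q: "\<And>N. N \<ge> 1 \<Longrightarrow>
          noise_covariance_operator P (w N) (integral_operator (step_kernel N (Q N)))"
    and x: "\<And>N. N \<ge> 1 \<Longrightarrow>
          mild_solution P T (\<lambda>t. graphon_operator N (A N t) (a N t)) (\<Phi> N) (w N) (x0 N) (x N)"
    and cauchy: "\<And>\<epsilon>\<^sub>0 \<epsilon>\<^sub>1 \<epsilon>\<^sub>2 :: real. \<epsilon>\<^sub>0 > 0 \<Longrightarrow> \<epsilon>\<^sub>1 > 0 \<Longrightarrow> \<epsilon>\<^sub>2 > 0 \<Longrightarrow>
          \<exists>N\<^sub>0. \<forall>N M. N > M \<and> M > N\<^sub>0 \<longrightarrow>
            (norm (x0 N - x0 M))\<^sup>2 < \<epsilon>\<^sub>0 \<and>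
            (\<forall>s t. 0 \<le> s \<and> s \<le> t \<and> t \<le> T \<longrightarrow> (norm (\<Phi> N t s - \<Phi> M t s))\<^sup>2 < \<epsilon>\<^sub>1) \<and>
            (\<forall>t\<in>{0..T}. E_nonneg P (\<lambda>\<omega>. (norm (w N t \<omega> - w M t \<omega>))\<^sup>2) < ennreal \<epsilon>\<^sub>2)"
    and c_bound: "\<exists>C. \<forall>N\<ge>1. (\<Sum>k=1..N. \<Sum>r=1..N. \<bar>c N k r\<bar>\<^sup>2) \<le> C"
    and \<Phi>_bound: "\<exists>\<alpha>. \<forall>N\<ge>1. \<forall>t\<in>{0..T}. (LBINT s:{0..t}. (norm (\<Phi> N t s))\<^sup>2) \<le> \<alpha>"
  shows "(\<forall>\<epsilon>>0. \<exists>N\<^sub>0. \<forall>N M. N > N\<^sub>0 \<and> M > N\<^sub>0 \<longrightarrow>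
            (\<forall>t\<in>{0..T}. E_nonneg P (\<lambda>\<omega>. norm (x N t \<omega> - x M t \<omega>)) < ennreal \<epsilon>)) \<and>
         (\<exists>x_lim.
            (\<forall>t\<in>{0..T}. x_lim t \<in> borel_measurable P \<and>
               (\<lambda>N. E_nonneg P (\<lambda>\<omega>. norm (x N t \<omega> - x_lim t \<omega>))) \<longlonglongrightarrow> 0) \<and>
            (\<forall>A_lim \<Phi>_lim w_lim x0_lim.
               x0 \<longlonglongrightarrow> x0_lim \<and>
               (\<forall>t\<in>{0..T}. mean_square_limit P (\<lambda>N. w N t) (w_lim t)) \<and>
               bounded (A_lim ` {0..T}) \<and>
               solution_operator T A_lim \<Phi>_lim \<and>
               (\<forall>s t. 0 \<le> s \<and> s \<le> t \<and> t \<le> T \<longrightarrow> (\<lambda>N. \<Phi> N t s) \<longlonglongrightarrow> \<Phi>_lim t s) \<longrightarrow>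
               mild_solution P T A_lim \<Phi>_lim w_lim x0_lim x_lim \<and>
               (\<forall>y. mild_solution P T A_lim \<Phi>_lim w_lim x0_lim y \<longrightarrow>
                  (\<forall>t\<in>{0..T}. AE \<omega> in P. y t \<omega> = x_lim t \<omega>))))"
proof -
  interpret convergent_systems P T W "\<lambda>N t. graphon_operator N (A N t) (a N t)" \<Phi> w x0 x
  proof (rule convergent_systems.intro)
    show "\<exists>g. \<forall>t\<ge>0. mean_square_limit P (\<lambda>n \<omega>. \<Sum>r=1..n. W r t \<omega> *\<^sub>R g r) (w N t)" if "N \<ge> 1" for N
      by (rule step_noise_series[OF w[OF that]])
    fix e :: real assume e: "e > 0"
    then have "e\<^sup>2 > 0" by simp
    from cauchy[OF this this e] obtain N0 where N0: "\<forall>N M. N > M \<and> M > N0 \<longrightarrow>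
        (norm (x0 N - x0 M))\<^sup>2 < e\<^sup>2 \<and>
        (\<forall>s t. 0 \<le> s \<and> s \<le> t \<and> t \<le> T \<longrightarrow> (norm (\<Phi> N t s - \<Phi> M t s))\<^sup>2 < e\<^sup>2) \<and>
        (\<forall>t\<in>{0..T}. mean_square P (\<lambda>\<omega>. w N t \<omega> - w M t \<omega>) < ennreal e)" ..
    have sq: "y < e" if "y\<^sup>2 < e\<^sup>2" for y :: real
      using that e by (intro power2_less_imp_less[of y e]) auto
    have "T \<in> {0..T}" using \<open>T > 0\<close> by simp
    with N0 sq show "\<exists>N0. \<forall>N M. N > M \<and> M > N0 \<longrightarrow>
        norm (x0 N - x0 M) \<le> e \<and>
        (\<forall>s t. 0 \<le> s \<and> s \<le> t \<and> t \<le> T \<longrightarrow> norm (\<Phi> N t s - \<Phi> M t s) \<le> e) \<and>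
        mean_square P (\<lambda>\<omega>. w N T \<omega> - w M T \<omega>) \<le> ennreal e"
      by (intro exI[of _ N0]) (blast intro: less_imp_le)
  qed fact+
  obtain x_lim where meas: "\<And>t. t \<in> {0..T} \<Longrightarrow> x_lim t \<in> borel_measurable P"
    and lim: "\<And>t. t \<in> {0..T} \<Longrightarrow> (\<lambda>N. mean_square P (\<lambda>\<omega>. x N t \<omega> - x_lim t \<omega>)) \<longlonglongrightarrow> 0"
    using limit_state_exists by blast
  show ?thesis
  proof (intro conjI allI impI exI[of _ x_lim] ballI)
    show "\<exists>N\<^sub>0. \<forall>N M. N > N\<^sub>0 \<and> M > N\<^sub>0 \<longrightarrow>
        (\<forall>t\<in>{0..T}. E_nonneg P (\<lambda>\<omega>. norm (x N t \<omega> - x M t \<omega>)) < ennreal \<epsilon>)" if "\<epsilon> > 0" for \<epsilon>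
      by (rule states_L1_cauchy[OF that])
    show "x_lim t \<in> borel_measurable P" if "t \<in> {0..T}" for t by (rule meas[OF that])
    show "(\<lambda>N. E_nonneg P (\<lambda>\<omega>. norm (x N t \<omega> - x_lim t \<omega>))) \<longlonglongrightarrow> 0" if "t \<in> {0..T}" for t
      by (rule limit_L1[OF that meas[OF that] lim[OF that]])
  next
    fix A_lim \<Phi>_lim w_lim x0_lim
    assume *: "x0 \<longlonglongrightarrow> x0_lim \<and>
      (\<forall>t\<in>{0..T}. mean_square_limit P (\<lambda>N. w N t) (w_lim t)) \<and>
      bounded (A_lim ` {0..T}) \<and> solution_operator T A_lim \<Phi>_lim \<and>
      (\<forall>s t. 0 \<le> s \<and> s \<le> t \<and> t \<le> T \<longrightarrow> (\<lambda>N. \<Phi> N t s) \<longlonglongrightarrow> \<Phi>_lim t s)"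
    then have w_lim: "\<And>t. t \<in> {0..T} \<Longrightarrow> mean_square_limit P (\<lambda>N. w N t) (w_lim t)"
      and A_lim: "bounded (A_lim ` {0..T})" by auto
    show mild: "mild_solution P T A_lim \<Phi>_lim w_lim x0_lim x_lim"
      by (rule limit_mild_solution[OF meas lim _ w_lim A_lim]) (use * in auto)
    obtain \<kappa> where "ito_bounded P T \<kappa> w_lim" using limit_noise_ito_bounded(1)[OF w_lim] by blast
    then show "AE \<omega> in P. y t \<omega> = x_lim t \<omega>"
      if "mild_solution P T A_lim \<Phi>_lim w_lim x0_lim y" "t \<in> {0..T}" for y t
      using mild_solution_unique[OF \<open>prob_space P\<close> mild that(1) A_lim _ that(2)] by blast
  qed
qed

end
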